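(* Let $G_\Gamma$ be a graph product of finitely generated groups. There exists $\sigma_0>0$ such that for all $\sigma\ge\sigma_0$ there exist $K\ge1$ and $L\ge0$ such that for all $g,h\in G_\Gamma$ $$\frac1K\sum_{[k\Lambda]\in\mathfrak S_\Gamma}\{\!\{\mathsf d_{[k\Lambda]}(g,h)\}\!\}_\sigma-L\ \le\ \mathsf d(g,h)\ \le\ K\sum_{[k\Lambda]\in\mathfrak S_\Gamma}\{\!\{\mathsf d_{[k\Lambda]}(g,h)\}\!\}_\sigma+L,$$ where $\{\!\{N\}\!\}_\sigma=N$ if $N\ge\sigma$ and $\{\!\{N\}\!\}_\sigma=0$ if $N<\sigma$.
   Context: Let $\Gamma$ be a finite non-empty simplicial graph with each vertex $v$ labelled by a non-trivial finitely generated group $G_v$. The graph product is $G_\Gamma=\left(\ast_{v\in V(\Gamma)}G_v\right)/\langle\langle [g_v,g_w] : g_v\in G_v,\ g_w\in G_w,\ \{v,w\}\in E(\Gamma)\rangle\rangle$. Fix a finite generating set $S_v$ of each $G_v$, let $S=\bigcup_vS_v$, and let $\mathsf d$ be the word metric on $G_\Gamma$ with respect to $S$. Subgraphs are non-empty and induced. For $\Lambda\subseteq\Gamma$, $\langle\Lambda\rangle$ is the subgroup generated by $\{G_v:v\in V(\Lambda)\}$; $\operatorname{lk}(\Lambda)$ is the (possibly empty) subgraph spanned by vertices of $\Gamma\smallsetminus\Lambda$ adjacent to every vertex of $\Lambda$; $\operatorname{st}(\Lambda)=\Lambda\cup\operatorname{lk}(\Lambda)$. Index set: $g\Lambda$ denotes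 the coset $g\langle\Lambda\rangle$; $g\Lambda$ and $h\Lambda$ are parallel if $g^{-1}h\in\langle\operatorname{st}(\Lambda)\rangle$; $[g\Lambda]$ is the parallelism class; $\mathfrak S_\Gamma=\{[g\Lambda]:g\in G_\Gamma,\Lambda\subseteq\Gamma\}$. Syllable metric: $\mathsf d_{syl}$ is the metric on $G_\Gamma$ from the graph with vertex set $G_\Gamma$ and an edge between distinct $g,h$ whenever $g^{-1}h$ lies in some vertex group. The gate map $\mathfrak g_{g\Lambda}:G_\Gamma\to g\langle\Lambda\rangle$ sends $x$ to the unique element of $g\langle\Lambda\rangle$ closest to $x$ in $\mathsf d_{syl}$ (existence and uniqueness are known). Spaces: $C(g\Lambda)$ is the graph with vertex set $g\langle\Lambda\rangle$ in which distinct $x,y$ are joined by an edge if $x^{-1}y\in\langle\Omega\rangle$ for some proper subgraph $\Omega\subsetneq\Lambda$, or $x^{-1}y\in S\cup S^{-1}$ (so if $\Lambda=\{v\}$ it is a copy of the Cayley graph of $G_v$). Its metric is $\mathsf d_{g\Lambda}$. For $x,y\in G_\Gamma$, $\mathsf d_{[k\Lambda]}(x,y)=\mathsf d_{k\Lambda}(\mathfrak g_{k\Lambda}(x),\mathfrak g_{k\Lambda}(y))$, where $k\Lambda$ is a fixed representative of the class (the value does not depend on the representative). *)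

theory Defs
  imports "HOL-Analysis.Analysis" "HOL-Algebra.Algebra"
begin

section \<open>Free products\<close>

definition fp_words :: "'v set \<Rightarrow> ('v \<Rightarrow> ('a, 'b) monoid_scheme) \<Rightarrow> ('v \<times> 'a) list set" where
  "fp_words I G = lists (SIGMA v:I. carrier (G v))"

inductive fp_eq :: "'v set \<Rightarrow> ('v \<Rightarrow> ('a, 'b) monoid_scheme) \<Rightarrow> ('v \<times> 'a) list \<Rightarrow> ('v \<times> 'a) list \<Rightarrow> bool"
  for I G where
  refl: "u \<in> fp_words I G \<Longrightarrow> fp_eq I G u u"
| sym: "fp_eq I G u w \<Longrightarrow> fp_eq I G w u"
| trans: "fp_eq I G u w \<Longrightarrow> fp_eq I G w z \<Longrightarrow> fp_eq I G u z"
| one: "p \<in> fp_words I G \<Longrightarrow> q \<in> fp_words I G \<Longrightarrow> v \<in> I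
        \<Longrightarrow> fp_eq I G (p @ [(v, \<one>\<^bsub>G v\<^esub>)] @ q) (p @ q)"
| mult: "p \<in> fp_words I G \<Longrightarrow> q \<in> fp_words I G \<Longrightarrow> v \<in> I
        \<Longrightarrow> x \<in> carrier (G v) \<Longrightarrow> y \<in> carrier (G v)
        \<Longrightarrow> fp_eq I G (p @ [(v, x), (v, y)] @ q) (p @ [(v, x \<otimes>\<^bsub>G v\<^esub> y)] @ q)"

definition fp_rel :: "'v set \<Rightarrow> ('v \<Rightarrow> ('a, 'b) monoid_scheme) \<Rightarrow> (('v \<times> 'a) list \<times> ('v \<times> 'a) list) set" where
  "fp_rel I G = {(u, w). fp_eq I G u w}"

text \<open>The free product of the groups \<open>G v\<close>, \<open>v \<in> I\<close>: words in the disjoint union of the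
  factors, modulo deletion of identity letters and multiplication of adjacent letters from
  the same factor.  All factors live in a common ambient type.\<close>

definition free_product :: "'v set \<Rightarrow> ('v \<Rightarrow> ('a, 'b) monoid_scheme) \<Rightarrow> ('v \<times> 'a) list set monoid" where
  "free_product I G =
     \<lparr>carrier = fp_words I G // fp_rel I G,
      mult = (\<lambda>A B. \<Union>u\<in>A. \<Union>w\<in>B. fp_rel I G `` {u @ w}),
      one = fp_rel I G `` {[]}\<rparr>"

definition fp_incl :: "'v set \<Rightarrow> ('v \<Rightarrow> ('a, 'b) monoid_scheme) \<Rightarrow> 'v \<Rightarrow> 'a \<Rightarrow> ('v \<times> 'a) list set" where
  "fp_incl I G v x = fp_rel I G `` {[(v, x)]}"

section \<open>Generic group and graph notions\<close>

definition normal_closure :: "('a, 'b) monoid_scheme \<Rightarrow> 'a set \<Rightarrow> 'a set" where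
  "normal_closure H A = \<Inter>{N. N \<lhd> H \<and> A \<subseteq> N}"

definition word_length :: "('a, 'b) monoid_scheme \<Rightarrow> 'a set \<Rightarrow> 'a \<Rightarrow> nat" where
  "word_length H A x =
     (LEAST n. \<exists>ws. length ws = n \<and> set ws \<subseteq> A \<union> m_inv H ` A \<and> foldr (mult H) ws \<one>\<^bsub>H\<^esub> = x)"

text \<open>Path metric of a graph given by its set of (ordered) edges.  It is only meaningful for
  vertices in the same connected component; all graphs below are connected.\<close>

definition graph_dist :: "('a \<times> 'a) set \<Rightarrow> 'a \<Rightarrow> 'a \<Rightarrow> nat" where
  "graph_dist R x y = (LEAST n. (x, y) \<in> R ^^ n)"

definition threshold :: "real \<Rightarrow> real \<Rightarrow> real" where
  "threshold \<sigma> N = (if N \<ge> \<sigma> then N else 0)"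

section \<open>Graph products\<close>

text \<open>The non-empty induced subgraphs of the graph \<open>(V, E)\<close> are identified with their vertex
  sets, the non-empty subsets of \<open>V\<close>.\<close>

locale graph_product =
  fixes V :: "'v set"
    and E :: "'v set set"
    and G :: "'v \<Rightarrow> ('a, 'b) monoid_scheme"
    and S :: "'v \<Rightarrow> 'a set"
  assumes finite_V: "finite V"
    and V_nonempty: "V \<noteq> {}"
    and simplicial: "e \<in> E \<Longrightarrow> \<exists>v\<in>V. \<exists>w\<in>V. v \<noteq> w \<and> e = {v, w}"
    and vertex_group: "v \<in> V \<Longrightarrow> group (G v)"
    and vertex_group_nontrivial: "v \<in> V \<Longrightarrow> carrier (G v) \<noteq> {\<one>\<^bsub>G v\<^esub>}"
    and gens_finite: "v \<in> V \<Longrightarrow> finite (S v)"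
    and gens_in_carrier: "v \<in> V \<Longrightarrow> S v \<subseteq> carrier (G v)"
    and gens_generate: "v \<in> V \<Longrightarrow> generate (G v) (S v) = carrier (G v)"
begin

definition commutators :: "('v \<times> 'a) list set set" where
  "commutators =
     {x \<otimes>\<^bsub>free_product V G\<^esub> y \<otimes>\<^bsub>free_product V G\<^esub> inv\<^bsub>free_product V G\<^esub> x
        \<otimes>\<^bsub>free_product V G\<^esub> inv\<^bsub>free_product V G\<^esub> y | v w x y.
      {v, w} \<in> E \<and> x \<in> fp_incl V G v ` carrier (G v) \<and> y \<in> fp_incl V G w ` carrier (G w)}"

definition GP :: "('v \<times> 'a) list set set monoid" where
  "GP = free_product V G Mod normal_closure (free_product V G) commutators"

definition incl :: "'v \<Rightarrow> 'a \<Rightarrow> ('v \<times> 'a) list set set" where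
  "incl v x = normal_closure (free_product V G) commutators #>\<^bsub>free_product V G\<^esub> fp_incl V G v x"

definition gens :: "('v \<times> 'a) list set set set" where
  "gens = (\<Union>v\<in>V. incl v ` S v)"

definition word_dist :: "('v \<times> 'a) list set set \<Rightarrow> ('v \<times> 'a) list set set \<Rightarrow> nat" where
  "word_dist g h = word_length GP gens (inv\<^bsub>GP\<^esub> g \<otimes>\<^bsub>GP\<^esub> h)"

definition subgraphs :: "'v set set" where
  "subgraphs = {\<Lambda>. \<Lambda> \<subseteq> V \<and> \<Lambda> \<noteq> {}}"

definition span :: "'v set \<Rightarrow> ('v \<times> 'a) list set set set" where
  "span \<Lambda> = generate GP (\<Union>v\<in>\<Lambda>. incl v ` carrier (G v))"

definition link :: "'v set \<Rightarrow> 'v set" where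
  "link \<Lambda> = {v \<in> V - \<Lambda>. \<forall>w\<in>\<Lambda>. {v, w} \<in> E}"

definition star :: "'v set \<Rightarrow> 'v set" where
  "star \<Lambda> = \<Lambda> \<union> link \<Lambda>"

text \<open>A coset \<open>g\<Lambda>\<close> is the coset of the subgroup spanned by \<open>\<Lambda>\<close>, with \<open>\<Lambda>\<close> as a label.\<close>

definition labelled_cosets :: "(('v \<times> 'a) list set set set \<times> 'v set) set" where
  "labelled_cosets = {(g <#\<^bsub>GP\<^esub> span \<Lambda>, \<Lambda>) | g \<Lambda>. g \<in> carrier GP \<and> \<Lambda> \<in> subgraphs}"

definition parallel ::
  "((('v \<times> 'a) list set set set \<times> 'v set) \<times> (('v \<times> 'a) list set set set \<times> 'v set)) set" where
  "parallel =
     {((g <#\<^bsub>GP\<^esub> span \<Lambda>, \<Lambda>), (h <#\<^bsub>GP\<^esub> span \<Lambda>, \<Lambda>)) | g h \<Lambda>.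
      g \<in> carrier GP \<and> h \<in> carrier GP \<and> \<Lambda> \<in> subgraphs \<and>
      inv\<^bsub>GP\<^esub> g \<otimes>\<^bsub>GP\<^esub> h \<in> span (star \<Lambda>)}"

definition index_set :: "(('v \<times> 'a) list set set set \<times> 'v set) set set" where
  "index_set = labelled_cosets // parallel"

definition syl_dist :: "('v \<times> 'a) list set set \<Rightarrow> ('v \<times> 'a) list set set \<Rightarrow> nat" where
  "syl_dist = graph_dist
     {(g, h). g \<in> carrier GP \<and> h \<in> carrier GP \<and> g \<noteq> h \<and>
              (\<exists>v\<in>V. inv\<^bsub>GP\<^esub> g \<otimes>\<^bsub>GP\<^esub> h \<in> incl v ` carrier (G v))}"

definition gate :: "('v \<times> 'a) list set set set \<Rightarrow> ('v \<times> 'a) list set set \<Rightarrow> ('v \<times> 'a) list set set" where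
  "gate A x = (THE z. is_arg_min (syl_dist x) (\<lambda>z. z \<in> A) z)"

definition coset_graph ::
  "('v \<times> 'a) list set set set \<Rightarrow> 'v set \<Rightarrow> (('v \<times> 'a) list set set \<times> ('v \<times> 'a) list set set) set" where
  "coset_graph A \<Lambda> =
     {(x, y). x \<in> A \<and> y \<in> A \<and> x \<noteq> y \<and>
        ((\<exists>\<Omega>\<in>subgraphs. \<Omega> \<subset> \<Lambda> \<and> inv\<^bsub>GP\<^esub> x \<otimes>\<^bsub>GP\<^esub> y \<in> span \<Omega>) \<or>
         inv\<^bsub>GP\<^esub> x \<otimes>\<^bsub>GP\<^esub> y \<in> gens \<union> m_inv GP ` gens)}"

definition coset_dist ::
  "('v \<times> 'a) list set set set \<times> 'v set \<Rightarrow> ('v \<times> 'a) list set set \<Rightarrow> ('v \<times> 'a) list set set \<Rightarrow> nat" where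
  "coset_dist = (\<lambda>(A, \<Lambda>) x y. graph_dist (coset_graph A \<Lambda>) (gate A x) (gate A y))"

text \<open>The choice of the representative of the parallelism class is immaterial.\<close>

definition class_dist ::
  "(('v \<times> 'a) list set set set \<times> 'v set) set \<Rightarrow> ('v \<times> 'a) list set set \<Rightarrow> ('v \<times> 'a) list set set \<Rightarrow> nat" where
  "class_dist c = coset_dist (SOME p. p \<in> c)"

text \<open>The index set is infinite in general.  The sum is taken in \<open>ereal\<close>, where sums of
  non-negative terms always exist, so that a finite bound on it carries information.\<close>

definition dist_sum :: "real \<Rightarrow> ('v \<times> 'a) list set set \<Rightarrow> ('v \<times> 'a) list set set \<Rightarrow> ereal" where
  "dist_sum \<sigma> g h = (\<Sum>\<^sub>\<infinity>c\<in>index_set. ereal (threshold \<sigma> (real (class_dist c g h))))"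

end

end

theory Submission
  imports Defs
begin

text \<open>
  Elements of the graph product are reduced words up to shuffling of commuting letters (a van der
  Waerden argument), and the gate of \<open>x\<close> in \<open>k\<langle>\<Lambda>\<rangle>\<close> is read off from the longest prefix of
  \<open>k\<^sup>-\<^sup>1 x\<close> in \<open>\<langle>\<Lambda>\<rangle>\<close>.

  For the lower bound on \<open>d(g, h)\<close>, fix \<open>\<Lambda>\<close> and a shortest path from \<open>g\<close> to \<open>h\<close>. Call a time active for a
  class if the path is then far from both of its endpoints in that class. Non-parallel cosets with the
  same label satisfy a Behrstock inequality, so each time is active for at most one class with label \<open>\<Lambda>\<close>;
  as gates move by at most \<open>1\<close> in each step, a class at distance \<open>N\<close> is active for at least \<open>N - 9\<close>
  times. There are only finitely many labels.

  For the upper bound, induct on \<open>\<Lambda>\<close> for \<open>x \<in> \<langle>\<Lambda>\<rangle>\<close>. Write \<open>x\<close> as a reduced product of \<open>N\<close> elements of proper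
  subgraph groups, where \<open>N\<close> is the distance in the class of \<open>\<langle>\<Lambda>\<rangle>\<close>. Each factor is bounded by
  induction. The bounds add up because gates of geodesics are geodesics, so that the distances in a
  fixed class are superadditive along a geodesic up to the constant \<open>2\<close>, which the threshold absorbs.
\<close>

text \<open>Two nonparallel cosets with the same label divide the group into two sides: one class
  gives diameter at most 4 to the first side, the other class to the second. Of the three points
  \<open>g\<close>, a path point and \<open>h\<close>, two lie on the same side, so the two classes
  cannot both have all three mutual distances at least 5. This explains the 5 in the notion of an
  active time; the values from 5 to \<open>N - 5\<close> then number \<open>N - 9\<close>. The
  threshold 20 gives \<open>N \<le> 2 * (N - 9)\<close> and leaves room for the constant 2 of the
  upper bound.

  That 2 comes from cutting a shortest product of proper factors in two. As soon as a factor reaches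
  into the right half, the rest of the left half commutes with a letter of it, so it misses a vertex
  of \<Lambda> and is itself a single proper factor.

  In the upper bound the factors of \<open>x\<close> see overlapping sets of classes.
  Superadditivity bounds their sums by one sum, so the coefficient does not grow with the number
  \<open>N\<close> of factors; only the additive constant is paid \<open>N\<close> times, and
  \<open>N\<close> is controlled by the term of the coset itself.\<close>

context graph_product
begin

section \<open>Reduced words up to shuffling\<close>

definition adj :: "'v \<Rightarrow> 'v \<Rightarrow> bool" where
  "adj v w \<longleftrightarrow> {v, w} \<in> E"

lemma adj_commute: "adj v w \<longleftrightarrow> adj w v"
  by (simp add: adj_def insert_commute)

lemma adj_irrefl [simp]: "\<not> adj v v"
  using simplicial[of "{v, v}"] by (auto simp: adj_def)

text \<open>Only neighbouring commuting letters are swapped and nothing is multiplied, so letters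
  and length are invariants. Products of letters are left to \<open>push\<close>.\<close>

inductive shuffle :: "('v \<times> 'a) list \<Rightarrow> ('v \<times> 'a) list \<Rightarrow> bool" (infix \<open>\<asymp>\<close> 50) where
  shuffle_Nil: "[] \<asymp> []"
| shuffle_Cons: "xs \<asymp> ys \<Longrightarrow> x # xs \<asymp> x # ys"
| shuffle_swap: "adj (fst x) (fst y) \<Longrightarrow> x # y # xs \<asymp> y # x # xs"
| shuffle_trans [trans]: "xs \<asymp> ys \<Longrightarrow> ys \<asymp> zs \<Longrightarrow> xs \<asymp> zs"

lemma shuffle_refl [simp]: "xs \<asymp> xs"
  by (induction xs) (auto intro: shuffle_Nil shuffle_Cons)

lemma shuffle_sym: "xs \<asymp> ys \<Longrightarrow> ys \<asymp> xs"
proof (induction rule: shuffle.induct)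
  case (shuffle_swap x y xs)
  then show ?case
    using adj_commute by (intro shuffle.shuffle_swap) blast
next
  case (shuffle_trans xs ys zs)
  then show ?case
    by (blast intro: shuffle.shuffle_trans)
qed (auto intro: shuffle_Cons)

lemma shuffle_mset: "xs \<asymp> ys \<Longrightarrow> mset xs = mset ys"
  by (induction rule: shuffle.induct) auto

lemma shuffle_set: "xs \<asymp> ys \<Longrightarrow> set xs = set ys"
  by (metis shuffle_mset set_mset_mset)

lemma shuffle_length: "xs \<asymp> ys \<Longrightarrow> length xs = length ys"
  by (metis shuffle_mset size_mset)

lemma shuffle_append_left: "xs \<asymp> ys \<Longrightarrow> zs @ xs \<asymp> zs @ ys"
  by (induction zs) (auto intro: shuffle_Cons)

lemma shuffle_append_right: "xs \<asymp> ys \<Longrightarrow> xs @ zs \<asymp> ys @ zs"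
proof (induction rule: shuffle.induct)
  case (shuffle_trans xs ys ws)
  then show ?case
    by (blast intro: shuffle.shuffle_trans)
qed (auto intro: shuffle_Cons shuffle_swap)

lemma shuffle_rev: "xs \<asymp> ys \<Longrightarrow> rev xs \<asymp> rev ys"
proof (induction rule: shuffle.induct)
  case (shuffle_swap x y xs)
  then show ?case
    using adj_commute by (auto intro!: shuffle_append_left shuffle.shuffle_swap)
next
  case (shuffle_trans xs ys zs)
  then show ?case
    by (blast intro: shuffle.shuffle_trans)
qed (auto intro: shuffle_append_right)

abbreviation adjl :: "'v \<Rightarrow> ('v \<times> 'a) list \<Rightarrow> bool" where
  "adjl v xs \<equiv> \<forall>w\<in>fst ` set xs. adj v w"

lemma shuffle_move: "adjl (fst x) xs \<Longrightarrow> x # xs @ ys \<asymp> xs @ x # ys"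
proof (induction xs)
  case (Cons y xs)
  then have "x # y # xs @ ys \<asymp> y # x # xs @ ys"
    by (intro shuffle_swap) auto
  also have "\<dots> \<asymp> y # xs @ x # ys"
    using Cons by (intro shuffle_Cons) auto
  finally show ?case by simp
qed auto

lemma shuffle_commute:
  assumes "\<forall>v\<in>fst ` set xs. adjl v ys"
  shows "xs @ ys \<asymp> ys @ xs"
  using assms
proof (induction xs)
  case (Cons x xs)
  have "x # xs @ ys \<asymp> x # ys @ xs"
    using Cons by (auto intro: shuffle_Cons)
  also have "\<dots> \<asymp> ys @ x # xs"
    using Cons.prems by (intro shuffle_move) auto
  finally show ?case by simp
qed auto

text \<open>A letter of \<open>v\<close> can be shuffled to the front exactly when the first
  \<open>v\<close>-letter commutes with everything before it. The recursion tests this without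
  quantifying over shuffles.\<close>

fun front :: "'v \<Rightarrow> ('v \<times> 'a) list \<Rightarrow> bool" where
  "front v [] \<longleftrightarrow> False"
| "front v (x # xs) \<longleftrightarrow> fst x = v \<or> adj v (fst x) \<and> front v xs"

abbreviation rear :: "'v \<Rightarrow> ('v \<times> 'a) list \<Rightarrow> bool" where
  "rear v xs \<equiv> front v (rev xs)"

lemma front_append [simp]: "front v (xs @ ys) \<longleftrightarrow> front v xs \<or> adjl v xs \<and> front v ys"
  by (induction xs) auto

lemma front_in_set: "front v xs \<Longrightarrow> v \<in> fst ` set xs"
  by (induction xs) auto

lemma rear_in_set: "rear v xs \<Longrightarrow> v \<in> fst ` set xs"
  using front_in_set[of v "rev xs"] by simp

lemma shuffle_front: "xs \<asymp> ys \<Longrightarrow> front v xs \<longleftrightarrow> front v ys"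
  by (induction rule: shuffle.induct) (auto simp: adj_commute)

lemma shuffle_rear: "xs \<asymp> ys \<Longrightarrow> rear v xs \<longleftrightarrow> rear v ys"
  by (rule shuffle_front[OF shuffle_rev])

lemma front_shuffle_Cons:
  assumes "front v xs"
  obtains a ys where "xs \<asymp> (v, a) # ys"
  using assms
proof (induction xs arbitrary: thesis)
  case (Cons x xs)
  show ?case
  proof (cases "fst x = v")
    case True
    then show ?thesis
      using Cons.prems(1)[of "snd x" xs] by (cases x) auto
  next
    case False
    then have "adj v (fst x)" "front v xs"
      using Cons.prems by auto
    then obtain a ys where "xs \<asymp> (v, a) # ys"
      using Cons.IH by blast
    then have "x # xs \<asymp> x # (v, a) # ys"
      by (rule shuffle_Cons)
    also have "\<dots> \<asymp> (v, a) # x # ys"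
      using \<open>adj v (fst x)\<close> adj_commute by (intro shuffle_swap) auto
    finally show ?thesis
      using Cons.prems(1) by blast
  qed
qed auto

lemma rear_shuffle_snoc:
  assumes "rear v xs"
  obtains a ys where "xs \<asymp> ys @ [(v, a)]"
proof -
  obtain a ys where "rev xs \<asymp> (v, a) # ys"
    using front_shuffle_Cons[OF assms] by blast
  then have "xs \<asymp> rev ys @ [(v, a)]"
    using shuffle_rev by fastforce
  then show ?thesis
    using that by blast
qed

lemma shuffle_filter:
  "xs \<asymp> ys \<Longrightarrow> filter (\<lambda>x. fst x = v) xs = filter (\<lambda>x. fst x = v) ys"
  by (induction rule: shuffle.induct) auto

fun delete_first :: "'v \<Rightarrow> ('v \<times> 'a) list \<Rightarrow> ('v \<times> 'a) list" where
  "delete_first v [] = []"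
| "delete_first v (x # xs) = (if fst x = v then xs else x # delete_first v xs)"

lemma shuffle_delete_first: "xs \<asymp> ys \<Longrightarrow> delete_first v xs \<asymp> delete_first v ys"
proof (induction rule: shuffle.induct)
  case (shuffle_trans xs ys zs)
  then show ?case
    by (blast intro: shuffle.shuffle_trans)
qed (auto intro: shuffle_Cons shuffle_swap)

text \<open>Letters of one vertex are never swapped, since \<open>adj\<close> is irreflexive. So the
  list of \<open>v\<close>-letters is an invariant, which gives \<open>a = b\<close>, and deleting
  the first of them is compatible with shuffles.\<close>

lemma shuffle_Cons_cancel:
  assumes "(v, a) # xs \<asymp> (v, b) # ys"
  shows "a = b \<and> xs \<asymp> ys"
  using shuffle_filter[OF assms, of v] shuffle_delete_first[OF assms, of v] by simp

text \<open>Besides asking for nontrivial letters, this forbids that two letters of one vertex can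
  be shuffled next to each other. It suffices to move the later one, hence the condition on the
  front of the tail.\<close>

fun red :: "('v \<times> 'a) list \<Rightarrow> bool" where
  "red [] \<longleftrightarrow> True"
| "red (x # xs) \<longleftrightarrow> fst x \<in> V \<and> snd x \<in> carrier (G (fst x)) \<and> snd x \<noteq> \<one>\<^bsub>G (fst x)\<^esub>
     \<and> \<not> front (fst x) xs \<and> red xs"

lemma shuffle_red: "xs \<asymp> ys \<Longrightarrow> red xs \<longleftrightarrow> red ys"
proof (induction rule: shuffle.induct)
  case (shuffle_Cons xs ys x)
  then show ?case
    using shuffle_front[of xs ys] by auto
qed (auto simp: adj_commute)

text \<open>Two letters that could be merged across the cut can be moved to it, one to the end of
  \<open>xs\<close> and one to the start of \<open>ys\<close>. Reducedness of a product of reduced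
  words is hence only ever checked at the interface.\<close>

lemma red_append: "red (xs @ ys) \<longleftrightarrow> red xs \<and> red ys \<and> (\<forall>v. \<not> (rear v xs \<and> front v ys))"
proof (induction xs)
  case (Cons x xs)
  have "(\<forall>w. \<not> (rear w (x # xs) \<and> front w ys)) \<longleftrightarrow>
      (\<forall>w. \<not> (rear w xs \<and> front w ys)) \<and> \<not> (adjl (fst x) xs \<and> front (fst x) ys)"
    by auto
  with Cons show ?case
    by auto
qed auto

lemma red_rev: "red (rev xs) \<longleftrightarrow> red xs"
  by (induction xs) (auto simp: red_append)

definition words :: "('v \<times> 'a) list set" where
  "words = fp_words V G"

lemma words_Nil [simp]: "[] \<in> words"
  by (simp add: words_def fp_words_def)

lemma words_Cons [simp]: "x # xs \<in> words \<longleftrightarrow> fst x \<in> V \<and> snd x \<in> carrier (G (fst x)) \<and> xs \<in> words"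
  by (cases x) (auto simp: words_def fp_words_def)

lemma words_append [simp]: "xs @ ys \<in> words \<longleftrightarrow> xs \<in> words \<and> ys \<in> words"
  by (auto simp: words_def fp_words_def)

lemma words_vertices: "xs \<in> words \<Longrightarrow> fst ` set xs \<subseteq> V"
  by (induction xs) auto

lemma red_words: "red xs \<Longrightarrow> xs \<in> words"
  by (induction xs) auto

lemma shuffle_words: "xs \<asymp> ys \<Longrightarrow> xs \<in> words \<longleftrightarrow> ys \<in> words"
  by (induction rule: shuffle.induct) auto

section \<open>Left multiplication on reduced words\<close>

fun mergef :: "'v \<Rightarrow> 'a \<Rightarrow> ('v \<times> 'a) list \<Rightarrow> ('v \<times> 'a) list" where
  "mergef v a [] = []"
| "mergef v a (x # xs) =
     (if fst x = v
      then (if a \<otimes>\<^bsub>G v\<^esub> snd x = \<one>\<^bsub>G v\<^esub> then xs else (v, a \<otimes>\<^bsub>G v\<^esub> snd x) # xs)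
      else x # mergef v a xs)"

text \<open>\<open>a\<close> is merged into the first \<open>v\<close>-letter where that letter
  stands. Moving the letter to the head first would give the same up to shuffling, but leaving all
  letters in place later preserves a cutting of the word into blocks.\<close>

fun push :: "'v \<times> 'a \<Rightarrow> ('v \<times> 'a) list \<Rightarrow> ('v \<times> 'a) list" where
  "push (v, a) xs =
     (if a = \<one>\<^bsub>G v\<^esub> then xs else if front v xs then mergef v a xs else (v, a) # xs)"

lemma shuffle_mergef: "xs \<asymp> ys \<Longrightarrow> mergef v a xs \<asymp> mergef v a ys"
proof (induction rule: shuffle.induct)
  case (shuffle_trans xs ys zs)
  then show ?case
    by (blast intro: shuffle.shuffle_trans)
qed (auto intro: shuffle_Cons shuffle_swap)

lemma shuffle_push: "xs \<asymp> ys \<Longrightarrow> push x xs \<asymp> push x ys"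
  by (cases x) (auto simp: shuffle_front intro: shuffle_mergef shuffle_Cons)

text \<open>In the last two cases the word is shuffled so that its \<open>v\<close>-letter stands at
  the head, where \<open>push\<close> computes; the price is that the result is known only up to
  shuffling.\<close>

lemma push_cases:
  assumes "red xs" "v \<in> V" "a \<in> carrier (G v)"
  obtains (one) "a = \<one>\<^bsub>G v\<^esub>" "push (v, a) xs = xs"
    | (cons) "a \<noteq> \<one>\<^bsub>G v\<^esub>" "\<not> front v xs" "push (v, a) xs = (v, a) # xs"
    | (cancel) b ys where "a \<noteq> \<one>\<^bsub>G v\<^esub>" "xs \<asymp> (v, b) # ys" "red ((v, b) # ys)"
        "a \<otimes>\<^bsub>G v\<^esub> b = \<one>\<^bsub>G v\<^esub>" "push (v, a) xs \<asymp> ys"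
    | (merge) b ys where "a \<noteq> \<one>\<^bsub>G v\<^esub>" "xs \<asymp> (v, b) # ys" "red ((v, b) # ys)"
        "a \<otimes>\<^bsub>G v\<^esub> b \<noteq> \<one>\<^bsub>G v\<^esub>" "push (v, a) xs \<asymp> (v, a \<otimes>\<^bsub>G v\<^esub> b) # ys"
proof (cases "a = \<one>\<^bsub>G v\<^esub> \<or> \<not> front v xs")
  case True
  then show ?thesis
    by (cases "a = \<one>\<^bsub>G v\<^esub>") (auto intro: one cons)
next
  case False
  then obtain b ys where *: "xs \<asymp> (v, b) # ys"
    using front_shuffle_Cons by blast
  then have "red ((v, b) # ys)"
    using assms shuffle_red by blast
  moreover have "push (v, a) xs \<asymp> push (v, a) ((v, b) # ys)"
    using * by (rule shuffle_push)
  ultimately show ?thesis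
    using cancel merge * False by (cases "a \<otimes>\<^bsub>G v\<^esub> b = \<one>\<^bsub>G v\<^esub>") auto
qed

lemma red_push:
  assumes "red xs" "v \<in> V" "a \<in> carrier (G v)"
  shows "red (push (v, a) xs)"
  using assms
proof (cases rule: push_cases)
  case (merge b ys)
  then have "b \<in> carrier (G v)" by simp
  then have "a \<otimes>\<^bsub>G v\<^esub> b \<in> carrier (G v)"
    using vertex_group[OF assms(2)] assms(3) by (simp add: group.is_monoid monoid.m_closed)
  then have "red ((v, a \<otimes>\<^bsub>G v\<^esub> b) # ys)"
    using merge assms by simp
  then show ?thesis
    using shuffle_red[OF merge(5)] by blast
next
  case (cancel b ys)
  then show ?thesis
    using shuffle_red[OF cancel(5)] by simp
qed (use assms in auto)

lemma push_mult:
  assumes "red xs" "v \<in> V" "a \<in> carrier (G v)" "b \<in> carrier (G v)"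
  shows "push (v, a) (push (v, b) xs) \<asymp> push (v, a \<otimes>\<^bsub>G v\<^esub> b) xs"
proof -
  interpret Gv: group "G v" by (rule vertex_group[OF assms(2)])
  from assms(1,2,4) show ?thesis
  proof (cases rule: push_cases)
    case one
    then show ?thesis using assms by simp
  next
    case cons
    then show ?thesis using assms by simp
  next
    case (cancel c ys)
    then have c: "c \<in> carrier (G v)" "\<not> front v ys" "c \<noteq> \<one>\<^bsub>G v\<^esub>" by auto
    have "push (v, a) (push (v, b) xs) \<asymp> push (v, a) ys"
      using cancel(5) by (rule shuffle_push)
    also have "push (v, a) ys = push (v, a \<otimes>\<^bsub>G v\<^esub> b) ((v, c) # ys)"
    proof -
      have "a \<otimes>\<^bsub>G v\<^esub> b \<otimes>\<^bsub>G v\<^esub> c = a"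
        using c assms cancel(4) by (simp add: Gv.m_assoc)
      moreover have "c = a" if "a \<otimes>\<^bsub>G v\<^esub> b = \<one>\<^bsub>G v\<^esub>"
        using calculation that c by simp
      ultimately show ?thesis
        using c assms by auto
    qed
    also have "\<dots> \<asymp> push (v, a \<otimes>\<^bsub>G v\<^esub> b) xs"
      by (rule shuffle_push[OF shuffle_sym[OF cancel(2)]])
    finally show ?thesis .
  next
    case (merge c ys)
    then have c: "c \<in> carrier (G v)" "\<not> front v ys" "c \<noteq> \<one>\<^bsub>G v\<^esub>" by auto
    have "push (v, a) (push (v, b) xs) \<asymp> push (v, a) ((v, b \<otimes>\<^bsub>G v\<^esub> c) # ys)"
      using merge(5) by (rule shuffle_push)
    also have "\<dots> = push (v, a \<otimes>\<^bsub>G v\<^esub> b) ((v, c) # ys)"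
    proof -
      have "a \<otimes>\<^bsub>G v\<^esub> b \<otimes>\<^bsub>G v\<^esub> c = a \<otimes>\<^bsub>G v\<^esub> (b \<otimes>\<^bsub>G v\<^esub> c)"
        using c assms by (simp add: Gv.m_assoc)
      moreover have "b \<otimes>\<^bsub>G v\<^esub> c = c" if "a = \<one>\<^bsub>G v\<^esub>" "a \<otimes>\<^bsub>G v\<^esub> b = \<one>\<^bsub>G v\<^esub>"
        using that c assms merge(1) by simp
      ultimately show ?thesis
        using c assms merge(1,4) by auto
    qed
    also have "\<dots> \<asymp> push (v, a \<otimes>\<^bsub>G v\<^esub> b) xs"
      by (rule shuffle_push[OF shuffle_sym[OF merge(2)]])
    finally show ?thesis .
  qed
qed

lemma push_commute_fresh:
  assumes "adj v w" "\<not> front v xs"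
  shows "push (v, a) (push (w, b) xs) \<asymp> push (w, b) (push (v, a) xs)"
proof -
  have [simp]: "v \<noteq> w" "adj w v" using assms adj_commute by auto
  \<comment> \<open>Cancelling a \<open>w\<close>-letter frees only vertices that it blocked, and
    \<open>v\<close> is adjacent to \<open>w\<close>.\<close>
  have "\<not> front v (mergef w b xs)" if "front w xs"
    using assms that by (induction xs) (auto simp: adj_commute)
  then show ?thesis
    using assms by (auto intro: shuffle_swap)
qed

lemma push_commute:
  assumes "red xs" "v \<in> V" "a \<in> carrier (G v)" "w \<in> V" "b \<in> carrier (G w)" "adj v w"
  shows "push (v, a) (push (w, b) xs) \<asymp> push (w, b) (push (v, a) xs)"
proof (cases "front v xs \<and> front w xs")
  case False
  then show ?thesis
    using push_commute_fresh assms(6) adj_commute shuffle_sym by metis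
next
  \<comment> \<open>Both vertices have a free letter; with these two letters at the head they are
    updated independently.\<close>
  case True
  have ne [simp]: "v \<noteq> w" "w \<noteq> v" "adj w v" "adj v w" using assms adj_commute by auto
  obtain c ys where ys: "xs \<asymp> (v, c) # ys"
    using True front_shuffle_Cons by blast
  then have "front w ys"
    using True shuffle_front[OF ys, of w] by auto
  then obtain d zs where "ys \<asymp> (w, d) # zs"
    using front_shuffle_Cons by blast
  then have zs: "xs \<asymp> (v, c) # (w, d) # zs"
    using ys shuffle_Cons shuffle_trans by blast
  then have "red ((v, c) # (w, d) # zs)"
    using assms shuffle_red by blast
  then have "push (v, a) (push (w, b) ((v, c) # (w, d) # zs)) \<asymp>
      push (w, b) (push (v, a) ((v, c) # (w, d) # zs))"
    by (auto intro: shuffle_Cons shuffle_swap)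
  then show ?thesis
    using zs by (meson shuffle_push shuffle_sym shuffle_trans)
qed

definition act :: "('v \<times> 'a) list \<Rightarrow> ('v \<times> 'a) list \<Rightarrow> ('v \<times> 'a) list" where
  "act u xs = foldr push u xs"

lemma act_simps [simp]:
  "act [] xs = xs" "act (x # u) xs = push x (act u xs)" "act (u @ w) xs = act u (act w xs)"
  by (simp_all add: act_def)

lemma shuffle_act: "xs \<asymp> ys \<Longrightarrow> act u xs \<asymp> act u ys"
  by (induction u) (auto intro: shuffle_push)

lemma red_act: "u \<in> words \<Longrightarrow> red xs \<Longrightarrow> red (act u xs)"
  by (induction u) (auto intro: red_push simp del: push.simps)

text \<open>No letter of a reduced word merges with its tail, so acting on the empty word gives the
  word back. The action therefore separates reduced words, which makes the normal form
  unique.\<close>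

lemma act_red: "red u \<Longrightarrow> act u [] = u"
  by (induction u) auto

lemma act_vertices: "fst ` set (act u []) \<subseteq> fst ` set u"
proof (induction u)
  case (Cons x u)
  have "fst ` set (mergef v a xs) \<subseteq> fst ` set xs" for v a xs
    by (induction xs) auto
  then have "fst ` set (push x xs) \<subseteq> insert (fst x) (fst ` set xs)" for xs
    by (cases x) (simp add: subset_insertI subset_insertI2)
  also have "insert (fst x) (fst ` set (act u [])) \<subseteq> fst ` set (x # u)"
    using Cons by auto
  finally show ?case by simp
qed simp

lemma length_act: "length (act u []) \<le> length u"
proof (induction u)
  case (Cons x u)
  have "length (mergef v a xs) \<le> length xs" for v a xs
    by (induction xs) auto
  then have "length (push x xs) \<le> Suc (length xs)" for xs
    by (cases x) (auto simp: le_Suc_eq)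
  then show ?case using Cons by (auto simp del: push.simps intro: order_trans)
qed simp

lemma fp_eq_words: "fp_eq V G u w \<Longrightarrow> u \<in> words \<and> w \<in> words"
  by (induction rule: fp_eq.induct)
    (auto simp: words_def[symmetric] vertex_group group.is_monoid monoid.m_closed monoid.one_closed)

lemma fp_eq_act:
  assumes "fp_eq V G u w" "red xs"
  shows "act u xs \<asymp> act w xs"
  using assms(1)
proof (induction rule: fp_eq.induct)
  case (one p q v)
  then show ?case by simp
next
  case (trans u w z)
  then show ?case
    using shuffle_trans by blast
next
  case (sym u w)
  then show ?case
    using shuffle_sym by blast
next
  case (mult p q v x y)
  then have "red (act q xs)"
    using red_act assms(2) words_def by blast
  then show ?case
    using mult push_mult by (auto intro!: shuffle_act simp del: push.simps)
qed auto

section \<open>Normal forms in the graph product\<close>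

abbreviation FP :: "('v \<times> 'a) list set monoid" where
  "FP \<equiv> free_product V G"

section \<open>The free product as a group of words\<close>

definition fp_class :: "('v \<times> 'a) list \<Rightarrow> ('v \<times> 'a) list set" where
  "fp_class u = fp_rel V G `` {u}"

lemma fp_eq_refl: "u \<in> words \<Longrightarrow> fp_eq V G u u"
  by (simp add: words_def fp_eq.refl)

lemma fp_eq_append_left:
  assumes "fp_eq V G u w" "p \<in> words"
  shows "fp_eq V G (p @ u) (p @ w)"
  using assms(1)
proof (induction rule: fp_eq.induct)
  case (one p' q v)
  then show ?case
    using fp_eq.one[of "p @ p'" V G q v] assms(2) words_append by (simp add: words_def)
next
  case (mult p' q v x y)
  then show ?case
    using fp_eq.mult[of "p @ p'" V G q v x y] assms(2) words_append by (simp add: words_def)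
next
  case (refl u)
  then show ?case
    using assms(2) by (intro fp_eq_refl) (simp add: words_def[symmetric])
qed (blast intro: fp_eq.sym fp_eq.trans)+

lemma fp_eq_append_right:
  assumes "fp_eq V G u w" "q \<in> words"
  shows "fp_eq V G (u @ q) (w @ q)"
  using assms(1)
proof (induction rule: fp_eq.induct)
  case (one p q' v)
  then show ?case
    using fp_eq.one[of p V G "q' @ q" v] assms(2) words_append by (simp add: words_def)
next
  case (mult p q' v x y)
  then show ?case
    using fp_eq.mult[of p V G "q' @ q" v x y] assms(2) words_append by (simp add: words_def)
next
  case (refl u)
  then show ?case
    using assms(2) by (intro fp_eq_refl) (simp add: words_def[symmetric])
qed (blast intro: fp_eq.sym fp_eq.trans)+

lemma fp_eq_append:
  assumes "fp_eq V G u u'" "fp_eq V G w w'"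
  shows "fp_eq V G (u @ w) (u' @ w')"
  using fp_eq_append_left[OF assms(2), of u] fp_eq_append_right[OF assms(1), of w']
    fp_eq_words assms fp_eq.trans by blast

lemma equiv_fp_rel: "equiv words (fp_rel V G)"
proof (rule equivI)
  show "fp_rel V G \<subseteq> words \<times> words"
    using fp_eq_words by (auto simp: fp_rel_def)
  show "refl_on words (fp_rel V G)"
    by (auto simp: refl_on_def fp_rel_def fp_eq_refl)
  show "sym (fp_rel V G)"
    by (auto simp: sym_def fp_rel_def intro: fp_eq.sym)
  show "trans (fp_rel V G)"
    by (auto simp: trans_def fp_rel_def intro: fp_eq.trans)
qed

lemma fp_class_eq_iff:
  "u \<in> words \<Longrightarrow> w \<in> words \<Longrightarrow> fp_class u = fp_class w \<longleftrightarrow> fp_eq V G u w"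
  unfolding fp_class_def using eq_equiv_class_iff[OF equiv_fp_rel] by (simp add: fp_rel_def)

lemma carrier_FP: "carrier FP = fp_class ` words"
  by (auto simp: free_product_def quotient_def fp_class_def words_def)

lemma one_FP: "\<one>\<^bsub>FP\<^esub> = fp_class []"
  by (simp add: free_product_def fp_class_def)

lemma mult_FP:
  assumes "u \<in> words" "w \<in> words"
  shows "fp_class u \<otimes>\<^bsub>FP\<^esub> fp_class w = fp_class (u @ w)"
proof -
  have *: "fp_class (u' @ w') = fp_class (u @ w)" if "u' \<in> fp_class u" "w' \<in> fp_class w" for u' w'
    using that fp_eq_append[of u u' w w'] fp_eq_words
    by (subst fp_class_eq_iff) (auto simp: fp_class_def fp_rel_def intro: fp_eq.sym)
  have "u \<in> fp_class u" "w \<in> fp_class w"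
    using assms by (auto simp: fp_class_def fp_rel_def fp_eq_refl)
  have "(\<Union>u'\<in>fp_class u. \<Union>w'\<in>fp_class w. fp_class (u' @ w'))
      = (\<Union>u'\<in>fp_class u. \<Union>w'\<in>fp_class w. fp_class (u @ w))"
    by (intro SUP_cong[OF HOL.refl] *)
  also have "\<dots> = fp_class (u @ w)"
    using \<open>u \<in> fp_class u\<close> \<open>w \<in> fp_class w\<close> by blast
  finally have "(\<Union>u'\<in>fp_class u. \<Union>w'\<in>fp_class w. fp_class (u' @ w')) = fp_class (u @ w)" .
  then show ?thesis
    by (simp add: free_product_def fp_class_def)
qed

definition word_inv :: "('v \<times> 'a) list \<Rightarrow> ('v \<times> 'a) list" where
  "word_inv u = rev (map (\<lambda>x. (fst x, inv\<^bsub>G (fst x)\<^esub> snd x)) u)"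

lemma word_inv_simps [simp]:
  "word_inv [] = []"
  "word_inv (x # u) = word_inv u @ [(fst x, inv\<^bsub>G (fst x)\<^esub> snd x)]"
  "word_inv (u @ w) = word_inv w @ word_inv u"
  by (simp_all add: word_inv_def)

lemma fst_set_word_inv [simp]: "fst ` set (word_inv u) = fst ` set u"
  by (force simp: word_inv_def)

lemma length_word_inv [simp]: "length (word_inv u) = length u"
  by (simp add: word_inv_def)

lemma words_word_inv [simp]: "u \<in> words \<Longrightarrow> word_inv u \<in> words"
  by (induction u) (auto simp: vertex_group group.inv_closed)

lemma fp_eq_word_inv: "u \<in> words \<Longrightarrow> fp_eq V G (word_inv u @ u) []"
proof (induction u)
  case (Cons x u)
  then have x: "fst x \<in> V" "snd x \<in> carrier (G (fst x))" and u: "u \<in> words" by auto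
  interpret Gx: group "G (fst x)" by (rule vertex_group[OF x(1)])
  have "fp_eq V G (word_inv u @ [(fst x, inv\<^bsub>G (fst x)\<^esub> snd x), (fst x, snd x)] @ u)
      (word_inv u @ [(fst x, inv\<^bsub>G (fst x)\<^esub> snd x \<otimes>\<^bsub>G (fst x)\<^esub> snd x)] @ u)"
    using x u words_word_inv by (intro fp_eq.mult) (auto simp flip: words_def)
  also have "inv\<^bsub>G (fst x)\<^esub> snd x \<otimes>\<^bsub>G (fst x)\<^esub> snd x = \<one>\<^bsub>G (fst x)\<^esub>"
    using x by simp
  finally have "fp_eq V G (word_inv (x # u) @ x # u) (word_inv u @ [(fst x, \<one>\<^bsub>G (fst x)\<^esub>)] @ u)"
    by simp
  moreover have "fp_eq V G (word_inv u @ [(fst x, \<one>\<^bsub>G (fst x)\<^esub>)] @ u) (word_inv u @ u)"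
    using x u words_word_inv by (intro fp_eq.one) (auto simp flip: words_def)
  ultimately show ?case
    using Cons.IH[OF u] fp_eq.trans by blast
qed (simp add: fp_eq_refl)

lemma group_FP: "group FP"
proof (rule groupI)
  fix x assume "x \<in> carrier FP"
  then obtain u where u: "u \<in> words" "x = fp_class u"
    by (auto simp: carrier_FP)
  then have "fp_class (word_inv u) \<otimes>\<^bsub>FP\<^esub> x = \<one>\<^bsub>FP\<^esub>"
    by (simp add: mult_FP one_FP fp_class_eq_iff fp_eq_word_inv)
  then show "\<exists>y\<in>carrier FP. y \<otimes>\<^bsub>FP\<^esub> x = \<one>\<^bsub>FP\<^esub>"
    using u by (auto simp: carrier_FP)
qed (auto simp: carrier_FP mult_FP one_FP)

lemma inv_FP: "u \<in> words \<Longrightarrow> inv\<^bsub>FP\<^esub> fp_class u = fp_class (word_inv u)"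
  by (intro group.inv_equality[OF group_FP])
    (auto simp: mult_FP one_FP fp_class_eq_iff fp_eq_word_inv carrier_FP)

lemma fp_incl_eq: "fp_incl V G v a = fp_class [(v, a)]"
  by (simp add: fp_incl_def fp_class_def)

section \<open>The graph product as its quotient\<close>

abbreviation NC :: "('v \<times> 'a) list set set" where
  "NC \<equiv> normal_closure FP commutators"

lemma edge_vertices: "{v, w} \<in> E \<Longrightarrow> v \<in> V \<and> w \<in> V"
  using simplicial[of "{v, w}"] by (auto simp: doubleton_eq_iff)

lemma commutators_eq:
  "commutators = {fp_class [(v, a), (w, b), (v, inv\<^bsub>G v\<^esub> a), (w, inv\<^bsub>G w\<^esub> b)] | v w a b.
     adj v w \<and> a \<in> carrier (G v) \<and> b \<in> carrier (G w)}"
proof -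
  have "fp_class [(v, a)] \<otimes>\<^bsub>FP\<^esub> fp_class [(w, b)] \<otimes>\<^bsub>FP\<^esub> inv\<^bsub>FP\<^esub> fp_class [(v, a)]
        \<otimes>\<^bsub>FP\<^esub> inv\<^bsub>FP\<^esub> fp_class [(w, b)]
      = fp_class [(v, a), (w, b), (v, inv\<^bsub>G v\<^esub> a), (w, inv\<^bsub>G w\<^esub> b)]"
    if "{v, w} \<in> E" "a \<in> carrier (G v)" "b \<in> carrier (G w)" for v w a b
    using that edge_vertices[OF that(1)]
    by (simp add: inv_FP mult_FP group.inv_closed[OF vertex_group])
  note * = this
  show ?thesis
  proof (intro equalityI subsetI)
    fix z assume "z \<in> commutators"
    then obtain v w a b where "{v, w} \<in> E" "a \<in> carrier (G v)" "b \<in> carrier (G w)"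
      "z = fp_class [(v, a)] \<otimes>\<^bsub>FP\<^esub> fp_class [(w, b)] \<otimes>\<^bsub>FP\<^esub> inv\<^bsub>FP\<^esub> fp_class [(v, a)]
        \<otimes>\<^bsub>FP\<^esub> inv\<^bsub>FP\<^esub> fp_class [(w, b)]"
      unfolding commutators_def fp_incl_eq by blast
    then show "z \<in> {fp_class [(v, a), (w, b), (v, inv\<^bsub>G v\<^esub> a), (w, inv\<^bsub>G w\<^esub> b)] | v w a b.
        adj v w \<and> a \<in> carrier (G v) \<and> b \<in> carrier (G w)}"
      unfolding adj_def using * by blast
  next
    fix z assume "z \<in> {fp_class [(v, a), (w, b), (v, inv\<^bsub>G v\<^esub> a), (w, inv\<^bsub>G w\<^esub> b)] | v w a b.
        adj v w \<and> a \<in> carrier (G v) \<and> b \<in> carrier (G w)}"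
    then obtain v w a b where z: "{v, w} \<in> E" "a \<in> carrier (G v)" "b \<in> carrier (G w)"
      "z = fp_class [(v, a), (w, b), (v, inv\<^bsub>G v\<^esub> a), (w, inv\<^bsub>G w\<^esub> b)]"
      unfolding adj_def by blast
    show "z \<in> commutators"
      unfolding commutators_def fp_incl_eq z(4) *[OF z(1-3), symmetric] using z(1-3) by blast
  qed
qed

lemma commutators_subset: "commutators \<subseteq> carrier FP"
proof -
  have "[(v, a), (w, b), (v, inv\<^bsub>G v\<^esub> a), (w, inv\<^bsub>G w\<^esub> b)] \<in> words"
    if "adj v w" "a \<in> carrier (G v)" "b \<in> carrier (G w)" for v w a b
    using that edge_vertices[of v w] by (auto simp: adj_def group.inv_closed[OF vertex_group])
  then show ?thesis
    unfolding commutators_eq carrier_FP by blast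
qed

lemma normal_closure_normal:
  assumes "group H" "A \<subseteq> carrier H"
  shows "normal_closure H A \<lhd> H"
proof -
  interpret H: group H by fact
  have car: "carrier H \<lhd> H"
    by (simp add: H.normal_inv_iff H.subgroup_self)
  show ?thesis
    unfolding H.normal_inv_iff
  proof (intro conjI ballI)
    show "subgroup (normal_closure H A) H"
      unfolding normal_closure_def
      using car assms(2) by (intro H.subgroups_Inter) (auto simp: normal_imp_subgroup)
    fix x h assume "x \<in> carrier H" "h \<in> normal_closure H A"
    then show "x \<otimes>\<^bsub>H\<^esub> h \<otimes>\<^bsub>H\<^esub> inv\<^bsub>H\<^esub> x \<in> normal_closure H A"
      by (auto simp: normal_closure_def intro: normal.inv_op_closed2)
  qed
qed

lemma NC_normal: "NC \<lhd> FP"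
  by (rule normal_closure_normal[OF group_FP commutators_subset])

lemma commutators_in_NC: "commutators \<subseteq> NC"
  by (auto simp: normal_closure_def)

sublocale GPg: group GP
  unfolding GP_def by (rule normal.factorgroup_is_group[OF NC_normal])

abbreviation gmult :: "('v \<times> 'a) list set set \<Rightarrow> _ \<Rightarrow> _" (infixl \<open>\<cdot>\<close> 70) where
  "x \<cdot> y \<equiv> x \<otimes>\<^bsub>GP\<^esub> y"

abbreviation ginv :: "('v \<times> 'a) list set set \<Rightarrow> ('v \<times> 'a) list set set" where
  "ginv x \<equiv> inv\<^bsub>GP\<^esub> x"

definition ev :: "('v \<times> 'a) list \<Rightarrow> ('v \<times> 'a) list set set" where
  "ev u = NC #>\<^bsub>FP\<^esub> fp_class u"

lemma carrier_GP: "carrier GP = ev ` words"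
  by (auto simp: GP_def carrier_FactGroup carrier_FP ev_def)

lemma ev_closed [simp]: "u \<in> words \<Longrightarrow> ev u \<in> carrier GP"
  by (auto simp: carrier_GP)

lemma hom_GP: "(\<lambda>x. NC #>\<^bsub>FP\<^esub> x) \<in> hom FP GP"
  unfolding GP_def by (rule normal.r_coset_hom_Mod[OF NC_normal])

lemma ev_append: "u \<in> words \<Longrightarrow> w \<in> words \<Longrightarrow> ev (u @ w) = ev u \<cdot> ev w"
  using hom_mult[OF hom_GP, of "fp_class u" "fp_class w"] mult_FP[of u w]
  by (simp add: ev_def carrier_FP)

lemma ev_Nil [simp]: "ev [] = \<one>\<^bsub>GP\<^esub>"
  using hom_one[OF hom_GP group_FP GPg.is_group] by (simp add: ev_def one_FP)

lemma ev_fp_eq: "fp_eq V G u w \<Longrightarrow> ev u = ev w"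
  using fp_class_eq_iff fp_eq_words by (metis ev_def)

lemma ev_word_inv: "u \<in> words \<Longrightarrow> ev (word_inv u) = ginv (ev u)"
  using ev_fp_eq[OF fp_eq_word_inv] ev_append[of "word_inv u" u]
  by (intro GPg.inv_equality[symmetric]) auto

lemma incl_ev: "incl v a = ev [(v, a)]"
  by (simp add: incl_def ev_def fp_incl_eq)

lemma ev_Cons: "fst x \<in> V \<Longrightarrow> snd x \<in> carrier (G (fst x)) \<Longrightarrow> u \<in> words \<Longrightarrow> ev (x # u) = ev [x] \<cdot> ev u"
  using ev_append[of "[x]" u] by simp

lemma ev_mult:
  assumes "v \<in> V" "a \<in> carrier (G v)" "b \<in> carrier (G v)"
  shows "ev [(v, a)] \<cdot> ev [(v, b)] = ev [(v, a \<otimes>\<^bsub>G v\<^esub> b)]"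
  using ev_fp_eq[OF fp_eq.mult[of "[]" V G "[]" v a b]] assms ev_append[of "[(v, a)]" "[(v, b)]"]
  by (simp flip: words_def)

lemma ev_one: "v \<in> V \<Longrightarrow> ev [(v, \<one>\<^bsub>G v\<^esub>)] = \<one>\<^bsub>GP\<^esub>"
  using ev_fp_eq[OF fp_eq.one[of "[]" V G "[]" v]] by (simp flip: words_def)

lemma ev_inv: "v \<in> V \<Longrightarrow> a \<in> carrier (G v) \<Longrightarrow> ginv (ev [(v, a)]) = ev [(v, inv\<^bsub>G v\<^esub> a)]"
  using ev_word_inv[of "[(v, a)]"] by simp

lemma ev_adj_commute:
  assumes "adj v w" "a \<in> carrier (G v)" "b \<in> carrier (G w)"
  shows "ev [(v, a)] \<cdot> ev [(w, b)] = ev [(w, b)] \<cdot> ev [(v, a)]"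
proof -
  have V: "v \<in> V" "w \<in> V"
    using assms edge_vertices by (auto simp: adj_def)
  interpret Gv: group "G v" by (rule vertex_group[OF V(1)])
  interpret Gw: group "G w" by (rule vertex_group[OF V(2)])
  let ?c = "[(v, a), (w, b), (v, inv\<^bsub>G v\<^esub> a), (w, inv\<^bsub>G w\<^esub> b)]"
  have "fp_class ?c \<in> NC"
    using commutators_in_NC assms unfolding commutators_eq by blast
  then have "ev ?c = NC"
    unfolding ev_def
    by (rule group.coset_join2[OF group_FP _ normal_imp_subgroup[OF NC_normal], rotated])
      (use assms V in \<open>auto simp: carrier_FP\<close>)
  then have "ev ?c = \<one>\<^bsub>GP\<^esub>"
    by (simp add: GP_def)
  moreover have "ev ?c = ev [(v, a)] \<cdot> ev [(w, b)] \<cdot> ginv (ev [(v, a)]) \<cdot> ginv (ev [(w, b)])"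
    using assms V ev_append[of "[(v, a), (w, b), (v, inv\<^bsub>G v\<^esub> a)]" "[(w, inv\<^bsub>G w\<^esub> b)]"]
      ev_append[of "[(v, a), (w, b)]" "[(v, inv\<^bsub>G v\<^esub> a)]"] ev_append[of "[(v, a)]" "[(w, b)]"]
    by (simp add: ev_inv)
  ultimately have *: "ev [(v, a)] \<cdot> ev [(w, b)] \<cdot> ginv (ev [(v, a)]) \<cdot> ginv (ev [(w, b)]) = \<one>\<^bsub>GP\<^esub>"
    by simp
  have c: "ev [(v, a)] \<in> carrier GP" "ev [(w, b)] \<in> carrier GP"
    using assms V by auto
  have "ev [(v, a)] \<cdot> ev [(w, b)] = ev [(v, a)] \<cdot> ev [(w, b)] \<cdot> ginv (ev [(v, a)]) \<cdot> ginv (ev [(w, b)])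
      \<cdot> ev [(w, b)] \<cdot> ev [(v, a)]"
    using c by (simp add: GPg.m_assoc)
  also have "\<dots> = ev [(w, b)] \<cdot> ev [(v, a)]"
    unfolding * using c by simp
  finally show ?thesis .
qed

lemma ev_shuffle: "xs \<asymp> ys \<Longrightarrow> xs \<in> words \<Longrightarrow> ev xs = ev ys"
proof (induction rule: shuffle.induct)
  case (shuffle_Cons xs ys x)
  moreover have "ys \<in> words"
    using shuffle_Cons shuffle_words by auto
  ultimately show ?case
    using ev_Cons[of x xs] ev_Cons[of x ys] by auto
next
  case (shuffle_swap x y xs)
  then have *: "ev [x] \<cdot> ev [y] = ev [y] \<cdot> ev [x]"
    using ev_adj_commute[of "fst x" "fst y" "snd x" "snd y"] by simp
  have "ev (x # y # xs) = ev [x] \<cdot> ev [y] \<cdot> ev xs" "ev (y # x # xs) = ev [y] \<cdot> ev [x] \<cdot> ev xs"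
    using shuffle_swap ev_Cons[of x "y # xs"] ev_Cons[of y xs] ev_Cons[of y "x # xs"] ev_Cons[of x xs]
    by (simp_all add: GPg.m_assoc)
  then show ?case
    using * by simp
next
  case (shuffle_trans xs ys zs)
  then show ?case
    using shuffle_words by auto
qed auto

lemma ev_push:
  assumes "red xs" "v \<in> V" "a \<in> carrier (G v)"
  shows "ev (push (v, a) xs) = ev [(v, a)] \<cdot> ev xs"
  using assms
proof (cases rule: push_cases)
  case one
  then show ?thesis
    using assms red_words by (simp add: ev_one)
next
  case cons
  then show ?thesis
    unfolding cons(3) using assms red_words ev_Cons[of "(v, a)" xs] by simp
next
  case (cancel b ys)
  have b: "b \<in> carrier (G v)" "ys \<in> words"
    using cancel(3) red_words by auto
  have "ev [(v, a)] \<cdot> ev xs = ev [(v, a)] \<cdot> (ev [(v, b)] \<cdot> ev ys)"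
    using ev_shuffle[OF cancel(2)] assms b red_words ev_Cons[of "(v, b)" ys] by simp
  also have "\<dots> = ev [(v, a \<otimes>\<^bsub>G v\<^esub> b)] \<cdot> ev ys"
    using assms b by (simp flip: GPg.m_assoc add: ev_mult)
  also have "\<dots> = ev ys"
    using cancel b assms by (simp add: ev_one)
  also have "\<dots> = ev (push (v, a) xs)"
    by (rule ev_shuffle[OF shuffle_sym[OF cancel(5)] b(2)])
  finally show ?thesis by simp
next
  case (merge b ys)
  have b: "b \<in> carrier (G v)" "ys \<in> words"
    using merge(3) red_words by auto
  have ab: "a \<otimes>\<^bsub>G v\<^esub> b \<in> carrier (G v)"
    using b assms vertex_group group.is_monoid monoid.m_closed by metis
  have "ev [(v, a)] \<cdot> ev xs = ev [(v, a)] \<cdot> (ev [(v, b)] \<cdot> ev ys)"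
    using ev_shuffle[OF merge(2)] assms b red_words ev_Cons[of "(v, b)" ys] by simp
  also have "\<dots> = ev [(v, a \<otimes>\<^bsub>G v\<^esub> b)] \<cdot> ev ys"
    using assms b by (simp flip: GPg.m_assoc add: ev_mult)
  also have "\<dots> = ev ((v, a \<otimes>\<^bsub>G v\<^esub> b) # ys)"
    using ab b assms ev_Cons[of "(v, a \<otimes>\<^bsub>G v\<^esub> b)" ys] by simp
  also have "\<dots> = ev (push (v, a) xs)"
    using ab b assms by (intro ev_shuffle[OF shuffle_sym[OF merge(5)]]) auto
  finally show ?thesis by simp
qed

lemma ev_act:
  assumes "u \<in> words" "red xs"
  shows "ev (act u xs) = ev u \<cdot> ev xs"
  using assms(1)
proof (induction u)
  case (Cons x u)
  then have "ev (act (x # u) xs) = ev [x] \<cdot> (ev u \<cdot> ev xs)"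
    using ev_push[of "act u xs" "fst x" "snd x"] assms red_act by simp
  also have "\<dots> = ev (x # u) \<cdot> ev xs"
    using Cons assms red_words ev_Cons[of x u] by (simp add: GPg.m_assoc)
  finally show ?case .
qed (use assms red_words in auto)

text \<open>Van der Waerden's trick: this is a normal subgroup containing the commutators, hence it contains
  their normal closure.\<close>

definition act_kernel :: "('v \<times> 'a) list set set" where
  "act_kernel = fp_class ` {u \<in> words. \<forall>xs. red xs \<longrightarrow> act u xs \<asymp> xs}"

lemma act_word_inv: "u \<in> words \<Longrightarrow> red xs \<Longrightarrow> act (word_inv u) (act u xs) \<asymp> xs"
  using fp_eq_act[OF fp_eq_word_inv] by fastforce

lemma act_word_inv': "u \<in> words \<Longrightarrow> red xs \<Longrightarrow> act u (act (word_inv u) xs) \<asymp> xs"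
proof -
  assume u: "u \<in> words" "red xs"
  have "word_inv (word_inv u) = u"
    using u(1) by (induction u) (auto simp: group.inv_inv[OF vertex_group])
  then show ?thesis
    using act_word_inv[of "word_inv u" xs] u by simp
qed

lemma act_kernel_normal: "act_kernel \<lhd> FP"
  unfolding group.normal_inv_iff[OF group_FP]
proof (intro conjI ballI)
  show "subgroup act_kernel FP"
  proof (rule group.subgroupI[OF group_FP])
    show "act_kernel \<subseteq> carrier FP"
      by (auto simp: act_kernel_def carrier_FP)
    have "[] \<in> {u \<in> words. \<forall>xs. red xs \<longrightarrow> act u xs \<asymp> xs}"
      by simp
    then show "act_kernel \<noteq> {}"
      unfolding act_kernel_def by blast
    fix x assume "x \<in> act_kernel"
    then obtain u where u: "u \<in> words" "\<And>xs. red xs \<Longrightarrow> act u xs \<asymp> xs" "x = fp_class u"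
      by (auto simp: act_kernel_def)
    have "act (word_inv u) xs \<asymp> xs" if "red xs" for xs
      using act_word_inv[OF u(1) that] shuffle_act[OF u(2)[OF that], of "word_inv u"]
      by (meson shuffle_sym shuffle_trans)
    then show "inv\<^bsub>FP\<^esub> x \<in> act_kernel"
      using u by (auto simp: act_kernel_def inv_FP)
    fix y assume "y \<in> act_kernel"
    then obtain w where w: "w \<in> words" "\<And>xs. red xs \<Longrightarrow> act w xs \<asymp> xs" "y = fp_class w"
      by (auto simp: act_kernel_def)
    have "act (u @ w) xs \<asymp> xs" if "red xs" for xs
      using u(2)[OF that] shuffle_act[OF w(2)[OF that], of u] shuffle_trans by auto
    then have "fp_class (u @ w) \<in> act_kernel"
      unfolding act_kernel_def using u w by (intro imageI) auto
    then show "x \<otimes>\<^bsub>FP\<^esub> y \<in> act_kernel"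
      using u w by (simp add: mult_FP)
  qed
next
  fix x h assume x: "x \<in> carrier FP" and "h \<in> act_kernel"
  then obtain u where u: "u \<in> words" "\<And>xs. red xs \<Longrightarrow> act u xs \<asymp> xs" "h = fp_class u"
    by (auto simp: act_kernel_def)
  from x obtain w where w: "w \<in> words" "x = fp_class w"
    by (auto simp: carrier_FP)
  have "act (w @ u @ word_inv w) xs \<asymp> xs" if "red xs" for xs
  proof -
    have "act (w @ u @ word_inv w) xs = act w (act u (act (word_inv w) xs))" by simp
    also have "\<dots> \<asymp> act w (act (word_inv w) xs)"
      using that w u red_act by (intro shuffle_act u(2)) auto
    also have "\<dots> \<asymp> xs"
      using that w by (intro act_word_inv')
    finally show ?thesis .
  qed
  then have "fp_class (w @ u @ word_inv w) \<in> act_kernel"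
    unfolding act_kernel_def using u w by (intro imageI) auto
  then show "x \<otimes>\<^bsub>FP\<^esub> h \<otimes>\<^bsub>FP\<^esub> inv\<^bsub>FP\<^esub> x \<in> act_kernel"
    using u w by (simp add: mult_FP inv_FP)
qed

lemma commutators_in_act_kernel: "commutators \<subseteq> act_kernel"
proof -
  have "fp_class [(v, a), (w, b), (v, inv\<^bsub>G v\<^esub> a), (w, inv\<^bsub>G w\<^esub> b)] \<in> act_kernel"
    if *: "adj v w" "a \<in> carrier (G v)" "b \<in> carrier (G w)" for v w a b
  proof -
    have V: "v \<in> V" "w \<in> V"
      using * edge_vertices by (auto simp: adj_def)
    have inv: "inv\<^bsub>G v\<^esub> a \<in> carrier (G v)" "inv\<^bsub>G w\<^esub> b \<in> carrier (G w)"
      using * V by (auto simp: group.inv_closed[OF vertex_group])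
    have "act [(v, a), (w, b), (v, inv\<^bsub>G v\<^esub> a), (w, inv\<^bsub>G w\<^esub> b)] xs \<asymp> xs" if "red xs" for xs
    proof -
      let ?ys = "act [(v, inv\<^bsub>G v\<^esub> a), (w, inv\<^bsub>G w\<^esub> b)] xs"
      have "red ?ys"
        using inv V that by (intro red_act) auto
      \<comment> \<open>Once the two outer letters are exchanged, each letter meets its own
        inverse.\<close>
      then have "act [(v, a), (w, b)] ?ys \<asymp> act [(w, b), (v, a)] ?ys"
        using push_commute[of ?ys v a w b] * V by (simp del: push.simps)
      also have "\<dots> = act [(w, b)] (act [(v, a), (v, inv\<^bsub>G v\<^esub> a)] (act [(w, inv\<^bsub>G w\<^esub> b)] xs))"
        by (simp del: push.simps)
      also have "\<dots> \<asymp> act [(w, b)] (act [(w, inv\<^bsub>G w\<^esub> b)] xs)"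
        using act_word_inv'[of "[(v, a)]" "act [(w, inv\<^bsub>G w\<^esub> b)] xs"] * V inv that red_act[of "[(w, inv\<^bsub>G w\<^esub> b)]" xs]
        by (intro shuffle_act) (simp del: push.simps)
      also have "\<dots> \<asymp> xs"
        using act_word_inv'[of "[(w, b)]" xs] * V that by (simp del: push.simps)
      finally show ?thesis by (simp del: push.simps)
    qed
    then show ?thesis
      unfolding act_kernel_def using * V inv by (intro imageI) auto
  qed
  then show ?thesis
    unfolding commutators_eq by blast
qed

text \<open>Words with the same value differ in the free product by an element of the normal
  closure, which acts trivially up to shuffling. So \<open>u\<close> and \<open>w\<close> act alike
  on the empty word, and the results are \<open>u\<close> and \<open>w\<close> by
  \<open>act_red\<close>.\<close>

theorem normal_form_unique:
  assumes "red u" "red w" "ev u = ev w"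
  shows "u \<asymp> w"
proof -
  have uw: "u \<in> words" "w \<in> words"
    using assms red_words by auto
  have "NC \<subseteq> act_kernel"
    using act_kernel_normal commutators_in_act_kernel by (auto simp: normal_closure_def)
  have "fp_class u \<in> ev w"
    using assms(3) uw group.rcos_self[OF group_FP, of "fp_class u" NC] normal_imp_subgroup[OF NC_normal]
    by (simp add: ev_def[of u] carrier_FP)
  then obtain n where "n \<in> NC" "fp_class u = n \<otimes>\<^bsub>FP\<^esub> fp_class w"
    by (auto simp: ev_def r_coset_def)
  then obtain z where z: "z \<in> words" "\<And>xs. red xs \<Longrightarrow> act z xs \<asymp> xs" "n = fp_class z"
    using \<open>NC \<subseteq> act_kernel\<close> by (auto simp: act_kernel_def)
  then have "fp_eq V G u (z @ w)"
    using \<open>fp_class u = n \<otimes>\<^bsub>FP\<^esub> fp_class w\<close> uw by (simp add: mult_FP fp_class_eq_iff)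
  then have "act u [] \<asymp> act (z @ w) []"
    by (intro fp_eq_act) auto
  then show ?thesis
    using z(2)[OF assms(2)] by (auto simp: act_red assms intro: shuffle_trans)
qed

lemma normal_form_exists:
  assumes "x \<in> carrier GP"
  obtains u where "red u" "ev u = x"
proof -
  obtain w where "w \<in> words" "x = ev w"
    using assms by (auto simp: carrier_GP)
  then show ?thesis
    using that[of "act w []"] ev_act[of w "[]"] red_act[of w "[]"] by simp
qed

section \<open>Gates\<close>

lemma ginv_mult_cancel [simp]:
  assumes "x \<in> carrier GP" "y \<in> carrier GP"
  shows "ginv x \<cdot> (x \<cdot> y) = y" "x \<cdot> (ginv x \<cdot> y) = y"
  using assms by (simp_all flip: GPg.m_assoc)

abbreviation nofront :: "'v set \<Rightarrow> ('v \<times> 'a) list \<Rightarrow> bool" where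
  "nofront \<Lambda> xs \<equiv> \<forall>v\<in>\<Lambda>. \<not> front v xs"

section \<open>Subgroups spanned by subgraphs\<close>

lemma span_eq:
  assumes "\<Lambda> \<subseteq> V"
  shows "span \<Lambda> = ev ` {u \<in> words. fst ` set u \<subseteq> \<Lambda>}"
proof (intro equalityI subsetI)
  fix x assume "x \<in> span \<Lambda>"
  then show "x \<in> ev ` {u \<in> words. fst ` set u \<subseteq> \<Lambda>}"
    unfolding span_def
  proof (induction rule: generate.induct)
    case one
    then show ?case
      by (intro image_eqI[of _ _ "[]"]) auto
  next
    case (incl h)
    then obtain v a where "v \<in> \<Lambda>" "a \<in> carrier (G v)" "h = ev [(v, a)]"
      by (auto simp: incl_ev)
    then show ?case
      using assms by (intro image_eqI[of _ _ "[(v, a)]"]) auto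
  next
    case (inv h)
    then obtain v a where "v \<in> \<Lambda>" "a \<in> carrier (G v)" "h = ev [(v, a)]"
      by (auto simp: incl_ev)
    then show ?case
      using assms ev_word_inv[of "[(v, a)]"] words_word_inv[of "[(v, a)]"]
      by (intro image_eqI[of _ _ "word_inv [(v, a)]"]) auto
  next
    case (eng g h)
    then obtain u w where "u \<in> words" "fst ` set u \<subseteq> \<Lambda>" "g = ev u"
        "w \<in> words" "fst ` set w \<subseteq> \<Lambda>" "h = ev w"
      by blast
    then show ?case
      by (intro image_eqI[of _ _ "u @ w"]) (auto simp: ev_append)
  qed
next
  fix x assume "x \<in> ev ` {u \<in> words. fst ` set u \<subseteq> \<Lambda>}"
  then obtain u where "u \<in> words" "fst ` set u \<subseteq> \<Lambda>" "x = ev u"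
    by blast
  then show "x \<in> span \<Lambda>"
  proof (induction u arbitrary: x)
    case Nil
    then show ?case by (simp add: span_def generate.one)
  next
    case (Cons y u)
    then have "ev [y] \<in> incl (fst y) ` carrier (G (fst y))"
      by (cases y) (auto simp: incl_ev)
    then have "ev [y] \<in> span \<Lambda>"
      unfolding span_def using Cons.prems by (intro generate.incl) auto
    moreover have "ev u \<in> span \<Lambda>"
      using Cons by simp
    ultimately show ?case
      using Cons.prems ev_Cons[of y u] unfolding span_def by (auto intro: generate.eng)
  qed
qed

lemma ev_in_span: "\<Lambda> \<subseteq> V \<Longrightarrow> u \<in> words \<Longrightarrow> fst ` set u \<subseteq> \<Lambda> \<Longrightarrow> ev u \<in> span \<Lambda>"
  by (auto simp: span_eq)

text \<open>Normalising a word by \<open>act\<close> creates no new vertices and shuffles keep the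
  letters, so no reduced word of an element of the subgroup leaves \<Lambda>. Membership becomes a
  condition on supports.\<close>

lemma red_in_span_iff:
  assumes "\<Lambda> \<subseteq> V" "red u"
  shows "ev u \<in> span \<Lambda> \<longleftrightarrow> fst ` set u \<subseteq> \<Lambda>"
proof
  assume "ev u \<in> span \<Lambda>"
  then obtain w where w: "w \<in> words" "fst ` set w \<subseteq> \<Lambda>" "ev u = ev w"
    using span_eq[OF assms(1)] by auto
  then have "ev u = ev (act w [])" "red (act w [])"
    using ev_act[of w "[]"] red_act by auto
  then have "u \<asymp> act w []"
    using assms(2) normal_form_unique by blast
  then have "set u = set (act w [])"
    by (rule shuffle_set)
  then show "fst ` set u \<subseteq> \<Lambda>"
    using act_vertices[of w] w by auto
qed (use assms red_words ev_in_span in auto)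

lemma span_red_cases:
  assumes "\<Lambda> \<subseteq> V" "x \<in> span \<Lambda>"
  obtains u where "red u" "ev u = x" "fst ` set u \<subseteq> \<Lambda>"
proof -
  have "x \<in> carrier GP"
    using assms span_eq by auto
  then obtain u where "red u" "ev u = x"
    using normal_form_exists by blast
  then show ?thesis
    using that red_in_span_iff assms by auto
qed

lemma subgroup_span: "\<Lambda> \<subseteq> V \<Longrightarrow> subgroup (span \<Lambda>) GP"
  unfolding span_def by (intro GPg.generate_is_subgroup) (auto simp: incl_ev)

lemma span_closed [simp]: "\<Lambda> \<subseteq> V \<Longrightarrow> x \<in> span \<Lambda> \<Longrightarrow> x \<in> carrier GP"
  using subgroup.mem_carrier[OF subgroup_span] by blast

lemma span_mono: "\<Omega> \<subseteq> \<Lambda> \<Longrightarrow> span \<Omega> \<subseteq> span \<Lambda>"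
  unfolding span_def by (intro GPg.mono_generate) blast

lemma span_one [simp]: "\<one>\<^bsub>GP\<^esub> \<in> span \<Lambda>"
  by (simp add: span_def generate.one)

lemma span_mult: "\<Lambda> \<subseteq> V \<Longrightarrow> x \<in> span \<Lambda> \<Longrightarrow> y \<in> span \<Lambda> \<Longrightarrow> x \<cdot> y \<in> span \<Lambda>"
  by (rule subgroup.m_closed[OF subgroup_span])

lemma span_inv: "\<Lambda> \<subseteq> V \<Longrightarrow> x \<in> span \<Lambda> \<Longrightarrow> ginv x \<in> span \<Lambda>"
  by (rule subgroup.m_inv_closed[OF subgroup_span])

lemma span_empty: "span {} = {\<one>\<^bsub>GP\<^esub>}"
  by (auto simp: span_eq)

lemma span_commute:
  assumes "\<Lambda> \<subseteq> V" "\<Omega> \<subseteq> V" "\<And>v w. v \<in> \<Lambda> \<Longrightarrow> w \<in> \<Omega> \<Longrightarrow> adj v w" "x \<in> span \<Lambda>" "y \<in> span \<Omega>"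
  shows "x \<cdot> y = y \<cdot> x"
proof -
  obtain u w where u: "u \<in> words" "fst ` set u \<subseteq> \<Lambda>" "x = ev u"
      and w: "w \<in> words" "fst ` set w \<subseteq> \<Omega>" "y = ev w"
    using assms span_eq[of \<Lambda>] span_eq[of \<Omega>] by auto
  have "u @ w \<asymp> w @ u"
    using u w assms(3) by (intro shuffle_commute) blast
  then have "ev (u @ w) = ev (w @ u)"
    using u w by (intro ev_shuffle) auto
  then show ?thesis
    using u w by (simp add: ev_append)
qed

lemma word_inv_inv [simp]: "u \<in> words \<Longrightarrow> word_inv (word_inv u) = u"
  by (induction u) (auto simp: group.inv_inv[OF vertex_group])

lemma front_map_fst: "map fst xs = map fst ys \<Longrightarrow> front v xs \<longleftrightarrow> front v ys"
  by (induction xs ys rule: list_induct2') auto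

lemma front_word_inv [simp]: "front v (word_inv u) \<longleftrightarrow> rear v u"
  by (rule front_map_fst) (simp add: word_inv_def rev_map comp_def)

lemma rear_word_inv [simp]: "rear v (word_inv u) \<longleftrightarrow> front v u"
  by (rule front_map_fst) (simp add: word_inv_def rev_map comp_def)

lemma red_word_inv: "red u \<Longrightarrow> red (word_inv u)"
proof (induction u)
  case (Cons x u)
  then interpret Gx: group "G (fst x)" by (intro vertex_group) auto
  show ?case
    using Cons by (auto simp: red_append Gx.inv_eq_1_iff)
qed simp

text \<open>Free letters of \<Lambda> are pulled out one after the other until none is left at the
  front of the rest; the length of the word bounds the number of rounds.\<close>

lemma factor_front:
  assumes "red xs"
  obtains as bs where "xs \<asymp> as @ bs" "fst ` set as \<subseteq> \<Lambda>" "nofront \<Lambda> bs" "red (as @ bs)"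
proof -
  have "\<exists>as bs. xs \<asymp> as @ bs \<and> fst ` set as \<subseteq> \<Lambda> \<and> nofront \<Lambda> bs"
    using assms
  proof (induction "length xs" arbitrary: xs)
    case 0
    then show ?case by (intro exI[of _ "[]"]) auto
  next
    case (Suc n)
    show ?case
    proof (cases "nofront \<Lambda> xs")
      case True
      then show ?thesis
        by (intro exI[of _ "[]"] exI[of _ xs]) auto
    next
      case False
      then obtain v where "v \<in> \<Lambda>" "front v xs" by blast
      then obtain a ys where ys: "xs \<asymp> (v, a) # ys"
        using front_shuffle_Cons by blast
      have "length ys = n" "red ys"
        using Suc shuffle_length[OF ys] shuffle_red[OF ys] by auto
      then obtain as bs where "ys \<asymp> as @ bs" "fst ` set as \<subseteq> \<Lambda>" "nofront \<Lambda> bs"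
        using Suc.hyps by blast
      then have "xs \<asymp> ((v, a) # as) @ bs"
        using ys by (auto intro: shuffle_trans shuffle_Cons)
      then show ?thesis
        using \<open>fst ` set as \<subseteq> \<Lambda>\<close> \<open>nofront \<Lambda> bs\<close> \<open>v \<in> \<Lambda>\<close>
        by (intro exI[of _ "(v, a) # as"] exI[of _ bs]) auto
    qed
  qed
  then show ?thesis
    using that assms shuffle_red by blast
qed

lemma factor_rear:
  assumes "red xs"
  obtains as bs where "xs \<asymp> bs @ as" "fst ` set as \<subseteq> \<Lambda>" "nofront \<Lambda> (rev bs)" "red (bs @ as)"
proof -
  obtain as bs where *: "rev xs \<asymp> as @ bs" "fst ` set as \<subseteq> \<Lambda>" "nofront \<Lambda> bs"
    using factor_front[of "rev xs" \<Lambda>] assms red_rev[of xs] by metis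
  then have "xs \<asymp> rev bs @ rev as"
    using shuffle_rev by fastforce
  then show ?thesis
    using that[of "rev bs" "rev as"] * assms shuffle_red by auto
qed

section \<open>Syllable length and the formula for gates\<close>

definition rlen :: "('v \<times> 'a) list set set \<Rightarrow> nat" where
  "rlen x = (THE n. \<exists>u. red u \<and> ev u = x \<and> length u = n)"

lemma rlen_ev: "red u \<Longrightarrow> rlen (ev u) = length u"
  unfolding rlen_def using normal_form_unique shuffle_length by (intro the_equality) metis+

lemma rlen_ev_le: "u \<in> words \<Longrightarrow> rlen (ev u) \<le> length u"
  using rlen_ev[of "act u []"] ev_act[of u "[]"] red_act[of u "[]"] length_act[of u] by simp

lemma rlen_inv:
  assumes "x \<in> carrier GP"
  shows "rlen (ginv x) = rlen x"
proof -
  obtain u where u: "red u" "ev u = x"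
    using normal_form_exists assms by blast
  then have "ginv x = ev (word_inv u)"
    using ev_word_inv red_words by auto
  then show ?thesis
    using u red_word_inv[of u] by (auto simp: rlen_ev)
qed

lemma syl_dist_eq:
  assumes "x \<in> carrier GP" "y \<in> carrier GP"
  shows "syl_dist x y = rlen (ginv x \<cdot> y)"
proof -
  define R where "R = {(g, h). g \<in> carrier GP \<and> h \<in> carrier GP \<and> g \<noteq> h \<and>
              (\<exists>v\<in>V. ginv g \<cdot> h \<in> incl v ` carrier (G v))}"
  have lower: "z \<in> carrier GP \<and> rlen (ginv x \<cdot> z) \<le> n" if "(x, z) \<in> R ^^ n" for z n
    using that
  proof (induction n arbitrary: z)
    case 0
    then show ?case
      using assms rlen_ev_le[of "[]"] by simp
  next
    case (Suc n)
    then obtain w where "(x, w) \<in> R ^^ n" and wz: "(w, z) \<in> R" by auto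
    then have w: "w \<in> carrier GP" "rlen (ginv x \<cdot> w) \<le> n"
      using Suc.IH by auto
    obtain u where u: "red u" "ev u = ginv x \<cdot> w"
      using normal_form_exists assms w by (metis GPg.inv_closed GPg.m_closed)
    obtain v a where va: "v \<in> V" "a \<in> carrier (G v)" "ginv w \<cdot> z = ev [(v, a)]" "z \<in> carrier GP"
      using wz by (auto simp: R_def incl_ev)
    have "ginv x \<cdot> z = ginv x \<cdot> w \<cdot> (ginv w \<cdot> z)"
      using assms w va(4) by (simp add: GPg.m_assoc)
    also have "\<dots> = ev (u @ [(v, a)])"
      using u va red_words by (simp add: ev_append)
    finally have "rlen (ginv x \<cdot> z) \<le> Suc (length u)"
      using rlen_ev_le[of "u @ [(v, a)]"] u va red_words by auto
    then show ?case
      using w u va rlen_ev[OF u(1)] by auto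
  qed
  have upper: "(z, z \<cdot> ev u) \<in> R ^^ length u" if "red u" "z \<in> carrier GP" for u z
    using that
  proof (induction u arbitrary: z)
    case (Cons l u)
    then have l: "red [l]" "ev [l] \<in> carrier GP" and u: "u \<in> words"
      using red_words by auto
    \<comment> \<open>Edges of the syllable graph join distinct elements, so a letter must be
      nontrivial in the graph product and not only in its vertex group.\<close>
    have "ev [l] \<noteq> \<one>\<^bsub>GP\<^esub>"
      using normal_form_unique[OF l(1), of "[]"] shuffle_length[of "[l]" "[]"] by auto
    then have "(z, z \<cdot> ev [l]) \<in> R"
      using Cons.prems l by (cases l) (auto simp: R_def incl_ev intro!: bexI[of _ "fst l"])
    moreover have "(z \<cdot> ev [l], z \<cdot> ev [l] \<cdot> ev u) \<in> R ^^ length u"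
      using Cons l by (intro Cons.IH) auto
    moreover have "z \<cdot> ev [l] \<cdot> ev u = z \<cdot> ev (l # u)"
      using Cons.prems l u ev_Cons[of l u] by (simp add: GPg.m_assoc)
    ultimately show ?case
      by (simp add: relpow_Suc_I2 del: relpow.simps)
  qed simp
  obtain u where u: "red u" "ev u = ginv x \<cdot> y"
    using normal_form_exists assms by (metis GPg.inv_closed GPg.m_closed)
  have "(LEAST n. (x, y) \<in> R ^^ n) = rlen (ginv x \<cdot> y)"
  proof (rule Least_equality)
    show "(x, y) \<in> R ^^ rlen (ginv x \<cdot> y)"
      using upper[OF u(1) assms(1)] u assms rlen_ev[OF u(1)] by simp
  qed (use lower in blast)
  then show ?thesis
    by (simp add: syl_dist_def graph_dist_def R_def)
qed

text \<open>For \<open>l\<close> in the subgroup let \<open>cs\<close> be a reduced word for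
  \<open>ginv l \<cdot> ev as\<close>. Since \<open>bs\<close> has no free letter of \<Lambda> at
  its front, \<open>cs @ bs\<close> stays reduced, and the distance to \<open>k \<cdot> l\<close> is
  \<open>length cs + length bs\<close>. It is least exactly when \<open>cs\<close> is empty, that is
  for \<open>l = ev as\<close>.\<close>

lemma gate_ev:
  assumes "\<Lambda> \<subseteq> V" "k \<in> carrier GP" "red (as @ bs)" "fst ` set as \<subseteq> \<Lambda>" "nofront \<Lambda> bs"
  shows "gate (k <#\<^bsub>GP\<^esub> span \<Lambda>) (k \<cdot> ev (as @ bs)) = k \<cdot> ev as"
proof -
  let ?x = "k \<cdot> ev (as @ bs)"
  have ab: "red as" "red bs" "as \<in> words" "bs \<in> words"
    using assms(3) red_words by (auto simp: red_append)
  have as: "ev as \<in> span \<Lambda>"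
    using ev_in_span assms ab by blast
  have *: "\<exists>cs. red cs \<and> ev cs = ginv l \<cdot> ev as \<and> syl_dist ?x (k \<cdot> l) = length cs + length bs"
    if l: "l \<in> span \<Lambda>" for l
  proof -
    have "ginv l \<cdot> ev as \<in> span \<Lambda>"
      using assms(1) as l by (intro span_mult span_inv)
    then obtain cs where cs: "red cs" "ev cs = ginv l \<cdot> ev as" "fst ` set cs \<subseteq> \<Lambda>"
      using span_red_cases assms(1) by blast
    have "red (cs @ bs)"
      using cs ab assms(5) rear_in_set by (fastforce simp: red_append)
    have lc: "l \<in> carrier GP" using assms(1) l by simp
    have "ginv (ginv ?x \<cdot> (k \<cdot> l)) = ginv l \<cdot> (ginv k \<cdot> (k \<cdot> (ev as \<cdot> ev bs)))"
      using assms(2) ab lc by (simp add: ev_append GPg.inv_mult_group GPg.m_assoc)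
    also have "\<dots> = ev (cs @ bs)"
      using assms(2) ab lc cs red_words by (simp add: ev_append GPg.m_assoc)
    finally have "syl_dist ?x (k \<cdot> l) = rlen (ev (cs @ bs))"
      using assms(2) ab lc by (metis GPg.inv_closed GPg.m_closed ev_closed rlen_inv syl_dist_eq words_append)
    then show ?thesis
      using rlen_ev[OF \<open>red (cs @ bs)\<close>] cs by auto
  qed
  have in_coset: "z \<in> k <#\<^bsub>GP\<^esub> span \<Lambda> \<longleftrightarrow> (\<exists>l\<in>span \<Lambda>. z = k \<cdot> l)" for z
    by (auto simp: l_coset_def)
  have min: "syl_dist ?x (k \<cdot> ev as) = length bs"
  proof -
    obtain cs where cs: "red cs" "ev cs = ginv (ev as) \<cdot> ev as" "syl_dist ?x (k \<cdot> ev as) = length cs + length bs"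
      using *[OF as] by blast
    then have "cs \<asymp> []"
      using ab by (intro normal_form_unique) auto
    then show ?thesis
      using cs shuffle_length by fastforce
  qed
  have uniq: "l = ev as" if l: "l \<in> span \<Lambda>" and le: "syl_dist ?x (k \<cdot> l) \<le> length bs" for l
  proof -
    obtain cs where cs: "ev cs = ginv l \<cdot> ev as" "syl_dist ?x (k \<cdot> l) = length cs + length bs"
      using *[OF l] by blast
    then have "ginv l \<cdot> ev as = \<one>\<^bsub>GP\<^esub>"
      using le by auto
    then have "l \<cdot> (ginv l \<cdot> ev as) = l"
      using l assms(1) by simp
    then show ?thesis
      using l assms(1) ab by simp
  qed
  show ?thesis
    unfolding gate_def
  proof (rule the_equality)
    have "length bs \<le> syl_dist ?x (k \<cdot> l)" if "l \<in> span \<Lambda>" for l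
      using *[OF that] by auto
    then show "is_arg_min (syl_dist ?x) (\<lambda>z. z \<in> k <#\<^bsub>GP\<^esub> span \<Lambda>) (k \<cdot> ev as)"
      using as unfolding is_arg_min_def in_coset by (metis min not_less)
  next
    fix z assume z: "is_arg_min (syl_dist ?x) (\<lambda>z. z \<in> k <#\<^bsub>GP\<^esub> span \<Lambda>) z"
    then obtain l where l: "l \<in> span \<Lambda>" "z = k \<cdot> l"
      by (auto simp: is_arg_min_def in_coset)
    have "k \<cdot> ev as \<in> k <#\<^bsub>GP\<^esub> span \<Lambda>"
      using as in_coset by blast
    then have "syl_dist ?x z \<le> length bs"
      using z unfolding is_arg_min_def by (metis min not_less)
    then show "z = k \<cdot> ev as"
      using uniq l by auto
  qed
qed

text \<open>The gate of the subgroup itself. All other gates are translates of it by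
  \<open>gate_eq\<close>, so the geometry can be done at the identity coset.\<close>

definition proj :: "'v set \<Rightarrow> ('v \<times> 'a) list set set \<Rightarrow> ('v \<times> 'a) list set set" where
  "proj \<Lambda> x = gate (span \<Lambda>) x"

lemma proj_ev:
  assumes "\<Lambda> \<subseteq> V" "red (as @ bs)" "fst ` set as \<subseteq> \<Lambda>" "nofront \<Lambda> bs"
  shows "proj \<Lambda> (ev (as @ bs)) = ev as"
proof -
  have "\<one>\<^bsub>GP\<^esub> <#\<^bsub>GP\<^esub> span \<Lambda> = span \<Lambda>"
    using assms(1) by (force simp: l_coset_def)
  moreover have "ev as \<in> carrier GP" "ev (as @ bs) \<in> carrier GP"
    using assms(2) red_words red_append ev_closed by blast+
  ultimately show ?thesis
    using gate_ev[OF assms(1) _ assms(2-4), of "\<one>\<^bsub>GP\<^esub>"] by (simp add: proj_def)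
qed

lemma proj_cases:
  assumes "\<Lambda> \<subseteq> V" "x \<in> carrier GP"
  obtains as bs where "red (as @ bs)" "fst ` set as \<subseteq> \<Lambda>" "nofront \<Lambda> bs" "x = ev (as @ bs)"
    "x = ev as \<cdot> ev bs" "proj \<Lambda> x = ev as"
proof -
  obtain u where u: "red u" "ev u = x"
    using assms normal_form_exists by blast
  obtain as bs where ab: "u \<asymp> as @ bs" "fst ` set as \<subseteq> \<Lambda>" "nofront \<Lambda> bs" "red (as @ bs)"
    using factor_front u by blast
  then have "x = ev (as @ bs)"
    using u red_words ev_shuffle by blast
  moreover have "as \<in> words" "bs \<in> words"
    using red_words[OF ab(4)] by auto
  ultimately show ?thesis
    using that ab proj_ev assms by (metis ev_append)
qed

lemma gate_eq:
  assumes "\<Lambda> \<subseteq> V" "k \<in> carrier GP" "x \<in> carrier GP"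
  shows "gate (k <#\<^bsub>GP\<^esub> span \<Lambda>) x = k \<cdot> proj \<Lambda> (ginv k \<cdot> x)"
proof -
  obtain as bs where "red (as @ bs)" "fst ` set as \<subseteq> \<Lambda>" "nofront \<Lambda> bs" "ginv k \<cdot> x = ev (as @ bs)"
    "proj \<Lambda> (ginv k \<cdot> x) = ev as"
    using proj_cases[OF assms(1), of "ginv k \<cdot> x"] assms GPg.inv_closed GPg.m_closed by metis
  then show ?thesis
    using gate_ev[OF assms(1,2), of as bs] assms by (metis ginv_mult_cancel(2))
qed

lemma proj_in_span [simp]: "\<Lambda> \<subseteq> V \<Longrightarrow> x \<in> carrier GP \<Longrightarrow> proj \<Lambda> x \<in> span \<Lambda>"
  by (metis ev_in_span proj_cases red_words words_append)

lemma proj_closed [simp]: "\<Lambda> \<subseteq> V \<Longrightarrow> x \<in> carrier GP \<Longrightarrow> proj \<Lambda> x \<in> carrier GP"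
  by (meson proj_in_span span_closed)

lemma proj_span_mult:
  assumes "\<Lambda> \<subseteq> V" "l \<in> span \<Lambda>" "x \<in> carrier GP"
  shows "proj \<Lambda> (l \<cdot> x) = l \<cdot> proj \<Lambda> x"
proof -
  obtain as bs where ab: "red (as @ bs)" "fst ` set as \<subseteq> \<Lambda>" "nofront \<Lambda> bs" "x = ev as \<cdot> ev bs"
    "proj \<Lambda> x = ev as"
    using proj_cases assms by metis
  then have w: "as \<in> words" "bs \<in> words"
    using red_words by fastforce+
  have "l \<cdot> ev as \<in> span \<Lambda>"
    using assms ab w by (intro span_mult ev_in_span) auto
  then obtain cs where cs: "red cs" "ev cs = l \<cdot> ev as" "fst ` set cs \<subseteq> \<Lambda>"
    using span_red_cases assms(1) by blast
  then have "red (cs @ bs)"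
    using ab rear_in_set by (fastforce simp: red_append)
  moreover have "l \<cdot> x = ev (cs @ bs)"
    using cs ab w assms red_words by (simp add: ev_append GPg.m_assoc)
  ultimately show ?thesis
    using proj_ev[OF assms(1)] cs ab by simp
qed

lemma link_eq: "\<Lambda> \<subseteq> V \<Longrightarrow> link \<Lambda> = {v \<in> V. \<forall>w\<in>\<Lambda>. adj v w}"
  using adj_irrefl by (auto simp: link_def adj_def[symmetric])

lemma link_subset: "link \<Lambda> \<subseteq> V"
  by (auto simp: link_def)

text \<open>An edge of the syllable graph moves the gate only if it is parallel to an edge of the
  coset: the element leading from the gate to \<open>x\<close> then commutes with the letter. Both
  the Lipschitz property of gates and the crossing of walls rest on this.\<close>

lemma proj_step:
  assumes "\<Lambda> \<subseteq> V" "x \<in> carrier GP" "v \<in> V" "a \<in> carrier (G v)"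
  shows "proj \<Lambda> (x \<cdot> ev [(v, a)]) = proj \<Lambda> x \<or>
    v \<in> \<Lambda> \<and> proj \<Lambda> (x \<cdot> ev [(v, a)]) = proj \<Lambda> x \<cdot> ev [(v, a)] \<and> ginv (proj \<Lambda> x) \<cdot> x \<in> span (link {v})"
proof -
  interpret Gv: group "G v" by (rule vertex_group[OF assms(3)])
  let ?s = "ev [(v, a)]"
  obtain as bs where ab: "red (as @ bs)" "fst ` set as \<subseteq> \<Lambda>" "nofront \<Lambda> bs" "x = ev as \<cdot> ev bs"
    "proj \<Lambda> x = ev as"
    using proj_cases assms by metis
  have w: "as \<in> words" "bs \<in> words" and r: "red as" "red bs"
    using red_words ab(1) by (fastforce simp: red_append)+
  have s: "?s \<in> carrier GP" using assms by simp
  have red_as: "red (as @ cs)" if "red cs" "nofront \<Lambda> cs" for cs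
    using that r ab(2) rear_in_set by (fastforce simp: red_append)
  have keep: "proj \<Lambda> (x \<cdot> ?s) = proj \<Lambda> x" if "red cs" "nofront \<Lambda> cs" "ev bs \<cdot> ?s = ev cs" for cs
  proof -
    have "x \<cdot> ?s = ev (as @ cs)"
      using that ab w s red_words by (simp add: ev_append GPg.m_assoc)
    then show ?thesis
      using proj_ev[OF assms(1) red_as ab(2)] that ab by simp
  qed
  consider "a = \<one>\<^bsub>G v\<^esub>" | "a \<noteq> \<one>\<^bsub>G v\<^esub>" "rear v bs" | "a \<noteq> \<one>\<^bsub>G v\<^esub>" "\<not> rear v bs" by blast
  then show ?thesis
  proof cases
    case 1
    then show ?thesis using assms by (simp add: ev_one)
  next
    case 2
    \<comment> \<open>The letter merges into one of the same vertex at the end of the tail. This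
      frees nothing at the front of the tail, so the gate stays.\<close>
    obtain b cs where cs: "bs \<asymp> cs @ [(v, b)]"
      using 2 rear_shuffle_snoc by blast
    then have "red (cs @ [(v, b)])" using r shuffle_red by blast
    then have c: "red cs" "b \<in> carrier (G v)" "\<not> rear v cs" "cs \<in> words"
      using red_words by (auto simp: red_append)
    have nf: "nofront \<Lambda> cs"
      using ab(3) shuffle_front[OF cs] by auto
    have "ev bs \<cdot> ?s = ev cs \<cdot> ev [(v, b)] \<cdot> ?s"
      using ev_shuffle[OF cs] w c assms by (simp add: ev_append)
    also have "\<dots> = ev cs \<cdot> ev [(v, b \<otimes>\<^bsub>G v\<^esub> a)]"
      using c assms by (simp add: GPg.m_assoc ev_mult)
    finally have e: "ev bs \<cdot> ?s = ev cs \<cdot> ev [(v, b \<otimes>\<^bsub>G v\<^esub> a)]" .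
    show ?thesis
    proof (cases "b \<otimes>\<^bsub>G v\<^esub> a = \<one>\<^bsub>G v\<^esub>")
      case True
      then have "ev bs \<cdot> ?s = ev cs"
        using e c assms by (simp add: ev_one)
      then show ?thesis
        using keep c nf by blast
    next
      case False
      have "red (cs @ [(v, b \<otimes>\<^bsub>G v\<^esub> a)])"
        using False c assms by (auto simp: red_append)
      moreover have "nofront \<Lambda> (cs @ [(v, b \<otimes>\<^bsub>G v\<^esub> a)])"
        using ab(3) shuffle_front[OF cs] by auto
      ultimately show ?thesis
        using keep e c assms by (simp add: ev_append)
    qed
  next
    case 3
    have red: "red (bs @ [(v, a)])"
      using r 3 assms by (auto simp: red_append)
    show ?thesis
    proof (cases "nofront \<Lambda> (bs @ [(v, a)])")
      case True
      then show ?thesis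
        using keep[OF red] w assms by (simp add: ev_append)
    next
      \<comment> \<open>The new letter becomes free at the front, so it commutes with the whole tail
        \<open>bs\<close> and slides into the prefix.\<close>
      case False
      then have v: "v \<in> \<Lambda>" "adjl v bs"
        using ab(3) by auto
      have "ev bs \<in> span (link {v})"
        using v w words_vertices[OF w(2)] assms by (intro ev_in_span) (auto simp: link_eq adj_commute)
      moreover have "?s \<in> span {v}"
        using assms by (intro ev_in_span) auto
      then have "?s \<cdot> ev bs = ev bs \<cdot> ?s"
        using assms link_subset \<open>ev bs \<in> span (link {v})\<close>
        by (intro span_commute[of "{v}" "link {v}"]) (auto simp: link_eq adj_commute)
      moreover have "ev as \<cdot> ?s \<in> span \<Lambda>"
        using v w ab assms by (intro span_mult ev_in_span) auto
      then have "proj \<Lambda> (ev as \<cdot> ?s \<cdot> ev bs) = ev as \<cdot> ?s \<cdot> proj \<Lambda> (ev bs)"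
        using proj_span_mult assms(1) w by simp
      moreover have "proj \<Lambda> (ev bs) = \<one>\<^bsub>GP\<^esub>"
        using proj_ev[of \<Lambda> "[]" bs] r ab assms(1) by simp
      ultimately show ?thesis
        using v w s ab by (simp add: GPg.m_assoc)
    qed
  qed
qed

section \<open>Distances in the coset graphs\<close>

text \<open>The steps of the coset graph with the identity added. Products may thus contain idle
  steps, so that \<open>pieces \<Lambda> n\<close> is a ball about the identity and not a
  sphere.\<close>

definition piece :: "'v set \<Rightarrow> ('v \<times> 'a) list set set set" where
  "piece \<Lambda> = {s \<in> span \<Lambda>. s = \<one>\<^bsub>GP\<^esub> \<or> (\<exists>\<Omega>\<in>subgraphs. \<Omega> \<subset> \<Lambda> \<and> s \<in> span \<Omega>) \<or> s \<in> gens \<union> m_inv GP ` gens}"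

fun pieces :: "'v set \<Rightarrow> nat \<Rightarrow> ('v \<times> 'a) list set set set" where
  "pieces \<Lambda> 0 = {\<one>\<^bsub>GP\<^esub>}"
| "pieces \<Lambda> (Suc n) = {s \<cdot> a | s a. s \<in> piece \<Lambda> \<and> a \<in> pieces \<Lambda> n}"

definition nrm :: "'v set \<Rightarrow> ('v \<times> 'a) list set set \<Rightarrow> nat" where
  "nrm \<Lambda> a = (LEAST n. a \<in> pieces \<Lambda> n)"

lemma piece_closed: "\<Lambda> \<subseteq> V \<Longrightarrow> s \<in> piece \<Lambda> \<Longrightarrow> s \<in> carrier GP"
  by (auto simp: piece_def)

lemma one_in_piece [simp]: "\<one>\<^bsub>GP\<^esub> \<in> piece \<Lambda>"
  by (simp add: piece_def)

lemma pieces_in_span: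
  assumes "\<Lambda> \<subseteq> V" "a \<in> pieces \<Lambda> n"
  shows "a \<in> span \<Lambda>"
  using assms(2) by (induction n arbitrary: a) (auto simp: piece_def intro: span_mult[OF assms(1)])

lemma pieces_closed: "\<Lambda> \<subseteq> V \<Longrightarrow> a \<in> pieces \<Lambda> n \<Longrightarrow> a \<in> carrier GP"
  using pieces_in_span span_closed by blast

lemma pieces_mult:
  assumes "\<Lambda> \<subseteq> V" "a \<in> pieces \<Lambda> m" "b \<in> pieces \<Lambda> n"
  shows "a \<cdot> b \<in> pieces \<Lambda> (m + n)"
  using assms(2)
proof (induction m arbitrary: a)
  case 0
  then show ?case using assms pieces_closed by auto
next
  case (Suc m)
  then obtain s c where sc: "s \<in> piece \<Lambda>" "c \<in> pieces \<Lambda> m" "a = s \<cdot> c" by auto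
  then have "a \<cdot> b = s \<cdot> (c \<cdot> b)"
    using assms pieces_closed piece_closed by (simp add: GPg.m_assoc)
  then show ?case
    using Suc.IH[OF sc(2)] sc(1) by auto
qed

lemma pieces_one: "\<Lambda> \<subseteq> V \<Longrightarrow> s \<in> piece \<Lambda> \<Longrightarrow> s \<in> pieces \<Lambda> 1"
  using piece_closed by (auto intro: exI[of _ s])

lemma pieces_trivial: "\<one>\<^bsub>GP\<^esub> \<in> pieces \<Lambda> n"
  by (induction n) (auto intro!: exI[of _ "\<one>\<^bsub>GP\<^esub>"])

lemma gens_closed: "gens \<subseteq> carrier GP"
  using gens_in_carrier by (fastforce simp: gens_def incl_ev)

lemma piece_inv:
  assumes "\<Lambda> \<subseteq> V" "s \<in> piece \<Lambda>"
  shows "ginv s \<in> piece \<Lambda>"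
proof -
  have s: "s \<in> span \<Lambda>" and "s = \<one>\<^bsub>GP\<^esub> \<or> (\<exists>\<Omega>\<in>subgraphs. \<Omega> \<subset> \<Lambda> \<and> s \<in> span \<Omega>) \<or> s \<in> gens \<union> m_inv GP ` gens"
    using assms(2) by (simp_all add: piece_def)
  then consider "s = \<one>\<^bsub>GP\<^esub>" | \<Omega> where "\<Omega> \<in> subgraphs" "\<Omega> \<subset> \<Lambda>" "s \<in> span \<Omega>"
    | "s \<in> gens" | t where "t \<in> gens" "s = ginv t"
    by blast
  then have "ginv s = \<one>\<^bsub>GP\<^esub> \<or> (\<exists>\<Omega>\<in>subgraphs. \<Omega> \<subset> \<Lambda> \<and> ginv s \<in> span \<Omega>)
      \<or> ginv s \<in> gens \<union> m_inv GP ` gens"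
  proof cases
    case (2 \<Omega>)
    then have "ginv s \<in> span \<Omega>"
      using assms(1) by (intro span_inv) auto
    then show ?thesis using 2 by blast
  next
    case (4 t)
    then have "ginv s = t"
      using gens_closed by auto
    then show ?thesis using 4 by blast
  qed auto
  then show ?thesis
    using span_inv[OF assms(1) s] unfolding piece_def by blast
qed

lemma pieces_inv:
  assumes "\<Lambda> \<subseteq> V" "a \<in> pieces \<Lambda> n"
  shows "ginv a \<in> pieces \<Lambda> n"
  using assms(2)
proof (induction n arbitrary: a)
  case (Suc n)
  then obtain s c where sc: "s \<in> piece \<Lambda>" "c \<in> pieces \<Lambda> n" "a = s \<cdot> c" by auto
  then have "ginv a = ginv c \<cdot> ginv s"
    using assms pieces_closed piece_closed by (simp add: GPg.inv_mult_group)
  then show ?case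
    using pieces_mult[OF assms(1) Suc.IH[OF sc(2)] pieces_one[OF assms(1) piece_inv[OF assms(1) sc(1)]]]
    by simp
qed simp

text \<open>Connectedness of the coset graph. If \<Lambda> has a second vertex, every letter lies in
  the proper subgraph group of its own vertex; for a single vertex the generators \<open>S v\<close>
  are needed.\<close>

lemma pieces_exists:
  assumes "\<Lambda> \<in> subgraphs" "a \<in> span \<Lambda>"
  obtains n where "a \<in> pieces \<Lambda> n"
proof -
  have L: "\<Lambda> \<subseteq> V" using assms by (simp add: subgraphs_def)
  have letter: "\<exists>n. ev [(v, b)] \<in> pieces \<Lambda> n" if v: "v \<in> \<Lambda>" "b \<in> carrier (G v)" for v b
  proof (cases "\<Lambda> = {v}")
    case False
    then have "{v} \<in> subgraphs" "{v} \<subset> \<Lambda>"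
      using v L by (auto simp: subgraphs_def)
    moreover have "ev [(v, b)] \<in> span {v}" "ev [(v, b)] \<in> span \<Lambda>"
      using v L by (auto intro!: ev_in_span)
    ultimately have "ev [(v, b)] \<in> piece \<Lambda>"
      unfolding piece_def by blast
    then show ?thesis
      using pieces_one L by blast
  next
    case True
    have V: "v \<in> V" using v L by auto
    have gen: "ev [(v, s)] \<in> piece \<Lambda>" if "s \<in> S v" for s
    proof -
      have "ev [(v, s)] \<in> span \<Lambda>"
        using that gens_in_carrier[OF V] L V v by (intro ev_in_span) auto
      moreover have "ev [(v, s)] \<in> gens"
        using that V unfolding gens_def incl_ev by blast
      ultimately show ?thesis
        unfolding piece_def by blast
    qed
    have "b \<in> generate (G v) (S v)"
      using gens_generate[OF V] v by simp
    then show ?thesis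
    proof (induction rule: generate.induct)
      case one
      then show ?case
        using V by (auto simp: ev_one intro: pieces_trivial)
    next
      case (incl s)
      then show ?case
        using gen pieces_one L by blast
    next
      case (inv s)
      then have "ev [(v, inv\<^bsub>G v\<^esub> s)] = ginv (ev [(v, s)])"
        using ev_inv V gens_in_carrier by auto
      then show ?case
        using inv gen piece_inv pieces_one L by metis
    next
      case (eng g h)
      then obtain m n where "ev [(v, g)] \<in> pieces \<Lambda> m" "ev [(v, h)] \<in> pieces \<Lambda> n" by blast
      then have "ev [(v, g)] \<cdot> ev [(v, h)] \<in> pieces \<Lambda> (m + n)"
        using pieces_mult L by blast
      moreover have "g \<in> carrier (G v)" "h \<in> carrier (G v)"
        using eng gens_generate[OF V] by auto
      ultimately show ?case
        using V by (auto simp: ev_mult)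
    qed
  qed
  obtain u where u: "u \<in> words" "fst ` set u \<subseteq> \<Lambda>" "a = ev u"
    using assms(2) span_eq[OF L] by auto
  then have "\<exists>n. a \<in> pieces \<Lambda> n"
  proof (induction u arbitrary: a)
    case Nil
    then show ?case using pieces_trivial by auto
  next
    case (Cons x u)
    then obtain m n where "ev [x] \<in> pieces \<Lambda> m" "ev u \<in> pieces \<Lambda> n"
      using letter[of "fst x" "snd x"] by auto
    then have "ev [x] \<cdot> ev u \<in> pieces \<Lambda> (m + n)"
      using pieces_mult L by blast
    then show ?case
      using Cons.prems ev_Cons[of x u] by auto
  qed
  then show ?thesis using that by blast
qed

lemma nrm_le: "a \<in> pieces \<Lambda> n \<Longrightarrow> nrm \<Lambda> a \<le> n"
  unfolding nrm_def by (rule Least_le)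

lemma nrm_pieces: "\<Lambda> \<in> subgraphs \<Longrightarrow> a \<in> span \<Lambda> \<Longrightarrow> a \<in> pieces \<Lambda> (nrm \<Lambda> a)"
  unfolding nrm_def by (meson LeastI pieces_exists)

lemma subgraphs_subset: "\<Lambda> \<in> subgraphs \<Longrightarrow> \<Lambda> \<subseteq> V"
  by (simp add: subgraphs_def)

lemma nrm_mult:
  "\<Lambda> \<in> subgraphs \<Longrightarrow> a \<in> span \<Lambda> \<Longrightarrow> b \<in> span \<Lambda> \<Longrightarrow> nrm \<Lambda> (a \<cdot> b) \<le> nrm \<Lambda> a + nrm \<Lambda> b"
  by (intro nrm_le pieces_mult subgraphs_subset nrm_pieces)

lemma nrm_inv_le: "\<Lambda> \<in> subgraphs \<Longrightarrow> a \<in> span \<Lambda> \<Longrightarrow> nrm \<Lambda> (ginv a) \<le> nrm \<Lambda> a"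
  by (intro nrm_le pieces_inv subgraphs_subset nrm_pieces)

lemma nrm_one [simp]: "nrm \<Lambda> \<one>\<^bsub>GP\<^esub> = 0"
  using nrm_le[of "\<one>\<^bsub>GP\<^esub>" \<Lambda> 0] by simp

text \<open>\<Omega> may be empty here: this is no subgraph, but its span is trivial and the
  identity counts as a piece. The support of any word can then serve as \<Omega>, also that of the
  empty word.\<close>

lemma proper_in_piece:
  assumes "\<Lambda> \<subseteq> V" "\<Omega> \<subset> \<Lambda>" "a \<in> span \<Omega>"
  shows "a \<in> piece \<Lambda>"
proof (cases "\<Omega> = {}")
  case True
  then show ?thesis using assms span_empty by simp
next
  case False
  then have "\<Omega> \<in> subgraphs" "a \<in> span \<Lambda>"
    using assms span_mono[of \<Omega> \<Lambda>] by (auto simp: subgraphs_def)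
  then show ?thesis
    using assms by (auto simp: piece_def)
qed

lemma nrm_proper: "\<Lambda> \<subseteq> V \<Longrightarrow> \<Omega> \<subset> \<Lambda> \<Longrightarrow> a \<in> span \<Omega> \<Longrightarrow> nrm \<Lambda> a \<le> 1"
  using nrm_le pieces_one proper_in_piece by blast

lemma nrm_letter:
  assumes "\<Lambda> \<subseteq> V" "v \<in> \<Lambda>" "s \<in> gens \<union> m_inv GP ` gens" "s \<in> span {v}"
  shows "nrm \<Lambda> s \<le> 1"
proof -
  have "s \<in> span \<Lambda>"
    using span_mono[of "{v}" \<Lambda>] assms by auto
  then have "s \<in> piece \<Lambda>"
    using assms by (auto simp: piece_def)
  then show ?thesis
    using nrm_le pieces_one assms by blast
qed

lemma graph_dist_coset:
  assumes "\<Lambda> \<subseteq> V" "k \<in> carrier GP" "x \<in> k <#\<^bsub>GP\<^esub> span \<Lambda>" "y \<in> k <#\<^bsub>GP\<^esub> span \<Lambda>"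
  shows "graph_dist (coset_graph (k <#\<^bsub>GP\<^esub> span \<Lambda>) \<Lambda>) x y = nrm \<Lambda> (ginv x \<cdot> y)"
proof -
  define A where "A = k <#\<^bsub>GP\<^esub> span \<Lambda>"
  define R where "R = coset_graph A \<Lambda>"
  have A_closed: "z \<in> carrier GP" if "z \<in> A" for z
    using that assms(1,2) by (auto simp: A_def l_coset_def)
  have A_diff: "ginv z \<cdot> w \<in> span \<Lambda>" if zw: "z \<in> A" "w \<in> A" for z w
  proof -
    obtain l m where lm: "l \<in> span \<Lambda>" "m \<in> span \<Lambda>" "z = k \<cdot> l" "w = k \<cdot> m"
      using zw by (auto simp: A_def l_coset_def)
    then have "ginv z \<cdot> w = ginv l \<cdot> m"
      using assms(1,2) by (simp add: GPg.inv_mult_group GPg.m_assoc)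
    then show ?thesis
      using lm assms(1) by (simp add: span_mult span_inv)
  qed
  have A_mult: "z \<cdot> l \<in> A" if zl: "z \<in> A" "l \<in> span \<Lambda>" for z l
  proof -
    obtain m where "m \<in> span \<Lambda>" "z = k \<cdot> m"
      using zl by (auto simp: A_def l_coset_def)
    then show ?thesis
      using zl assms(1,2) span_mult[OF assms(1), of m l]
      by (auto simp: A_def l_coset_def GPg.m_assoc)
  qed
  have lower: "ginv z \<cdot> w \<in> pieces \<Lambda> n \<and> w \<in> A" if "(z, w) \<in> R ^^ n" "z \<in> A" for z w n
    using that
  proof (induction n arbitrary: z)
    case 0
    then show ?case using A_closed by auto
  next
    case (Suc n)
    obtain z' where z': "(z, z') \<in> R" "(z', w) \<in> R ^^ n"
      by (rule relpow_Suc_E2[OF Suc.prems(1)])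
    then have "z' \<in> A" and *: "ginv z \<cdot> z' \<in> piece \<Lambda>"
      using A_diff by (auto simp: R_def coset_graph_def piece_def)
    then have w: "ginv z' \<cdot> w \<in> pieces \<Lambda> n" "w \<in> A"
      using Suc.IH z' by auto
    have "ginv z \<cdot> w = ginv z \<cdot> z' \<cdot> (ginv z' \<cdot> w)"
      using A_closed[OF Suc.prems(2)] A_closed[OF \<open>z' \<in> A\<close>] A_closed[OF w(2)]
      by (simp add: GPg.m_assoc)
    then show ?case
      using * w by auto
  qed
  \<comment> \<open>Idle steps are dropped, so the path may be shorter than
    \<open>n\<close>.\<close>
  have upper: "\<exists>m\<le>n. (z, z \<cdot> a) \<in> R ^^ m" if "a \<in> pieces \<Lambda> n" "z \<in> A" for z a n
    using that
  proof (induction n arbitrary: z a)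
    case 0
    then show ?case using A_closed by auto
  next
    case (Suc n)
    then obtain s c where sc: "s \<in> piece \<Lambda>" "c \<in> pieces \<Lambda> n" "a = s \<cdot> c" by auto
    have s: "s \<in> span \<Lambda>" "s \<in> carrier GP" "c \<in> carrier GP"
      using sc assms(1) pieces_closed by (auto simp: piece_def)
    have zs: "z \<cdot> s \<in> A" using A_mult Suc s by blast
    obtain m where m: "m \<le> n" "(z \<cdot> s, z \<cdot> s \<cdot> c) \<in> R ^^ m"
      using Suc.IH[OF sc(2) zs] by blast
    have zsc: "z \<cdot> s \<cdot> c = z \<cdot> a"
      using sc s A_closed[OF Suc.prems(2)] by (simp add: GPg.m_assoc)
    show ?case
    proof (cases "z \<cdot> s = z")
      case True
      then show ?thesis using m zsc by (metis le_Suc_eq)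
    next
      case False
      moreover have "s \<noteq> \<one>\<^bsub>GP\<^esub>"
        using False A_closed[OF Suc.prems(2)] by auto
      ultimately have "(\<exists>\<Omega>\<in>subgraphs. \<Omega> \<subset> \<Lambda> \<and> s \<in> span \<Omega>) \<or> s \<in> gens \<union> m_inv GP ` gens"
        using sc(1) unfolding piece_def by blast
      moreover have "ginv z \<cdot> (z \<cdot> s) = s"
        using A_closed[OF Suc.prems(2)] s by simp
      ultimately have "(z, z \<cdot> s) \<in> R"
        using zs Suc.prems(2) False unfolding R_def coset_graph_def mem_Collect_eq prod.case by metis
      then have "(z, z \<cdot> a) \<in> R ^^ Suc m"
        using m zsc relpow_Suc_I2 by metis
      then show ?thesis
        using m by (meson Suc_le_mono)
    qed
  qed
  have y: "x \<cdot> (ginv x \<cdot> y) = y"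
    using assms A_closed by (simp add: A_def)
  have xA: "x \<in> A" using assms by (simp add: A_def)
  have "(LEAST n. (x, y) \<in> R ^^ n) = (LEAST n. ginv x \<cdot> y \<in> pieces \<Lambda> n)"
  proof (cases "\<exists>n. ginv x \<cdot> y \<in> pieces \<Lambda> n")
    case True
    then have *: "ginv x \<cdot> y \<in> pieces \<Lambda> (LEAST n. ginv x \<cdot> y \<in> pieces \<Lambda> n)"
      by (rule LeastI_ex)
    then obtain m where m: "m \<le> (LEAST n. ginv x \<cdot> y \<in> pieces \<Lambda> n)" "(x, y) \<in> R ^^ m"
      using upper[OF * xA] y by auto
    show ?thesis
    proof (rule antisym)
      show "(LEAST n. (x, y) \<in> R ^^ n) \<le> (LEAST n. ginv x \<cdot> y \<in> pieces \<Lambda> n)"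
        using m Least_le[of "\<lambda>n. (x, y) \<in> R ^^ n" m] by linarith
      have "(x, y) \<in> R ^^ (LEAST n. (x, y) \<in> R ^^ n)"
        using m(2) by (rule LeastI)
      then show "(LEAST n. ginv x \<cdot> y \<in> pieces \<Lambda> n) \<le> (LEAST n. (x, y) \<in> R ^^ n)"
        using lower[OF _ xA] by (intro Least_le) blast
    qed
  next
    \<comment> \<open>Neither predicate holds for any \<open>n\<close>, so both \<open>LEAST\<close>
      take the same default value.\<close>
    case False
    then have "(x, y) \<in> R ^^ n \<longleftrightarrow> ginv x \<cdot> y \<in> pieces \<Lambda> n" for n
      using lower[OF _ xA] by blast
    then show ?thesis by simp
  qed
  then show ?thesis
    by (simp add: graph_dist_def R_def A_def nrm_def)
qed

definition cdist :: "('v \<times> 'a) list set set \<Rightarrow> 'v set \<Rightarrow> ('v \<times> 'a) list set set \<Rightarrow> ('v \<times> 'a) list set set \<Rightarrow> nat" where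
  "cdist k \<Lambda> x y = nrm \<Lambda> (ginv (proj \<Lambda> (ginv k \<cdot> x)) \<cdot> proj \<Lambda> (ginv k \<cdot> y))"

lemma coset_dist_eq:
  assumes "\<Lambda> \<subseteq> V" "k \<in> carrier GP" "x \<in> carrier GP" "y \<in> carrier GP"
  shows "coset_dist (k <#\<^bsub>GP\<^esub> span \<Lambda>, \<Lambda>) x y = cdist k \<Lambda> x y"
proof -
  have "k \<cdot> proj \<Lambda> (ginv k \<cdot> z) \<in> k <#\<^bsub>GP\<^esub> span \<Lambda>" if "z \<in> carrier GP" for z
    using assms that by (auto simp: l_coset_def)
  then have "coset_dist (k <#\<^bsub>GP\<^esub> span \<Lambda>, \<Lambda>) x y
      = nrm \<Lambda> (ginv (k \<cdot> proj \<Lambda> (ginv k \<cdot> x)) \<cdot> (k \<cdot> proj \<Lambda> (ginv k \<cdot> y)))"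
    using assms graph_dist_coset by (simp add: coset_dist_def gate_eq)
  also have "ginv (k \<cdot> proj \<Lambda> (ginv k \<cdot> x)) \<cdot> (k \<cdot> proj \<Lambda> (ginv k \<cdot> y))
      = ginv (proj \<Lambda> (ginv k \<cdot> x)) \<cdot> proj \<Lambda> (ginv k \<cdot> y)"
    using assms by (simp add: GPg.inv_mult_group GPg.m_assoc)
  finally show ?thesis
    by (simp add: cdist_def)
qed

section \<open>Parallelism classes and their distances\<close>

lemma star_subset: "\<Lambda> \<subseteq> V \<Longrightarrow> star \<Lambda> \<subseteq> V"
  using link_subset by (auto simp: star_def)

lemma parallelI:
  assumes "g \<in> carrier GP" "h \<in> carrier GP" "\<Lambda> \<in> subgraphs" "ginv g \<cdot> h \<in> span (star \<Lambda>)"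
  shows "((g <#\<^bsub>GP\<^esub> span \<Lambda>, \<Lambda>), (h <#\<^bsub>GP\<^esub> span \<Lambda>, \<Lambda>)) \<in> parallel"
  using assms unfolding parallel_def by blast

lemma equiv_parallel: "equiv labelled_cosets parallel"
proof (rule equivI)
  show "parallel \<subseteq> labelled_cosets \<times> labelled_cosets"
    by (auto simp: parallel_def labelled_cosets_def)
  show "refl_on labelled_cosets parallel"
    by (fastforce simp: refl_on_def labelled_cosets_def parallel_def)
  show "sym parallel"
  proof (rule symI)
    fix p q assume "(p, q) \<in> parallel"
    then obtain g h \<Lambda> where *: "p = (g <#\<^bsub>GP\<^esub> span \<Lambda>, \<Lambda>)" "q = (h <#\<^bsub>GP\<^esub> span \<Lambda>, \<Lambda>)"
        "g \<in> carrier GP" "h \<in> carrier GP" "\<Lambda> \<in> subgraphs" "ginv g \<cdot> h \<in> span (star \<Lambda>)"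
      by (auto simp: parallel_def)
    then have "ginv (ginv g \<cdot> h) \<in> span (star \<Lambda>)"
      by (intro span_inv star_subset subgraphs_subset)
    then have "ginv h \<cdot> g \<in> span (star \<Lambda>)"
      using * by (simp add: GPg.inv_mult_group)
    then show "(q, p) \<in> parallel"
      using * unfolding parallel_def by blast
  qed
  show "trans parallel"
  proof (rule transI)
    fix p q r assume pq: "(p, q) \<in> parallel" and qr: "(q, r) \<in> parallel"
    obtain g h \<Lambda> where gh: "p = (g <#\<^bsub>GP\<^esub> span \<Lambda>, \<Lambda>)" "q = (h <#\<^bsub>GP\<^esub> span \<Lambda>, \<Lambda>)"
        "g \<in> carrier GP" "h \<in> carrier GP" "\<Lambda> \<in> subgraphs" "ginv g \<cdot> h \<in> span (star \<Lambda>)"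
      using pq unfolding parallel_def by blast
    obtain h' f \<Lambda>' where hf: "q = (h' <#\<^bsub>GP\<^esub> span \<Lambda>', \<Lambda>')" "r = (f <#\<^bsub>GP\<^esub> span \<Lambda>', \<Lambda>')"
        "h' \<in> carrier GP" "f \<in> carrier GP" "ginv h' \<cdot> f \<in> span (star \<Lambda>')"
      using qr unfolding parallel_def by blast
    from gh hf have *: "p = (g <#\<^bsub>GP\<^esub> span \<Lambda>, \<Lambda>)" "r = (f <#\<^bsub>GP\<^esub> span \<Lambda>, \<Lambda>)"
        "h <#\<^bsub>GP\<^esub> span \<Lambda> = h' <#\<^bsub>GP\<^esub> span \<Lambda>" "h' \<in> carrier GP" "f \<in> carrier GP"
        "g \<in> carrier GP" "h \<in> carrier GP" "\<Lambda> \<in> subgraphs"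
        "ginv g \<cdot> h \<in> span (star \<Lambda>)" "ginv h' \<cdot> f \<in> span (star \<Lambda>)"
      by auto
    have L: "\<Lambda> \<subseteq> V" using * subgraphs_subset by blast
    \<comment> \<open>The middle coset comes with two representatives \<open>h\<close> and
      \<open>h'\<close>; they differ by an element of \<open>span \<Lambda>\<close>, which lies in
      the star group.\<close>
    have "h' \<in> h <#\<^bsub>GP\<^esub> span \<Lambda>"
      unfolding *(3) using *(4) by (auto simp: l_coset_def intro!: bexI[of _ "\<one>\<^bsub>GP\<^esub>"])
    then obtain l where l: "l \<in> span \<Lambda>" "h' = h \<cdot> l"
      by (auto simp: l_coset_def)
    then have lst: "l \<in> span (star \<Lambda>)"
      using span_mono[of \<Lambda> "star \<Lambda>"] by (auto simp: star_def)
    have "ginv g \<cdot> f = (ginv g \<cdot> h) \<cdot> l \<cdot> (ginv h' \<cdot> f)"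
      using * l L by (simp add: GPg.m_assoc GPg.inv_mult_group)
    then have "ginv g \<cdot> f \<in> span (star \<Lambda>)"
      using * lst by (simp add: span_mult star_subset L)
    then show "(p, r) \<in> parallel"
      using * unfolding parallel_def by blast
  qed
qed

text \<open>\<open>lab\<close> and \<open>rep\<close> describe the element that
  \<open>class_dist\<close> picks, through the same \<open>SOME\<close>, so that every class
  distance is a value of \<open>cdist\<close>.\<close>

definition lab :: "(('v \<times> 'a) list set set set \<times> 'v set) set \<Rightarrow> 'v set" where
  "lab c = snd (SOME p. p \<in> c)"

definition rep :: "(('v \<times> 'a) list set set set \<times> 'v set) set \<Rightarrow> ('v \<times> 'a) list set set" where
  "rep c = (SOME k. k \<in> carrier GP \<and> (SOME p. p \<in> c) = (k <#\<^bsub>GP\<^esub> span (lab c), lab c))"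

lemma index_set_rep:
  assumes "c \<in> index_set"
  shows "lab c \<in> subgraphs" "rep c \<in> carrier GP"
    "c = parallel `` {(rep c <#\<^bsub>GP\<^esub> span (lab c), lab c)}"
    "(rep c <#\<^bsub>GP\<^esub> span (lab c), lab c) = (SOME p. p \<in> c)"
proof -
  obtain q where q: "q \<in> labelled_cosets" "c = parallel `` {q}"
    using assms by (auto simp: index_set_def quotient_def)
  then have "q \<in> c"
    using equiv_class_self[OF equiv_parallel] by blast
  then have p: "(SOME p. p \<in> c) \<in> c" by (rule someI)
  then have "(q, SOME p. p \<in> c) \<in> parallel"
    using q by auto
  then have "parallel `` {q} = parallel `` {SOME p. p \<in> c}"
    using equiv_class_eq[OF equiv_parallel] by blast
  from HOL.trans[OF q(2) this] have c: "c = parallel `` {SOME p. p \<in> c}" .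
  have "(SOME p. p \<in> c) \<in> labelled_cosets"
    using \<open>(q, SOME p. p \<in> c) \<in> parallel\<close> equiv_type[OF equiv_parallel] by blast
  then obtain k \<Lambda> where k: "k \<in> carrier GP" "\<Lambda> \<in> subgraphs"
      "(SOME p. p \<in> c) = (k <#\<^bsub>GP\<^esub> span \<Lambda>, \<Lambda>)"
    unfolding labelled_cosets_def by blast
  moreover from k(3) have "lab c = \<Lambda>"
    unfolding lab_def by (metis snd_conv)
  ultimately have k: "k \<in> carrier GP \<and> (SOME p. p \<in> c) = (k <#\<^bsub>GP\<^esub> span (lab c), lab c)"
      and "lab c \<in> subgraphs"
    by blast+
  then show "lab c \<in> subgraphs" by blast
  have "rep c \<in> carrier GP \<and> (SOME p. p \<in> c) = (rep c <#\<^bsub>GP\<^esub> span (lab c), lab c)"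
    unfolding rep_def using k by (rule someI)
  then show "rep c \<in> carrier GP"
    "c = parallel `` {(rep c <#\<^bsub>GP\<^esub> span (lab c), lab c)}"
    "(rep c <#\<^bsub>GP\<^esub> span (lab c), lab c) = (SOME p. p \<in> c)"
    using c by argo+
qed

lemma class_dist_eq:
  assumes "c \<in> index_set" "x \<in> carrier GP" "y \<in> carrier GP"
  shows "class_dist c x y = cdist (rep c) (lab c) x y"
  using coset_dist_eq[OF subgraphs_subset[OF index_set_rep(1)[OF assms(1)]] index_set_rep(2)[OF assms(1)] assms(2,3)]
  unfolding class_dist_def index_set_rep(4)[OF assms(1), symmetric] by simp

lemma index_set_not_parallel:
  assumes "c \<in> index_set" "c' \<in> index_set" "lab c = lab c'" "c \<noteq> c'"
  shows "ginv (rep c) \<cdot> rep c' \<notin> span (star (lab c))"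
proof
  assume "ginv (rep c) \<cdot> rep c' \<in> span (star (lab c))"
  then have "((rep c <#\<^bsub>GP\<^esub> span (lab c), lab c), (rep c' <#\<^bsub>GP\<^esub> span (lab c), lab c)) \<in> parallel"
    by (intro parallelI index_set_rep(1,2) assms)
  then have "parallel `` {(rep c <#\<^bsub>GP\<^esub> span (lab c), lab c)} = parallel `` {(rep c' <#\<^bsub>GP\<^esub> span (lab c'), lab c')}"
    using equiv_class_eq[OF equiv_parallel] assms(3) by simp
  then have "c = c'"
    using index_set_rep(3)[OF assms(1)] index_set_rep(3)[OF assms(2)] by argo
  then show False using assms by blast
qed

lemma cdist_triangle:
  assumes "\<Lambda> \<in> subgraphs" "k \<in> carrier GP" "x \<in> carrier GP" "y \<in> carrier GP" "z \<in> carrier GP"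
  shows "cdist k \<Lambda> x z \<le> cdist k \<Lambda> x y + cdist k \<Lambda> y z"
proof -
  have L: "\<Lambda> \<subseteq> V" using assms subgraphs_subset by blast
  let ?p = "\<lambda>x. proj \<Lambda> (ginv k \<cdot> x)"
  have "ginv (?p x) \<cdot> ?p z = (ginv (?p x) \<cdot> ?p y) \<cdot> (ginv (?p y) \<cdot> ?p z)"
    using assms L by (simp add: GPg.m_assoc)
  then show ?thesis
    using assms L nrm_mult[OF assms(1), of "ginv (?p x) \<cdot> ?p y" "ginv (?p y) \<cdot> ?p z"]
    by (simp add: cdist_def span_mult span_inv)
qed

text \<open>By \<open>proj_step\<close> the gate stays or is multiplied by the same generator, and
  that is one step of the coset graph.\<close>

lemma cdist_gen_step:
  assumes "\<Lambda> \<in> subgraphs" "k \<in> carrier GP" "x \<in> carrier GP" "s \<in> gens \<union> m_inv GP ` gens"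
  shows "cdist k \<Lambda> x (x \<cdot> s) \<le> 1"
proof -
  have L: "\<Lambda> \<subseteq> V" using assms subgraphs_subset by blast
  obtain v a where va: "v \<in> V" "a \<in> carrier (G v)" "s = ev [(v, a)]"
  proof -
    obtain v b where vb: "v \<in> V" "b \<in> S v" "s = ev [(v, b)] \<or> s = ginv (ev [(v, b)])"
      using assms(4) by (auto simp: gens_def incl_ev)
    then have "b \<in> carrier (G v)" using gens_in_carrier by auto
    then show ?thesis
      using that vb ev_inv group.inv_closed[OF vertex_group] by metis
  qed
  let ?y = "ginv k \<cdot> x"
  have y: "ginv k \<cdot> (x \<cdot> s) = ?y \<cdot> s" "?y \<in> carrier GP" "s \<in> carrier GP"
    using assms va by (auto simp: GPg.m_assoc)
  consider "proj \<Lambda> (?y \<cdot> s) = proj \<Lambda> ?y" | "v \<in> \<Lambda>" "proj \<Lambda> (?y \<cdot> s) = proj \<Lambda> ?y \<cdot> s"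
    using proj_step[OF L y(2) va(1,2)] va by blast
  then show ?thesis
  proof cases
    case 1
    then show ?thesis
      using y L by (simp add: cdist_def)
  next
    case 2
    have "s \<in> span {v}"
      using va by (auto intro: ev_in_span)
    then have "nrm \<Lambda> s \<le> 1"
      using nrm_letter L 2 assms(4) by blast
    then show ?thesis
      using y L 2 by (simp add: cdist_def)
  qed
qed

section \<open>The Behrstock inequality and the lower bound\<close>

text \<open>The longest prefix in \<Lambda> is stripped, then the longest suffix. The second move
  cannot free a letter of \<Lambda> at the front, because what is free at the front of
  \<open>ds\<close> is also free at the front of \<open>ds @ cs\<close>.\<close>

lemma double_coset_cases:
  assumes "\<Lambda> \<subseteq> V" "k \<in> carrier GP"
  obtains a b ds where "a \<in> span \<Lambda>" "b \<in> span \<Lambda>" "red ds" "nofront \<Lambda> ds" "nofront \<Lambda> (rev ds)"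
    "k = a \<cdot> ev ds \<cdot> b"
proof -
  obtain as bs where ab: "red (as @ bs)" "fst ` set as \<subseteq> \<Lambda>" "nofront \<Lambda> bs" "k = ev as \<cdot> ev bs"
    using proj_cases assms by metis
  then have r: "red as" "red bs" by (auto simp: red_append)
  obtain cs ds where cd: "bs \<asymp> ds @ cs" "fst ` set cs \<subseteq> \<Lambda>" "nofront \<Lambda> (rev ds)" "red (ds @ cs)"
    using factor_rear[OF r(2)] by metis
  have w: "ds \<in> words" "cs \<in> words" "as \<in> words" "bs \<in> words"
    using cd(4) ab(1) red_words by fastforce+
  have "nofront \<Lambda> ds"
    using ab(3) shuffle_front[OF cd(1)] by auto
  moreover have "k = ev as \<cdot> ev ds \<cdot> ev cs"
    using ab ev_shuffle[OF cd(1)] w by (simp add: ev_append GPg.m_assoc)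
  moreover have "ev as \<in> span \<Lambda>" "ev cs \<in> span \<Lambda>"
    using ev_in_span assms ab cd w by auto
  moreover have "red ds"
    using cd by (auto simp: red_append)
  ultimately show ?thesis
    using that cd by blast
qed

text \<open>A Behrstock inequality: with \<open>d\<close> minimal in its double coset, the gate of \<open>\<langle>\<Lambda>\<rangle>\<close> or the gate of
  \<open>d\<langle>\<Lambda>\<rangle>\<close> at \<open>y\<close> is close to the (parallel) gates of the two cosets in each other, which are copies
  of \<open>\<langle>\<Omega>\<rangle>\<close>.\<close>

lemma behrstock:
  assumes L: "\<Lambda> \<subseteq> V" and ds: "red ds" "nofront \<Lambda> ds" "nofront \<Lambda> (rev ds)" and y: "y \<in> carrier GP"
  defines "\<Omega> \<equiv> {v \<in> \<Lambda>. adjl v ds}"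
  assumes "proj \<Lambda> y \<notin> span \<Omega>"
  shows "\<exists>\<omega>\<in>span \<Omega>. \<exists>\<Theta>. \<Theta> \<subset> \<Lambda> \<and> (\<exists>\<theta>\<in>span \<Theta>. proj \<Lambda> (ginv (ev ds) \<cdot> y) = \<omega> \<cdot> \<theta>)"
proof -
  have Om: "\<Omega> \<subseteq> V" "\<Omega> \<subseteq> \<Lambda>"
    using L by (auto simp: \<Omega>_def)
  define D where "D = word_inv ds"
  have dsw: "ds \<in> words" using ds red_words by blast
  have D: "red D" "nofront \<Lambda> D" "nofront \<Lambda> (rev D)" "fst ` set D = fst ` set ds" "ev D = ginv (ev ds)"
    "D \<in> words"
    using ds red_word_inv ev_word_inv dsw by (auto simp: D_def)
  obtain as bs where ab: "red (as @ bs)" "fst ` set as \<subseteq> \<Lambda>" "nofront \<Lambda> bs" "y = ev as \<cdot> ev bs"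
    "proj \<Lambda> y = ev as"
    using proj_cases[OF L y] by metis
  have ab_red: "red as" "red bs" and abw: "as \<in> words" "bs \<in> words"
    using ab(1) red_words by (fastforce simp: red_append)+
  obtain ws cs where wc: "as \<asymp> ws @ cs" "fst ` set ws \<subseteq> \<Omega>" "nofront \<Omega> cs" "red (ws @ cs)"
    using factor_front[OF ab_red(1)] by metis
  have wcw: "ws \<in> words" "cs \<in> words" and cs_red: "red cs"
    using wc(4) red_words by (fastforce simp: red_append)+
  define A where "A = fst ` set cs"
  have A: "A \<subseteq> \<Lambda>"
    using ab(2) shuffle_set[OF wc(1)] by (auto simp: A_def)
  \<comment> \<open>Here the gate of \<open>y\<close> is outside \<open>span \<Omega>\<close>. The
    free letters at the front of \<open>cs\<close> do not commute with \<open>ds\<close>, so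
    \<open>cs\<close> is a barrier between \<open>D\<close> and the tail \<open>bs\<close>.\<close>
  have "cs \<noteq> []"
  proof
    assume "cs = []"
    then have "proj \<Lambda> y = ev ws"
      using ab(5) ev_shuffle[OF wc(1) abw(1)] by simp
    then show False
      using assms(7) ev_in_span[OF Om(1) wcw(1) wc(2)] by simp
  qed
  then have A_ne: "A \<noteq> {}" by (simp add: A_def)
  \<comment> \<open>Only letters commuting with all of \<open>cs\<close> pass the barrier. So
    \<open>D\<close> and \<open>bs\<close> interact only through the end \<open>F1\<close> of
    \<open>D\<close> and the start \<open>F2\<close> of \<open>bs\<close>, and \<open>F\<close>
    collects the result.\<close>
  define B where "B = {v \<in> V. \<forall>w\<in>A. adj v w}"
  have BV: "B \<subseteq> V" by (auto simp: B_def)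
  have AV: "A \<subseteq> V" using A L by auto
  obtain D1 F1 where DF: "D \<asymp> D1 @ F1" "fst ` set F1 \<subseteq> B" "nofront B (rev D1)" "red (D1 @ F1)"
    using factor_rear[OF D(1)] by metis
  obtain F2 B2 where FB: "bs \<asymp> F2 @ B2" "fst ` set F2 \<subseteq> B" "nofront B B2" "red (F2 @ B2)"
    using factor_front[OF ab_red(2)] by metis
  have w: "D1 \<in> words" "F1 \<in> words" "F2 \<in> words" "B2 \<in> words" and r: "red D1" "red B2"
    using red_words[OF DF(4)] red_words[OF FB(4)] DF(4) FB(4) by (auto simp: red_append)
  have "ev F1 \<cdot> ev F2 \<in> span B"
    using ev_in_span[OF BV w(2) DF(2)] ev_in_span[OF BV w(3) FB(2)] span_mult[OF BV] by blast
  then obtain F where F: "red F" "ev F = ev F1 \<cdot> ev F2" "fst ` set F \<subseteq> B"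
    using span_red_cases[OF BV] by metis
  have Fw: "F \<in> words" using F red_words by blast
  have AB: "adj v w" "adj w v" if "v \<in> A" "w \<in> B" for v w
    using that adj_commute by (auto simp: B_def)
  have notAB: "v \<notin> B" if "v \<in> A" for v
    using that AB(1)[of v v] by auto
  have inB: "v \<in> B" if "v \<in> V" "adjl v cs" for v
    using that by (auto simp: A_def B_def)
  have supD: "adjl v ds \<longleftrightarrow> adjl v D1 \<and> adjl v F1" for v
    using D(4) shuffle_set[OF DF(1)] by (metis (no_types, lifting) Un_iff image_Un set_append)
  have red_FB: "red (F @ B2)"
    using F(1) r(2) F(3) FB(3) rear_in_set by (fastforce simp: red_append)
  have no_cs: "\<not> (rear v cs \<and> front v (F @ B2))" for v
  proof
    assume v: "rear v cs \<and> front v (F @ B2)"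
    then have "v \<in> A" using rear_in_set by (auto simp: A_def)
    then have "\<not> front v F"
      using notAB F(3) front_in_set by blast
    then have "front v B2" using v by auto
    then have "front v (F2 @ B2)"
      using AB[OF \<open>v \<in> A\<close>] FB(2) by auto
    then have "front v bs" using shuffle_front[OF FB(1)] by blast
    then show False using ab(3) A \<open>v \<in> A\<close> by blast
  qed
  have words_FB: "fst ` set (F @ B2) \<subseteq> V"
    using words_vertices[of "F @ B2"] Fw w by simp
  \<comment> \<open>A letter at the end of \<open>D1\<close> that meets one of \<open>cs\<close>
    would have its vertex in \<open>A\<close>, pass \<open>F1\<close> and be free at the end of
    \<open>D\<close>, although it belongs to \<Lambda>. One that meets a letter beyond
    \<open>cs\<close> would lie in \<open>B\<close>, against the maximality of
    \<open>F1\<close>.\<close>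
  have no_D1: "\<not> (rear v D1 \<and> front v (cs @ F @ B2))" for v
  proof
    assume v: "rear v D1 \<and> front v (cs @ F @ B2)"
    then consider "front v cs" | "adjl v cs" "front v (F @ B2)" by auto
    then show False
    proof cases
      case 1
      then have "v \<in> A" using front_in_set by (auto simp: A_def)
      then have "rear v (D1 @ F1)"
        using v AB[OF \<open>v \<in> A\<close>] DF(2) by auto
      then have "rear v D" using shuffle_rear[OF DF(1)] by blast
      then show False using D(3) A \<open>v \<in> A\<close> by blast
    next
      case 2
      then have "v \<in> B"
        using front_in_set[OF 2(2)] words_FB by (intro inB) blast+
      then show False using v DF(3) by blast
    qed
  qed
  have "red (cs @ F @ B2)"
    using cs_red red_FB no_cs unfolding red_append[of cs] by blast
  then have red_all: "red (D1 @ cs @ F @ B2)"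
    using r(1) no_D1 unfolding red_append[of D1] by blast
  \<comment> \<open>The vertices of \<Lambda> whose letters can still come to the front past
    \<open>D1\<close> and \<open>cs\<close>. They lie in \<open>B\<close>, which misses the nonempty
    subset \<open>A\<close> of \<Lambda>; hence \<Theta> is proper.\<close>
  define \<Theta> where "\<Theta> = {v \<in> \<Lambda>. v \<in> B \<and> adjl v D1}"
  have Th: "\<Theta> \<subset> \<Lambda>" "\<Theta> \<subseteq> V"
    using A A_ne notAB L by (auto simp: \<Theta>_def)
  obtain X1 Y1 where XY: "F @ B2 \<asymp> X1 @ Y1" "fst ` set X1 \<subseteq> \<Theta>" "nofront \<Theta> Y1" "red (X1 @ Y1)"
    using factor_front[OF red_FB] by metis
  have XYw: "X1 \<in> words" "Y1 \<in> words" using red_words[OF XY(4)] by auto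
  have "D1 @ cs @ F @ B2 \<asymp> (D1 @ cs) @ X1 @ Y1"
    using XY(1) shuffle_append_left[of _ _ "D1 @ cs"] by fastforce
  also have "\<dots> \<asymp> X1 @ (D1 @ cs) @ Y1"
  proof -
    have "\<forall>v\<in>fst ` set X1. adjl v (D1 @ cs)"
    proof
      fix v assume "v \<in> fst ` set X1"
      then have v: "v \<in> B" "adjl v D1" using XY(2) by (auto simp: \<Theta>_def)
      then have "adjl v cs" by (auto simp: B_def A_def)
      with v show "adjl v (D1 @ cs)" by auto
    qed
    then have "X1 @ (D1 @ cs) \<asymp> (D1 @ cs) @ X1"
      by (rule shuffle_commute)
    from shuffle_append_right[OF shuffle_sym[OF this], of Y1] show ?thesis by simp
  qed
  finally have sh: "D1 @ cs @ F @ B2 \<asymp> X1 @ D1 @ cs @ Y1" by simp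
  then have red_X: "red (X1 @ D1 @ cs @ Y1)"
    using red_all shuffle_red by blast
  have "nofront \<Lambda> (D1 @ cs @ Y1)"
  proof (rule ballI, rule notI)
    fix v assume v: "v \<in> \<Lambda>" "front v (D1 @ cs @ Y1)"
    then consider "front v D1" | "adjl v D1" "front v cs" | "adjl v D1" "adjl v cs" "front v Y1" by auto
    then show False
    proof cases
      case 1
      then have "front v D" using shuffle_front[OF DF(1)] by auto
      then show ?thesis using D(2) v by blast
    next
      \<comment> \<open>Such a letter of \<open>cs\<close> passes \<open>D1\<close>, and passes
        \<open>F1\<close> by the choice of \<open>B\<close>, so it commutes with all of
        \<open>ds\<close>. Its vertex is then in \<Omega>, against the choice of
        \<open>cs\<close>.\<close>
      case 2
      then have "v \<in> A" using front_in_set by (auto simp: A_def)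
      then have "adjl v F1" using AB DF(2) by blast
      then have "v \<in> \<Omega>" using supD 2 v by (auto simp: \<Omega>_def)
      then show ?thesis using wc(3) 2 by blast
    next
      case 3
      then have "v \<in> \<Theta>" using inB v L by (auto simp: \<Theta>_def)
      then show ?thesis using XY(3) 3 by blast
    qed
  qed
  then have pz: "proj \<Lambda> (ev (X1 @ D1 @ cs @ Y1)) = ev X1"
    using proj_ev[OF L red_X] XY(2) Th by blast
  have c1: "ev D \<cdot> ev ws = ev ws \<cdot> ev D"
    using Om(1) words_vertices[OF dsw] D(4,6) wc(2) wcw
    by (intro span_commute[of "fst ` set ds" \<Omega>] ev_in_span) (auto simp: \<Omega>_def adj_commute)
  have c2: "ev F1 \<cdot> ev cs = ev cs \<cdot> ev F1"
    using AB by (intro span_commute[OF BV AV] ev_in_span BV AV w DF(2) wcw) (auto simp: A_def)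
  have cl: "ev D \<in> carrier GP" "ev ws \<in> carrier GP" "ev cs \<in> carrier GP" "ev D1 \<in> carrier GP"
    "ev F1 \<in> carrier GP" "ev F2 \<in> carrier GP" "ev B2 \<in> carrier GP" "ev bs \<in> carrier GP"
    using D(6) wcw w abw by simp_all
  have "ginv (ev ds) \<cdot> y = ev D \<cdot> (ev ws \<cdot> ev cs) \<cdot> ev bs"
    using ab(4) ev_shuffle[OF wc(1) abw(1)] D(5) cl wcw dsw by (simp add: ev_append GPg.m_assoc)
  also have "\<dots> = (ev D \<cdot> ev ws) \<cdot> ev cs \<cdot> ev bs"
    using cl by (simp add: GPg.m_assoc)
  also have "\<dots> = ev ws \<cdot> (ev D \<cdot> ev cs \<cdot> ev bs)"
    unfolding c1 using cl by (simp add: GPg.m_assoc)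
  also have "ev D \<cdot> ev cs \<cdot> ev bs = ev D1 \<cdot> (ev F1 \<cdot> ev cs) \<cdot> ev F2 \<cdot> ev B2"
    using ev_shuffle[OF DF(1) D(6)] ev_shuffle[OF FB(1) abw(2)] w cl by (simp add: ev_append GPg.m_assoc)
  also have "\<dots> = ev D1 \<cdot> ev cs \<cdot> ev F \<cdot> ev B2"
    unfolding c2 F(2) using cl by (simp add: GPg.m_assoc)
  also have "\<dots> = ev (D1 @ cs @ F @ B2)"
    using w wcw Fw by (simp add: ev_append GPg.m_assoc)
  also have "\<dots> = ev (X1 @ D1 @ cs @ Y1)"
    using ev_shuffle[OF sh] w wcw Fw by simp
  finally have "proj \<Lambda> (ginv (ev ds) \<cdot> y) = ev ws \<cdot> ev X1"
    using proj_span_mult[OF L, of "ev ws" "ev (X1 @ D1 @ cs @ Y1)"] pz ev_in_span[OF L wcw(1)] wc(2) Om(2)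
      w wcw XYw by auto
  moreover have "ev ws \<in> span \<Omega>" "ev X1 \<in> span \<Theta>"
    using ev_in_span Om Th wcw XYw wc(2) XY(2) by auto
  ultimately show ?thesis
    using Th by blast
qed

lemma cdist_coset:
  assumes "\<Lambda> \<subseteq> V" "k \<in> carrier GP" "a \<in> span \<Lambda>" "x \<in> carrier GP" "y \<in> carrier GP"
  shows "cdist (k \<cdot> a) \<Lambda> x y = cdist k \<Lambda> x y"
proof -
  have a: "a \<in> carrier GP" "ginv a \<in> span \<Lambda>" using assms span_inv by auto
  have "proj \<Lambda> (ginv (k \<cdot> a) \<cdot> z) = ginv a \<cdot> proj \<Lambda> (ginv k \<cdot> z)" if "z \<in> carrier GP" for z
    using that assms a proj_span_mult[OF assms(1) a(2), of "ginv k \<cdot> z"]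
    by (simp add: GPg.inv_mult_group GPg.m_assoc)
  then show ?thesis
    using assms a by (simp add: cdist_def GPg.inv_mult_group GPg.m_assoc)
qed

text \<open>\<open>P x\<close> says that the gate of \<open>x\<close> in the coset of
  \<open>k\<close> lies in the copy of \<open>span \<Omega>\<close>, which has diameter at most 1.
  Otherwise \<open>behrstock\<close> writes the gate in the other coset as a product of two elements
  of proper subgraph groups, so of norm at most 2; two such gates are at distance at most 4.\<close>

lemma transverse:
  assumes "\<Lambda> \<in> subgraphs" "k \<in> carrier GP" "k' \<in> carrier GP" "ginv k \<cdot> k' \<notin> span (star \<Lambda>)"
  obtains P where "\<And>x y. x \<in> carrier GP \<Longrightarrow> y \<in> carrier GP \<Longrightarrow> P x \<Longrightarrow> P y \<Longrightarrow> cdist k \<Lambda> x y \<le> 4"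
    "\<And>x y. x \<in> carrier GP \<Longrightarrow> y \<in> carrier GP \<Longrightarrow> \<not> P x \<Longrightarrow> \<not> P y \<Longrightarrow> cdist k' \<Lambda> x y \<le> 4"
proof -
  have L: "\<Lambda> \<subseteq> V" using assms subgraphs_subset by blast
  obtain a b ds where d: "a \<in> span \<Lambda>" "b \<in> span \<Lambda>" "red ds" "nofront \<Lambda> ds" "nofront \<Lambda> (rev ds)"
    "ginv k \<cdot> k' = a \<cdot> ev ds \<cdot> b"
    using double_coset_cases[OF L, of "ginv k \<cdot> k'"] assms by (metis GPg.inv_closed GPg.m_closed)
  have dw: "ds \<in> words" using d red_words by blast
  have cl: "a \<in> carrier GP" "b \<in> carrier GP" "ev ds \<in> carrier GP"
    using d L dw by auto
  define q where "q = k \<cdot> a"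
  define \<Omega> where "\<Omega> = {v \<in> \<Lambda>. adjl v ds}"
  have q: "q \<in> carrier GP" using assms cl by (simp add: q_def)
  have "k' = k \<cdot> (ginv k \<cdot> k')" using assms by simp
  also have "\<dots> = q \<cdot> ev ds \<cdot> b"
    unfolding d(6) q_def using assms cl by (simp add: GPg.m_assoc)
  finally have k': "k' = q \<cdot> ev ds \<cdot> b" .
  \<comment> \<open>If every vertex of \<Lambda> commuted with \<open>ds\<close>, then
    \<open>ds\<close> would lie in the link and the two cosets would be parallel.\<close>
  have Om: "\<Omega> \<subset> \<Lambda>"
  proof (rule ccontr)
    assume "\<not> \<Omega> \<subset> \<Lambda>"
    then have "\<forall>v\<in>\<Lambda>. adjl v ds" by (auto simp: \<Omega>_def)
    then have "fst ` set ds \<subseteq> link \<Lambda>"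
      using words_vertices[OF dw] link_eq[OF L] adj_commute by blast
    then have "fst ` set ds \<subseteq> star \<Lambda>" by (auto simp: star_def)
    then have "ev ds \<in> span (star \<Lambda>)"
      using ev_in_span star_subset L dw by blast
    moreover have "a \<in> span (star \<Lambda>)" "b \<in> span (star \<Lambda>)"
      using d(1,2) span_mono[of \<Lambda> "star \<Lambda>"] by (auto simp: star_def)
    ultimately show False
      using assms(4) unfolding d(6) by (simp add: span_mult star_subset L)
  qed
  let ?P = "\<lambda>x. proj \<Lambda> (ginv q \<cdot> x) \<in> span \<Omega>"
  show ?thesis
  proof (rule that[of ?P])
    fix x y assume xy: "x \<in> carrier GP" "y \<in> carrier GP" "?P x" "?P y"
    have "\<Omega> \<subseteq> V" using Om L by auto
    then have "ginv (proj \<Lambda> (ginv q \<cdot> x)) \<cdot> proj \<Lambda> (ginv q \<cdot> y) \<in> span \<Omega>"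
      using xy by (intro span_mult span_inv)
    then have "cdist q \<Lambda> x y \<le> 1"
      unfolding cdist_def using nrm_proper L Om by blast
    then show "cdist k \<Lambda> x y \<le> 4"
      using cdist_coset[OF L assms(2) d(1) xy(1,2)] by (simp add: q_def)
  next
    have *: "nrm \<Lambda> (proj \<Lambda> (ginv (q \<cdot> ev ds) \<cdot> x)) \<le> 2" if x: "x \<in> carrier GP" "\<not> ?P x" for x
    proof -
      have "ginv q \<cdot> x \<in> carrier GP" using x q by simp
      then obtain \<omega> \<Theta> \<theta> where *: "\<omega> \<in> span \<Omega>" "\<Theta> \<subset> \<Lambda>" "\<theta> \<in> span \<Theta>"
          "proj \<Lambda> (ginv (ev ds) \<cdot> (ginv q \<cdot> x)) = \<omega> \<cdot> \<theta>"
        using behrstock[OF L d(3-5)] x(2) unfolding \<Omega>_def by blast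
      have "\<omega> \<in> span \<Lambda>" "\<theta> \<in> span \<Lambda>"
        using * Om span_mono by blast+
      then have "nrm \<Lambda> (\<omega> \<cdot> \<theta>) \<le> nrm \<Lambda> \<omega> + nrm \<Lambda> \<theta>"
        using nrm_mult assms(1) by blast
      also have "\<dots> \<le> 1 + 1"
        using * Om by (intro add_mono nrm_proper[OF L])
      finally have "nrm \<Lambda> (\<omega> \<cdot> \<theta>) \<le> 2" by simp
      then show ?thesis
        using *(4) q cl x by (simp add: GPg.inv_mult_group GPg.m_assoc)
    qed
    fix x y assume xy: "x \<in> carrier GP" "y \<in> carrier GP" "\<not> ?P x" "\<not> ?P y"
    let ?p = "\<lambda>x. proj \<Lambda> (ginv (q \<cdot> ev ds) \<cdot> x)"
    have p: "?p x \<in> span \<Lambda>" "?p y \<in> span \<Lambda>"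
      using xy q cl L by simp_all
    have "cdist (q \<cdot> ev ds) \<Lambda> x y \<le> nrm \<Lambda> (ginv (?p x)) + nrm \<Lambda> (?p y)"
      unfolding cdist_def using nrm_mult assms(1) p span_inv L by blast
    also have "\<dots> \<le> 4"
      using *[OF xy(1,3)] *[OF xy(2,4)] nrm_inv_le[OF assms(1) p(1)] by linarith
    finally show "cdist k' \<Lambda> x y \<le> 4"
      unfolding k' using cdist_coset[OF L, of "q \<cdot> ev ds" b x y] d(2) q cl xy by simp
  qed
qed

lemma discrete_ivt:
  fixes f :: "nat \<Rightarrow> nat"
  assumes "f 0 = 0" "\<And>t. t < n \<Longrightarrow> f (Suc t) \<le> Suc (f t)" "j \<le> f n"
  shows "\<exists>t\<le>n. f t = j"
  using assms
proof (induction n)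
  case (Suc n)
  show ?case
  proof (cases "j \<le> f n")
    case True
    then show ?thesis using Suc by (metis le_Suc_eq less_Suc_eq)
  next
    case False
    then have "j = f (Suc n)" using Suc.prems(2)[of n] Suc.prems(3) by simp
    then show ?thesis by blast
  qed
qed auto

lemma sum_same_label:
  fixes p :: "nat \<Rightarrow> ('v \<times> 'a) list set set"
  assumes p: "\<And>t. t \<le> n \<Longrightarrow> p t \<in> carrier GP"
    and step: "\<And>t. t < n \<Longrightarrow> \<exists>s\<in>gens \<union> m_inv GP ` gens. p (Suc t) = p t \<cdot> s"
    and F: "finite F" "F \<subseteq> index_set" "\<And>c. c \<in> F \<Longrightarrow> lab c = \<Lambda>"
  shows "(\<Sum>c\<in>F. class_dist c (p 0) (p n) - 9) \<le> n + 1"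
proof -
  \<comment> \<open>The bound 5 exceeds the 4 of \<open>transverse\<close>. The distance between the
    end points is required too, because the two points on a common side may be these.\<close>
  define act_times where "act_times c = {t \<in> {..n}. 5 \<le> class_dist c (p 0) (p n) \<and> 5 \<le> class_dist c (p 0) (p t) \<and> 5 \<le> class_dist c (p t) (p n)}" for c
  have cd: "class_dist c x y = cdist (rep c) \<Lambda> x y" if "c \<in> F" "x \<in> carrier GP" "y \<in> carrier GP" for c x y
    using that(1) F(2) F(3)[OF that(1)] class_dist_eq[OF _ that(2,3), of c] by auto
  have rep: "\<Lambda> \<in> subgraphs" "rep c \<in> carrier GP" if "c \<in> F" for c
    using that F(2) F(3)[OF that] index_set_rep[of c] by auto
  have card: "class_dist c (p 0) (p n) - 9 \<le> card (act_times c)" if c: "c \<in> F" for c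
  proof -
    let ?D = "\<lambda>t. class_dist c (p 0) (p t)"
    have tri: "class_dist c (p t) (p v) \<le> class_dist c (p t) (p u) + class_dist c (p u) (p v)"
      if "t \<le> n" "u \<le> n" "v \<le> n" for t u v
      using that cd[OF c] cdist_triangle[OF rep[OF c]] p by simp
    have D0: "?D 0 = 0"
      using cd[OF c] p[of 0] rep[OF c] subgraphs_subset by (simp add: cdist_def)
    have D_step: "?D (Suc t) \<le> Suc (?D t)" if t: "t < n" for t
    proof -
      have "class_dist c (p t) (p (Suc t)) \<le> 1"
        using step[OF t] cdist_gen_step[OF rep[OF c]] cd[OF c] p t
        by (metis Suc_leI less_imp_le_nat)
      then show ?thesis
        using tri[of 0 t "Suc t"] t by simp
    qed
    \<comment> \<open>Each of these \<open>?D n - 9\<close> values is taken at some time, and the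
      triangle inequality keeps the path point at that time at distance at least 5 from the far
      end.\<close>
    have "{5..?D n - 5} \<subseteq> ?D ` act_times c"
    proof
      fix j assume j: "j \<in> {5..?D n - 5}"
      then have "j \<le> ?D n" by auto
      then obtain t where t: "t \<le> n" "?D t = j"
        using discrete_ivt[of ?D n j] D0 D_step by auto
      have "?D n \<le> ?D t + class_dist c (p t) (p n)"
        using tri[of 0 t n] t by simp
      then have "t \<in> act_times c"
        using t j by (auto simp: act_times_def)
      then show "j \<in> ?D ` act_times c"
        using t by blast
    qed
    moreover have "finite (act_times c)"
      by (simp add: act_times_def)
    ultimately have "card {5..?D n - 5} \<le> card (act_times c)"
      by (meson card_image_le card_mono finite_imageI order_trans)
    then show ?thesis by simp
  qed
  have disj: "act_times c \<inter> act_times c' = {}" if c: "c \<in> F" "c' \<in> F" "c \<noteq> c'" for c c'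
  proof (rule ccontr)
    assume "act_times c \<inter> act_times c' \<noteq> {}"
    then obtain t where t: "t \<le> n" "5 \<le> class_dist c (p 0) (p t)" "5 \<le> class_dist c (p t) (p n)"
      "5 \<le> class_dist c' (p 0) (p t)" "5 \<le> class_dist c' (p t) (p n)"
      "5 \<le> class_dist c (p 0) (p n)" "5 \<le> class_dist c' (p 0) (p n)"
      by (auto simp: act_times_def)
    have "ginv (rep c) \<cdot> rep c' \<notin> span (star \<Lambda>)"
      using index_set_not_parallel[of c c'] c F by auto
    then obtain P where P:
      "\<And>x y. x \<in> carrier GP \<Longrightarrow> y \<in> carrier GP \<Longrightarrow> P x \<Longrightarrow> P y \<Longrightarrow> cdist (rep c) \<Lambda> x y \<le> 4"
      "\<And>x y. x \<in> carrier GP \<Longrightarrow> y \<in> carrier GP \<Longrightarrow> \<not> P x \<Longrightarrow> \<not> P y \<Longrightarrow> cdist (rep c') \<Lambda> x y \<le> 4"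
      using transverse[OF rep(1)[OF c(1)] rep(2)[OF c(1)] rep(2)[OF c(2)]] by metis
    have "p 0 \<in> carrier GP" "p t \<in> carrier GP" "p n \<in> carrier GP"
      using p t by simp_all
    \<comment> \<open>However the three points are distributed over the sides \<open>P\<close> and
      not \<open>P\<close>, two of them share a side.\<close>
    then show False
      using P(1)[of "p 0" "p t"] P(1)[of "p t" "p n"] P(1)[of "p 0" "p n"]
        P(2)[of "p 0" "p t"] P(2)[of "p t" "p n"] P(2)[of "p 0" "p n"] t cd[OF c(1)] cd[OF c(2)]
      by (cases "P (p 0)"; cases "P (p t)"; cases "P (p n)") simp_all
  qed
  have "(\<Sum>c\<in>F. class_dist c (p 0) (p n) - 9) \<le> (\<Sum>c\<in>F. card (act_times c))"
    by (intro sum_mono card)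
  also have "\<dots> = card (\<Union>c\<in>F. act_times c)"
    using F(1) disj by (intro card_UN_disjoint[symmetric]) (auto simp: act_times_def)
  also have "\<dots> \<le> card {..n}"
    by (intro card_mono) (auto simp: act_times_def)
  finally show ?thesis by simp
qed

section \<open>Word length and paths in the Cayley graph\<close>

abbreviation gens_sym :: "('v \<times> 'a) list set set set" where
  "gens_sym \<equiv> gens \<union> m_inv GP ` gens"

definition prd :: "('v \<times> 'a) list set set list \<Rightarrow> ('v \<times> 'a) list set set" where
  "prd ws = foldr (mult GP) ws \<one>\<^bsub>GP\<^esub>"

definition wlen :: "('v \<times> 'a) list set set \<Rightarrow> nat" where
  "wlen x = word_length GP gens x"

lemma gens_sym_closed: "gens_sym \<subseteq> carrier GP"
  using gens_closed by auto

lemma prd_simps [simp]: "prd [] = \<one>\<^bsub>GP\<^esub>" "prd (w # ws) = w \<cdot> prd ws"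
  by (simp_all add: prd_def)

lemma prd_closed: "set ws \<subseteq> gens_sym \<Longrightarrow> prd ws \<in> carrier GP"
  by (induction ws) (use gens_sym_closed in auto)

lemma prd_append: "set us \<subseteq> gens_sym \<Longrightarrow> set ws \<subseteq> gens_sym \<Longrightarrow> prd (us @ ws) = prd us \<cdot> prd ws"
proof (induction us)
  case (Cons u us)
  then have "u \<in> carrier GP" "prd us \<in> carrier GP" "prd ws \<in> carrier GP"
    using gens_sym_closed prd_closed by auto
  then show ?case using Cons by (simp add: GPg.m_assoc)
qed (simp add: prd_closed)

text \<open>A single vertex has no proper nonempty subgraph, so its nontrivial pieces are generators
  or their inverses.\<close>

lemma pieces_vertex_word:
  assumes "a \<in> pieces {v} n"
  shows "\<exists>ws. length ws \<le> n \<and> set ws \<subseteq> gens_sym \<and> prd ws = a"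
  using assms
proof (induction n arbitrary: a)
  case (Suc n)
  then obtain s c where sc: "s \<in> piece {v}" "c \<in> pieces {v} n" "a = s \<cdot> c" by auto
  then obtain ws where ws: "length ws \<le> n" "set ws \<subseteq> gens_sym" "prd ws = c"
    using Suc.IH by blast
  have "\<not> (\<exists>\<Omega>\<in>subgraphs. \<Omega> \<subset> {v} \<and> s \<in> span \<Omega>)"
    by (auto simp: subgraphs_def)
  then consider "s = \<one>\<^bsub>GP\<^esub>" | "s \<in> gens_sym"
    using sc(1) unfolding piece_def by blast
  then show ?case
  proof cases
    case 1
    then have "prd ws = a"
      using sc ws prd_closed[OF ws(2)] by simp
    then show ?thesis using ws le_SucI by blast
  next
    case 2
    then show ?thesis
      using ws sc by (intro exI[of _ "s # ws"]) auto
  qed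
qed (auto intro: exI[of _ "[]"])

lemma word_exists:
  assumes "x \<in> carrier GP"
  shows "\<exists>ws. set ws \<subseteq> gens_sym \<and> prd ws = x"
proof -
  obtain u where "u \<in> words" "x = ev u"
    using assms by (auto simp: carrier_GP)
  then show ?thesis
  proof (induction u arbitrary: x)
    case Nil
    then show ?case by (intro exI[of _ "[]"]) auto
  next
    case (Cons y u)
    then obtain ws where ws: "set ws \<subseteq> gens_sym" "prd ws = ev u" by auto
    have "{fst y} \<in> subgraphs" "ev [y] \<in> span {fst y}"
      using Cons.prems by (auto simp: subgraphs_def intro!: ev_in_span)
    then obtain n where "ev [y] \<in> pieces {fst y} n"
      using pieces_exists by blast
    then obtain us where "set us \<subseteq> gens_sym" "prd us = ev [y]"
      using pieces_vertex_word by blast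
    then show ?case
      using ws prd_append[of us ws] ev_Cons[of y u] Cons.prems
      by (intro exI[of _ "us @ ws"]) auto
  qed
qed

lemma wlen_le: "set ws \<subseteq> gens_sym \<Longrightarrow> wlen (prd ws) \<le> length ws"
  unfolding wlen_def word_length_def prd_def by (intro Least_le) blast

lemma wlen_word:
  assumes "x \<in> carrier GP"
  obtains ws where "length ws = wlen x" "set ws \<subseteq> gens_sym" "prd ws = x"
proof -
  have "\<exists>n ws. length ws = n \<and> set ws \<subseteq> gens_sym \<and> foldr (mult GP) ws \<one>\<^bsub>GP\<^esub> = x"
    using word_exists[OF assms] by (simp add: prd_def)
  from LeastI_ex[OF this] show ?thesis
    using that unfolding wlen_def word_length_def prd_def by blast
qed

lemma wlen_mult:
  assumes "x \<in> carrier GP" "y \<in> carrier GP"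
  shows "wlen (x \<cdot> y) \<le> wlen x + wlen y"
proof -
  obtain us ws where "length us = wlen x" "set us \<subseteq> gens_sym" "prd us = x"
      "length ws = wlen y" "set ws \<subseteq> gens_sym" "prd ws = y"
    using wlen_word assms by metis
  then show ?thesis
    using wlen_le[of "us @ ws"] prd_append[of us ws] by simp
qed

lemma wlen_vertex:
  assumes "v \<in> V" "x \<in> span {v}"
  shows "wlen x \<le> nrm {v} x"
proof -
  have "x \<in> pieces {v} (nrm {v} x)"
    using assms by (intro nrm_pieces) (auto simp: subgraphs_def)
  then obtain ws where "length ws \<le> nrm {v} x" "set ws \<subseteq> gens_sym" "prd ws = x"
    using pieces_vertex_word by blast
  then show ?thesis
    using wlen_le[of ws] by simp
qed

lemma word_dist_eq: "word_dist g h = wlen (ginv g \<cdot> h)"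
  by (simp add: word_dist_def wlen_def)

lemma word_path:
  assumes "g \<in> carrier GP" "h \<in> carrier GP"
  obtains p where "p 0 = g" "p (word_dist g h) = h" "\<forall>t. p t \<in> carrier GP"
    "\<forall>t<word_dist g h. \<exists>s\<in>gens_sym. p (Suc t) = p t \<cdot> s"
proof -
  obtain ws where ws: "length ws = word_dist g h" "set ws \<subseteq> gens_sym" "prd ws = ginv g \<cdot> h"
    using wlen_word[of "ginv g \<cdot> h"] assms unfolding word_dist_eq by auto
  have tk: "set (take t ws) \<subseteq> gens_sym" for t
    using ws(2) set_take_subset by fastforce
  show ?thesis
  proof (rule that[of "\<lambda>t. g \<cdot> prd (take t ws)"]; (intro allI impI)?)
    fix t assume t: "t < word_dist g h"
    then have s: "ws ! t \<in> gens_sym"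
      using ws nth_mem by (metis subsetD)
    then have "prd (take (Suc t) ws) = prd (take t ws) \<cdot> ws ! t"
      using t ws(1) tk[of t] prd_append[of "take t ws" "[ws ! t]"] gens_sym_closed
      by (auto simp: take_Suc_conv_app_nth)
    then show "\<exists>s\<in>gens_sym. g \<cdot> prd (take (Suc t) ws) = g \<cdot> prd (take t ws) \<cdot> s"
      using s assms prd_closed[OF tk[of t]] gens_sym_closed by (intro bexI[of _ "ws ! t"]) (auto simp: GPg.m_assoc)
  qed (use assms ws tk prd_closed in auto)
qed

section \<open>The sum of distances as a finite sum, and its bound\<close>

definition big :: "real \<Rightarrow> ('v \<times> 'a) list set set \<Rightarrow> ('v \<times> 'a) list set set \<Rightarrow> _ set" where
  "big \<sigma> g h = {c \<in> index_set. \<sigma> \<le> real (class_dist c g h)}"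

lemma sum_class_dist_le:
  assumes "g \<in> carrier GP" "h \<in> carrier GP" "finite F" "F \<subseteq> big 20 g h"
  shows "(\<Sum>c\<in>F. class_dist c g h) \<le> 2 ^ card V * (2 * (word_dist g h + 1))"
proof -
  obtain p where p: "p 0 = g" "p (word_dist g h) = h" "\<forall>t. p t \<in> carrier GP"
    "\<forall>t<word_dist g h. \<exists>s\<in>gens_sym. p (Suc t) = p t \<cdot> s"
    using word_path[OF assms(1,2)] by metis
  have "lab ` F \<subseteq> Pow V"
    using assms(4) index_set_rep(1) subgraphs_subset by (fastforce simp: big_def)
  \<comment> \<open>The labels are counted by \<open>Pow V\<close>, which includes the empty label;
    its block of classes is empty.\<close>
  then have "(\<Sum>c\<in>F. class_dist c g h) = (\<Sum>\<Lambda>\<in>Pow V. \<Sum>c | c \<in> F \<and> lab c = \<Lambda>. class_dist c g h)"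
    using assms(3) finite_V by (simp add: sum.group)
  also have "\<dots> \<le> (\<Sum>\<Lambda>\<in>Pow V. 2 * (word_dist g h + 1))"
  proof (rule sum_mono)
    fix \<Lambda> assume "\<Lambda> \<in> Pow V"
    let ?F = "{c. c \<in> F \<and> lab c = \<Lambda>}"
    \<comment> \<open>Distances of at least 20 are at most twice their excess over 9, which makes up
      for the loss in \<open>sum_same_label\<close>.\<close>
    have "(\<Sum>c\<in>?F. class_dist c g h) \<le> (\<Sum>c\<in>?F. 2 * (class_dist c g h - 9))"
      using assms(4) by (intro sum_mono) (auto simp: big_def)
    also have "\<dots> = 2 * (\<Sum>c\<in>?F. class_dist c (p 0) (p (word_dist g h)) - 9)"
      by (simp add: p sum_distrib_left)
    also have "\<dots> \<le> 2 * (word_dist g h + 1)"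
      using assms(3,4) p by (intro mult_le_mono sum_same_label[of _ p _ \<Lambda>]) (auto simp: big_def)
    finally show "(\<Sum>c\<in>?F. class_dist c g h) \<le> 2 * (word_dist g h + 1)" .
  qed
  also have "\<dots> = 2 ^ card V * (2 * (word_dist g h + 1))"
    using finite_V by (simp add: card_Pow)
  finally show ?thesis .
qed

text \<open>Each class contributes at least 1 to the sum, so the uniform bound on sums over finite
  subfamilies bounds their size.\<close>

lemma finite_big:
  assumes "g \<in> carrier GP" "h \<in> carrier GP" "20 \<le> \<sigma>"
  shows "finite (big \<sigma> g h)"
proof (rule ccontr)
  assume "infinite (big \<sigma> g h)"
  then obtain F where F: "finite F" "card F = Suc (2 ^ card V * (2 * (word_dist g h + 1)))" "F \<subseteq> big \<sigma> g h"
    using infinite_arbitrarily_large by blast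
  have F20: "F \<subseteq> big 20 g h"
    using F(3) assms(3) by (auto simp: big_def)
  then have "(\<Sum>c\<in>F. 1) \<le> (\<Sum>c\<in>F. class_dist c g h)"
    by (intro sum_mono) (force simp: big_def)
  then show False
    using sum_class_dist_le[OF assms(1,2) F(1) F20] F(2) by simp
qed

lemma dist_sum_eq:
  assumes "g \<in> carrier GP" "h \<in> carrier GP" "20 \<le> \<sigma>"
  shows "dist_sum \<sigma> g h = ereal (\<Sum>c\<in>big \<sigma> g h. real (class_dist c g h))"
proof -
  have "dist_sum \<sigma> g h = (\<Sum>\<^sub>\<infinity>c\<in>big \<sigma> g h. ereal (real (class_dist c g h)))"
    unfolding dist_sum_def by (intro infsum_cong_neutral) (auto simp: big_def threshold_def)
  also have "\<dots> = ereal (\<Sum>c\<in>big \<sigma> g h. real (class_dist c g h))"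
    using finite_big[OF assms] by simp
  finally show ?thesis .
qed

lemma dist_sum_le_word_dist:
  assumes "g \<in> carrier GP" "h \<in> carrier GP" "20 \<le> \<sigma>"
  shows "(\<Sum>c\<in>big \<sigma> g h. real (class_dist c g h)) \<le> 2 ^ (card V + 1) * (real (word_dist g h) + 1)"
proof -
  have "big \<sigma> g h \<subseteq> big 20 g h"
    using assms(3) by (auto simp: big_def)
  then have "(\<Sum>c\<in>big \<sigma> g h. class_dist c g h) \<le> 2 ^ card V * (2 * (word_dist g h + 1))"
    using sum_class_dist_le[OF assms(1,2) finite_big[OF assms]] by blast
  then have "real (\<Sum>c\<in>big \<sigma> g h. class_dist c g h) \<le> real (2 ^ card V * (2 * (word_dist g h + 1)))"
    by (rule of_nat_mono)
  then show ?thesis by (simp add: algebra_simps)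
qed

section \<open>Geodesics and the upper bound\<close>

text \<open>Levi's lemma for partially commutative words. The head of \<open>as\<close> is free in
  \<open>cs\<close> or, past all of \<open>cs\<close>, in \<open>ds\<close>; accordingly it is put
  into \<open>p\<close> or \<open>q\<close>, and in the second case it commutes with
  \<open>r\<close>.\<close>

lemma levi:
  assumes "as @ bs \<asymp> cs @ ds"
  shows "\<exists>p q r t. as \<asymp> p @ q \<and> bs \<asymp> r @ t \<and> cs \<asymp> p @ r \<and> ds \<asymp> q @ t \<and> (\<forall>v\<in>fst ` set q. adjl v r)"
  using assms
proof (induction as arbitrary: cs ds)
  case Nil
  then show ?case
    by (intro exI[of _ "[]"] exI[of _ cs] exI[of _ ds]) auto
next
  case (Cons x as)
  obtain v c where x: "x = (v, c)" by (cases x)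
  have "front v (cs @ ds)"
    using shuffle_front[OF Cons.prems, of v] x by simp
  then consider "front v cs" | "adjl v cs" "front v ds" by auto
  then show ?case
  proof cases
    case 1
    then obtain b cs' where cs': "cs \<asymp> (v, b) # cs'"
      using front_shuffle_Cons by blast
    then have "(v, c) # (as @ bs) \<asymp> (v, b) # (cs' @ ds)"
      using Cons.prems shuffle_append_right[OF cs', of ds] x by (auto intro: shuffle_trans)
    from shuffle_Cons_cancel[OF this] have b: "c = b" "as @ bs \<asymp> cs' @ ds" by auto
    then obtain p q r t where *: "as \<asymp> p @ q" "bs \<asymp> r @ t" "cs' \<asymp> p @ r" "ds \<asymp> q @ t"
      "\<forall>v\<in>fst ` set q. adjl v r"
      using Cons.IH by blast
    have "x # as \<asymp> (x # p) @ q" "cs \<asymp> (x # p) @ r"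
      using * cs' x b by (auto intro: shuffle_Cons shuffle_trans)
    then show ?thesis using * by blast
  next
    case 2
    then obtain b ds' where ds': "ds \<asymp> (v, b) # ds'"
      using front_shuffle_Cons by blast
    have "(v, c) # (as @ bs) \<asymp> cs @ (v, b) # ds'"
      using Cons.prems shuffle_append_left[OF ds', of cs] x by (auto intro: shuffle_trans)
    also have "\<dots> \<asymp> (v, b) # (cs @ ds')"
      using 2 by (intro shuffle_sym[OF shuffle_move]) auto
    finally have b: "c = b" "as @ bs \<asymp> cs @ ds'"
      using shuffle_Cons_cancel by blast+
    then obtain p q r t where *: "as \<asymp> p @ q" "bs \<asymp> r @ t" "cs \<asymp> p @ r" "ds' \<asymp> q @ t"
      "\<forall>v\<in>fst ` set q. adjl v r"
      using Cons.IH by blast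
    have pr: "adjl v p" "adjl v r"
      using shuffle_set[OF *(3)] 2 by auto
    have "x # as \<asymp> x # p @ q"
      using *(1) by (rule shuffle_Cons)
    also have "\<dots> \<asymp> p @ x # q"
      using pr x by (intro shuffle_move) auto
    finally have "x # as \<asymp> p @ x # q" .
    moreover have "ds \<asymp> (x # q) @ t"
      using ds' * x b by (auto intro: shuffle_Cons shuffle_trans)
    ultimately show ?thesis
      using *(2,3,5) pr x by (intro exI[of _ p] exI[of _ "x # q"] exI[of _ r] exI[of _ t]) auto
  qed
qed

text \<open>The cut divides the block \<open>ys\<close> into a part \<open>p\<close> of
  \<open>as\<close> and a part \<open>r\<close> of \<open>bs\<close>. While \<open>r\<close> is
  empty, a block costs \<open>as\<close> at most one piece and \<open>bs\<close> none; the first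
  nonempty \<open>r\<close> makes the rest \<open>q\<close> of \<open>as\<close> a single
  piece.\<close>

lemma split_pieces:
  assumes L: "\<Lambda> \<in> subgraphs" and "red (as @ bs)" "as @ bs \<asymp> concat yss" "\<forall>ys\<in>set yss. fst ` set ys \<subset> \<Lambda>"
  shows "ev as \<in> pieces \<Lambda> (length yss) \<and> ev bs \<in> pieces \<Lambda> (length yss)
    \<and> nrm \<Lambda> (ev as) + nrm \<Lambda> (ev bs) \<le> length yss + 2"
  using assms(2-)
proof (induction yss arbitrary: as bs)
  case Nil
  then have "as = []" "bs = []"
    using shuffle_length[of "as @ bs" "[]"] by auto
  then show ?case by simp
next
  case (Cons ys yss)
  have LV: "\<Lambda> \<subseteq> V" using L subgraphs_subset by blast
  obtain p q r t where *: "as \<asymp> p @ q" "bs \<asymp> r @ t" "ys \<asymp> p @ r" "concat yss \<asymp> q @ t"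
      "\<forall>v\<in>fst ` set q. adjl v r"
    using levi[of as bs ys "concat yss"] Cons.prems(2) by auto
  have "red (ys @ concat yss)"
    using Cons.prems shuffle_red by auto
  then have "red (concat yss)" by (simp add: red_append)
  then have red_qt: "red (q @ t)" using * shuffle_red by blast
  have IH: "ev q \<in> pieces \<Lambda> (length yss)" "ev t \<in> pieces \<Lambda> (length yss)"
      "nrm \<Lambda> (ev q) + nrm \<Lambda> (ev t) \<le> length yss + 2"
    using Cons.IH[OF red_qt shuffle_sym[OF *(4)]] Cons.prems(3) by auto
  have w: "as \<in> words" "bs \<in> words"
    using red_words[OF Cons.prems(1)] by auto
  then have w': "p \<in> words" "q \<in> words" "r \<in> words" "t \<in> words"
    using shuffle_words[OF *(1)] shuffle_words[OF *(2)] by auto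
  have e: "ev as = ev p \<cdot> ev q" "ev bs = ev r \<cdot> ev t"
    using ev_shuffle[OF *(1) w(1)] ev_shuffle[OF *(2) w(2)] w' by (auto simp: ev_append)
  have "fst ` set ys \<subset> \<Lambda>" using Cons.prems(3) by simp
  then have sup: "fst ` set p \<subset> \<Lambda>" "fst ` set r \<subset> \<Lambda>"
    using shuffle_set[OF *(3)] by auto
  have piece: "ev u \<in> pieces \<Lambda> 1" if "u \<in> words" "fst ` set u \<subset> \<Lambda>" for u
    using that LV ev_in_span[of "fst ` set u" u] proper_in_piece[OF LV that(2)] pieces_one[OF LV]
    by blast
  have as: "ev as \<in> pieces \<Lambda> (length (ys # yss))"
    unfolding e using pieces_mult[OF LV piece[OF w'(1) sup(1)] IH(1)] by simp
  have bs: "ev bs \<in> pieces \<Lambda> (length (ys # yss))"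
    unfolding e using pieces_mult[OF LV piece[OF w'(3) sup(2)] IH(2)] by simp
  have span: "ev p \<in> span \<Lambda>" "ev q \<in> span \<Lambda>" "ev t \<in> span \<Lambda>"
    using pieces_in_span[OF LV] IH piece[OF w'(1) sup(1)] by blast+
  have np: "nrm \<Lambda> (ev as) \<le> 1 + nrm \<Lambda> (ev q)"
    unfolding e using nrm_mult[OF L span(1,2)] nrm_le[OF piece[OF w'(1) sup(1)]] by linarith
  have "nrm \<Lambda> (ev as) + nrm \<Lambda> (ev bs) \<le> length (ys # yss) + 2"
  proof (cases "r = []")
    case True
    then have "ev bs = ev t" using e w' by simp
    then show ?thesis using np IH(3) by simp
  next
    case False
    \<comment> \<open>\<open>q\<close> commutes with a letter of vertex \<open>u\<close> and
      therefore avoids \<open>u\<close>. So \<open>as\<close> costs at most 2, for \<open>p\<close>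
      and \<open>q\<close>, and \<open>bs\<close> at most one piece per block.\<close>
    then obtain u where u: "u \<in> fst ` set r" by (cases r) auto
    then have "u \<notin> fst ` set q" "u \<in> \<Lambda>"
      using *(5) sup(2) by fastforce+
    moreover have "fst ` set q \<subseteq> \<Lambda>"
      using span(2) red_in_span_iff[OF LV, of q] red_qt by (simp add: red_append)
    ultimately have "nrm \<Lambda> (ev q) \<le> 1"
      using piece[OF w'(2)] nrm_le by blast
    then show ?thesis
      using np nrm_le[OF bs] by simp
  qed
  then show ?case using as bs by blast
qed

section \<open>Reduced words cut into proper blocks\<close>

lemma mergef_append:
  "mergef v a (xs @ ys) = (if v \<in> fst ` set xs then mergef v a xs @ ys else xs @ mergef v a ys)"
  by (induction xs) auto

lemma mergef_vertices: "fst ` set (mergef v a xs) \<subseteq> fst ` set xs"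
  by (induction xs) auto

abbreviation shrink :: "('v \<times> 'a) list list \<Rightarrow> ('v \<times> 'a) list list \<Rightarrow> bool" where
  "shrink \<equiv> list_all2 (\<lambda>ys zs. fst ` set zs \<subseteq> fst ` set ys)"

lemma shrink_refl: "shrink yss yss"
  by (simp add: list_all2_refl)

lemma mergef_concat: "\<exists>zss. mergef v a (concat yss) = concat zss \<and> shrink yss zss"
proof (induction yss)
  case (Cons ys yss)
  then obtain zss where zss: "mergef v a (concat yss) = concat zss" "shrink yss zss" by blast
  show ?case
  proof (cases "v \<in> fst ` set ys")
    case True
    then show ?thesis
      using mergef_vertices[of v a ys]
      by (intro exI[of _ "mergef v a ys # yss"]) (auto simp: mergef_append shrink_refl)
  next
    case False
    then show ?thesis
      using zss by (intro exI[of _ "ys # zss"]) (auto simp: mergef_append)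
  qed
qed simp

lemma push_concat:
  "\<exists>zs zss. push (v, a) (concat (ys # yss)) = concat (zs # zss)
    \<and> fst ` set zs \<subseteq> insert v (fst ` set ys) \<and> shrink yss zss"
proof -
  consider "a = \<one>\<^bsub>G v\<^esub>" | "a \<noteq> \<one>\<^bsub>G v\<^esub>" "front v (concat (ys # yss))"
    | "a \<noteq> \<one>\<^bsub>G v\<^esub>" "\<not> front v (concat (ys # yss))" by blast
  then show ?thesis
  proof cases
    case 1
    then show ?thesis
      by (intro exI[of _ ys] exI[of _ yss]) (auto simp: shrink_refl)
  next
    case 2
    obtain zs' where zs': "mergef v a (concat (ys # yss)) = concat zs'" "shrink (ys # yss) zs'"
      using mergef_concat by blast
    then obtain zs zss where "zs' = zs # zss" "fst ` set zs \<subseteq> fst ` set ys" "shrink yss zss"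
      by (auto simp: list_all2_Cons1)
    then show ?thesis
      using 2 zs'(1) by (intro exI[of _ zs] exI[of _ zss]) auto
  next
    case 3
    then show ?thesis
      by (intro exI[of _ "(v, a) # ys"] exI[of _ yss]) (auto simp: shrink_refl)
  qed
qed

text \<open>A letter of \<open>u\<close> either merges into a letter where that stands, so that no
  later block gains a vertex, or is put at the head. All heads form one new block, with vertices
  from \<open>u\<close>; multiplication by a piece thus costs one block.\<close>

lemma act_concat:
  "\<exists>zs zss. act u (concat yss) = concat (zs # zss) \<and> fst ` set zs \<subseteq> fst ` set u \<and> shrink yss zss"
proof (induction u)
  case Nil
  then show ?case
    by (intro exI[of _ "[]"] exI[of _ yss]) (auto simp: shrink_refl)
next
  case (Cons x u)
  then obtain zs zss where zs: "act u (concat yss) = concat (zs # zss)" "fst ` set zs \<subseteq> fst ` set u"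
    "shrink yss zss" by blast
  obtain zs' zss' where zs': "push x (concat (zs # zss)) = concat (zs' # zss')"
    "fst ` set zs' \<subseteq> insert (fst x) (fst ` set zs)" "shrink zss zss'"
    using push_concat[of "fst x" "snd x" zs zss] by auto
  have "shrink yss zss'"
    using zs(3) zs'(3) by (rule list_all2_trans[rotated]) auto
  moreover have "act (x # u) (concat yss) = concat (zs' # zss')"
    unfolding act_simps zs(1) zs'(1) ..
  moreover have "insert (fst x) (fst ` set zs) \<subseteq> fst ` set (x # u)"
    using zs(2) by auto
  then have "fst ` set zs' \<subseteq> fst ` set (x # u)"
    using zs'(2) by (rule order_trans[rotated])
  ultimately show ?case by blast
qed

lemma pieces_decomposition:
  assumes L: "\<Lambda> \<in> subgraphs" "\<And>v. \<Lambda> \<noteq> {v}" and "a \<in> pieces \<Lambda> n"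
  shows "\<exists>yss. length yss = n \<and> (\<forall>ys\<in>set yss. fst ` set ys \<subset> \<Lambda>) \<and> red (concat yss) \<and> ev (concat yss) = a"
  using assms(3)
proof (induction n arbitrary: a)
  case 0
  then show ?case by (intro exI[of _ "[]"]) auto
next
  case (Suc n)
  have LV: "\<Lambda> \<subseteq> V" "\<Lambda> \<noteq> {}" using L by (auto simp: subgraphs_def)
  obtain s c where sc: "s \<in> piece \<Lambda>" "c \<in> pieces \<Lambda> n" "a = s \<cdot> c"
    using Suc.prems by auto
  obtain yss where yss: "length yss = n" "\<forall>ys\<in>set yss. fst ` set ys \<subset> \<Lambda>" "red (concat yss)"
    "ev (concat yss) = c"
    using Suc.IH[OF sc(2)] by blast
  have s: "s \<in> span \<Lambda>" using sc(1) by (simp add: piece_def)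
  obtain u where u: "red u" "ev u = s" "fst ` set u \<subset> \<Lambda>"
  proof -
    obtain u where u: "red u" "ev u = s" "fst ` set u \<subseteq> \<Lambda>"
      using s span_red_cases LV by blast
    \<comment> \<open>A generator lies in the span of a single vertex, which does not cover
      \<Lambda> because \<Lambda> is no singleton. The support of the reduced word \<open>u\<close>
      then misses a vertex of \<Lambda>.\<close>
    have "\<exists>\<Omega>\<subseteq>V. s \<in> span \<Omega> \<and> \<not> \<Lambda> \<subseteq> \<Omega>"
    proof -
      have inv: "ginv t \<in> span {v}" if "v \<in> V" "t \<in> span {v}" for t v
        using that by (intro span_inv) auto
      have gen: "\<exists>v\<in>V. t \<in> span {v}" if "t \<in> gens" for t
        using that gens_in_carrier by (force simp: gens_def incl_ev intro!: ev_in_span)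
      consider "s = \<one>\<^bsub>GP\<^esub>" | \<Omega> where "\<Omega> \<subset> \<Lambda>" "s \<in> span \<Omega>" | "s \<in> gens_sym"
        using sc(1) unfolding piece_def by blast
      then show ?thesis
      proof cases
        case 1
        then show ?thesis using LV by (intro exI[of _ "{}"]) auto
      next
        case 2
        then show ?thesis using LV by blast
      next
        case 3
        then obtain v where v: "v \<in> V" "s \<in> span {v}"
          using gen inv by blast
        then show ?thesis
          using L(2)[of v] LV by (intro exI[of _ "{v}"]) auto
      qed
    qed
    then obtain \<Omega> where "\<Omega> \<subseteq> V" "s \<in> span \<Omega>" "\<not> \<Lambda> \<subseteq> \<Omega>" by blast
    then have "fst ` set u \<subset> \<Lambda>"
      using red_in_span_iff[of \<Omega> u] u by auto
    then show ?thesis using that u by blast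
  qed
  obtain zs zss where zs: "act u (concat yss) = concat (zs # zss)" "fst ` set zs \<subseteq> fst ` set u"
    "shrink yss zss"
    using act_concat by blast
  have "\<forall>ys\<in>set zss. fst ` set ys \<subset> \<Lambda>"
  proof
    fix z assume "z \<in> set zss"
    then obtain i where "i < length zss" "z = zss ! i"
      by (auto simp: in_set_conv_nth)
    then have "fst ` set z \<subseteq> fst ` set (yss ! i)" "yss ! i \<in> set yss"
      using zs(3) by (auto simp: list_all2_conv_all_nth)
    then show "fst ` set z \<subset> \<Lambda>" using yss(2) by blast
  qed
  moreover have "red (concat (zs # zss))" "ev (concat (zs # zss)) = a"
    unfolding zs(1)[symmetric] using red_act ev_act u yss sc red_words by auto
  moreover have "length (zs # zss) = Suc n"
    using yss(1) zs(3) list_all2_lengthD by fastforce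
  ultimately show ?case
    using zs(2) u(3) by (intro exI[of _ "zs # zss"]) auto
qed

lemma nrm_superadditive:
  assumes L: "\<Lambda> \<in> subgraphs" and "red (as @ bs)" "fst ` set (as @ bs) \<subseteq> \<Lambda>"
  shows "nrm \<Lambda> (ev as) \<le> nrm \<Lambda> (ev (as @ bs))" "nrm \<Lambda> (ev bs) \<le> nrm \<Lambda> (ev (as @ bs))"
    "nrm \<Lambda> (ev as) + nrm \<Lambda> (ev bs) \<le> nrm \<Lambda> (ev (as @ bs)) + 2"
proof -
  have LV: "\<Lambda> \<subseteq> V" using L subgraphs_subset by blast
  have "nrm \<Lambda> (ev as) \<le> nrm \<Lambda> (ev (as @ bs)) \<and> nrm \<Lambda> (ev bs) \<le> nrm \<Lambda> (ev (as @ bs)) \<and>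
    nrm \<Lambda> (ev as) + nrm \<Lambda> (ev bs) \<le> nrm \<Lambda> (ev (as @ bs)) + 2"
  proof (cases "\<exists>v. \<Lambda> = {v}")
    case True
    then obtain v where v: "\<Lambda> = {v}" by blast
    \<comment> \<open>Over a single vertex there is no decomposition into proper blocks, but a
      reduced word has at most one letter, so every cut is trivial.\<close>
    have "as = [] \<or> bs = []"
    proof (rule ccontr)
      assume "\<not> (as = [] \<or> bs = [])"
      then obtain as' x y bs' where xy: "as = as' @ [x]" "bs = y # bs'"
        by (metis neq_Nil_conv rev_exhaust)
      then have "fst x = v" "fst y = v" using assms(3) v by auto
      then have "rear v as \<and> front v bs" using xy by auto
      then show False using assms(2) red_append by blast
    qed
    then show ?thesis by auto
  next
    case False
    have "ev (as @ bs) \<in> span \<Lambda>"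
      using ev_in_span LV assms red_words by blast
    then obtain yss where yss: "length yss = nrm \<Lambda> (ev (as @ bs))" "\<forall>ys\<in>set yss. fst ` set ys \<subset> \<Lambda>"
        "red (concat yss)" "ev (concat yss) = ev (as @ bs)"
      using pieces_decomposition[OF L _ nrm_pieces[OF L]] False by blast
    then have "as @ bs \<asymp> concat yss"
      using normal_form_unique assms(2) by metis
    from split_pieces[OF L assms(2) this yss(2)] show ?thesis
      using nrm_le yss(1) by metis
  qed
  then show "nrm \<Lambda> (ev as) \<le> nrm \<Lambda> (ev (as @ bs))" "nrm \<Lambda> (ev bs) \<le> nrm \<Lambda> (ev (as @ bs))"
    "nrm \<Lambda> (ev as) + nrm \<Lambda> (ev bs) \<le> nrm \<Lambda> (ev (as @ bs)) + 2"
    by blast+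
qed

text \<open>A path starting on one side of the hyperplane of the vertex coset \<open>\<langle>v\<rangle>\<close> can only leave that side
  through an edge dual to the hyperplane, whose carrier is \<open>\<langle>st v\<rangle>\<close>.\<close>

lemma wall_crossing:
  assumes v: "v \<in> V" and h: "h \<in> carrier GP" "proj {v} h = \<one>\<^bsub>GP\<^esub>"
    and "q \<in> words" "proj {v} (h \<cdot> ev q) \<noteq> \<one>\<^bsub>GP\<^esub>"
  shows "\<exists>q1 t q2. q = q1 @ (v, t) # q2 \<and> h \<cdot> ev q1 \<in> span (link {v})"
  using assms(4,5)
proof (induction q rule: rev_induct)
  case Nil
  then show ?case using h by simp
next
  case (snoc x q)
  then have q: "q \<in> words" and x: "fst x \<in> V" "snd x \<in> carrier (G (fst x))" by auto
  show ?case
  proof (cases "proj {v} (h \<cdot> ev q) = \<one>\<^bsub>GP\<^esub>")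
    case False
    then obtain q1 t q2 where "q = q1 @ (v, t) # q2" "h \<cdot> ev q1 \<in> span (link {v})"
      using snoc.IH q by blast
    then show ?thesis
      by (intro exI[of _ q1] exI[of _ t] exI[of _ "q2 @ [x]"]) auto
  next
    case True
    have hq: "h \<cdot> ev q \<in> carrier GP" using h q by simp
    have "h \<cdot> ev (q @ [x]) = h \<cdot> ev q \<cdot> ev [(fst x, snd x)]"
      using q x h by (simp add: ev_append GPg.m_assoc)
    then have "fst x \<in> {v} \<and> ginv \<one>\<^bsub>GP\<^esub> \<cdot> (h \<cdot> ev q) \<in> span (link {fst x})"
      using proj_step[of "{v}" "h \<cdot> ev q" "fst x" "snd x"] True snoc.prems(2) v hq x by auto
    then have "fst x = v" "h \<cdot> ev q \<in> span (link {v})"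
      using hq by auto
    then show ?thesis
      by (intro exI[of _ q] exI[of _ "snd x"] exI[of _ "[]"]) auto
  qed
qed

text \<open>A letter free at the front of the gate is free at the front of \<open>x\<close>, so the
  longest prefix of \<open>x\<close> in the group of \<open>v\<close> is not empty.\<close>

lemma front_proj:
  assumes "\<Lambda> \<subseteq> V" "v \<in> \<Lambda>" "x \<in> carrier GP" "red bs" "ev bs = proj \<Lambda> x" "front v bs"
  shows "proj {v} x \<noteq> \<one>\<^bsub>GP\<^esub>"
proof
  assume one: "proj {v} x = \<one>\<^bsub>GP\<^esub>"
  obtain as cs where ac: "red (as @ cs)" "x = ev (as @ cs)" "proj \<Lambda> x = ev as"
    using proj_cases[OF assms(1,3)] by metis
  have "bs \<asymp> as"
    using assms(4,5) ac by (intro normal_form_unique) (auto simp: red_append)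
  then have fr: "front v (as @ cs)"
    using assms(6) shuffle_front by auto
  have "{v} \<subseteq> V" using assms by auto
  then obtain as' cs' where ac': "red (as' @ cs')" "nofront {v} cs'" "x = ev (as' @ cs')" "proj {v} x = ev as'"
    using proj_cases[of "{v}" x] assms(3) by metis
  then have "as' \<asymp> []"
    using one by (intro normal_form_unique) (auto simp: red_append)
  then have "as' = []" using shuffle_length by fastforce
  then have "as @ cs \<asymp> cs'"
    using ac ac' by (intro normal_form_unique) auto
  then show False
    using fr ac'(2) shuffle_front by blast
qed

text \<open>If \<open>v\<close> were free at the end of \<open>as\<close> and at the start of
  \<open>bs\<close>, the paths from \<open>y\<close> along \<open>qs\<close> and backwards along
  \<open>ps\<close> would both cross the wall of \<open>v\<close>. Both crossings start in
  \<open>span (link {v})\<close>, so the part of \<open>ps @ qs\<close> between the two crossing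
  letters commutes with \<open>v\<close>, and these letters could be merged.\<close>

lemma gate_geodesic:
  assumes L: "\<Lambda> \<subseteq> V" and y: "y \<in> carrier GP" "proj \<Lambda> y = \<one>\<^bsub>GP\<^esub>" and red: "red (ps @ qs)"
    and as: "red as" "ev as = ginv (proj \<Lambda> (y \<cdot> ginv (ev ps)))"
    and bs: "red bs" "ev bs = proj \<Lambda> (y \<cdot> ev qs)"
  shows "red (as @ bs)"
proof -
  have pq: "red ps" "red qs" "ps \<in> words" "qs \<in> words"
    using red red_words by (fastforce simp: red_append)+
  have False if v: "rear v as" "front v bs" for v
  proof -
    have "ev bs \<in> span \<Lambda>" using bs(2) L y pq by simp
    then have vL: "v \<in> \<Lambda>"
      using red_in_span_iff[OF L bs(1)] front_in_set[OF v(2)] by blast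
    then have vV: "v \<in> V" "{v} \<subseteq> V" using L by auto
    have psi: "y \<cdot> ev (word_inv ps) = y \<cdot> ginv (ev ps)" "word_inv ps \<in> words"
      using ev_word_inv pq by auto
    have "ev (word_inv as) = proj \<Lambda> (y \<cdot> ev (word_inv ps))"
      using as(2) ev_word_inv[OF red_words[OF as(1)]] y pq L psi by simp
    then have A: "proj {v} (y \<cdot> ev (word_inv ps)) \<noteq> \<one>\<^bsub>GP\<^esub>"
      using front_proj[OF L vL _ red_word_inv[OF as(1)]] v(1) y pq by simp
    have B: "proj {v} (y \<cdot> ev qs) \<noteq> \<one>\<^bsub>GP\<^esub>"
      using front_proj[OF L vL _ bs(1) bs(2) v(2)] y pq by simp
    have y1: "proj {v} y = \<one>\<^bsub>GP\<^esub>"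
    proof -
      obtain es fs where ef: "red (es @ fs)" "nofront \<Lambda> fs" "y = ev (es @ fs)" "proj \<Lambda> y = ev es"
        using proj_cases[OF L y(1)] by metis
      then have "es \<asymp> []"
        using y(2) by (intro normal_form_unique) (auto simp: red_append)
      then have "es = []" using shuffle_length by fastforce
      then show ?thesis
        using proj_ev[OF vV(2), of "[]" fs] ef vL by simp
    qed
    obtain q1 t q2 where q: "qs = q1 @ (v, t) # q2" "y \<cdot> ev q1 \<in> span (link {v})"
      using wall_crossing[OF vV(1) y(1) y1 pq(4) B] by blast
    obtain p1 s p2 where p: "word_inv ps = p1 @ (v, s) # p2" "y \<cdot> ev p1 \<in> span (link {v})"
      using wall_crossing[OF vV(1) y(1) y1 psi(2) A] by blast
    have pw: "p1 \<in> words" "q1 \<in> words"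
      using psi(2) pq(4) unfolding p(1) q(1) by auto
    have "ps = word_inv (p1 @ (v, s) # p2)"
      using word_inv_inv[OF pq(3)] unfolding p(1) by simp
    then have split: "ps @ qs = word_inv p2 @ (v, inv\<^bsub>G v\<^esub> s) # (word_inv p1 @ q1) @ (v, t) # q2"
      using q(1) by simp
    have rpq: "red (word_inv p1 @ q1)"
      using red unfolding split by (simp add: red_append del: red.simps) (simp add: red_append)
    have "ginv (y \<cdot> ev p1) \<cdot> (y \<cdot> ev q1) \<in> span (link {v})"
      by (rule span_mult[OF link_subset span_inv[OF link_subset p(2)] q(2)])
    also have "ginv (y \<cdot> ev p1) \<cdot> (y \<cdot> ev q1) = ev (word_inv p1 @ q1)"
      using pw y by (simp add: ev_append ev_word_inv GPg.inv_mult_group GPg.m_assoc)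
    finally have "fst ` set (word_inv p1 @ q1) \<subseteq> link {v}"
      using red_in_span_iff[OF link_subset rpq] by blast
    then have "adjl v (word_inv p1 @ q1)"
      using link_eq[OF vV(2)] adj_commute by blast
    then have "front v ((word_inv p1 @ q1) @ (v, t) # q2)"
      unfolding front_append by auto
    then show False
      using red unfolding split red_append[of "word_inv p2"] by auto
  qed
  then show ?thesis
    using as(1) bs(1) red_append by blast
qed

lemma class_dist_superadditive:
  assumes c: "c \<in> index_set" and g: "g \<in> carrier GP" and red: "red (ps @ qs)"
  defines "g1 \<equiv> g \<cdot> ev ps" and "g2 \<equiv> g \<cdot> ev (ps @ qs)"
  shows "class_dist c g g1 \<le> class_dist c g g2" "class_dist c g1 g2 \<le> class_dist c g g2"
    "class_dist c g g1 + class_dist c g1 g2 \<le> class_dist c g g2 + 2"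
proof -
  define k where "k = rep c"
  define \<Lambda> where "\<Lambda> = lab c"
  have L: "\<Lambda> \<in> subgraphs" and k: "k \<in> carrier GP"
    using index_set_rep[OF c] by (auto simp: k_def \<Lambda>_def)
  then have LV: "\<Lambda> \<subseteq> V" using subgraphs_subset by blast
  have pq: "ps \<in> words" "qs \<in> words" using red_words[OF red] by auto
  have g12: "g1 \<in> carrier GP" "g2 \<in> carrier GP" "g2 = g1 \<cdot> ev qs"
    using g pq by (auto simp: g1_def g2_def ev_append GPg.m_assoc)
  let ?p = "\<lambda>x. proj \<Lambda> (ginv k \<cdot> x)"
  have p: "?p x \<in> span \<Lambda>" "?p x \<in> carrier GP" if "x \<in> carrier GP" for x
    using that k LV by simp_all
  \<comment> \<open>\<open>g1\<close> is moved to a point whose gate is the identity, as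
    \<open>gate_geodesic\<close> requires. Then \<open>as\<close> and \<open>bs\<close> are the
    displacements of the gate from \<open>g\<close> to \<open>g1\<close> and from \<open>g1\<close>
    to \<open>g2\<close>.\<close>
  define y where "y = ginv (?p g1) \<cdot> (ginv k \<cdot> g1)"
  have i: "ginv (?p g1) \<in> span \<Lambda>" "ginv (?p g1) \<in> carrier GP"
    using p[OF g12(1)] span_inv[OF LV] by auto
  have y: "y \<in> carrier GP" "proj \<Lambda> y = \<one>\<^bsub>GP\<^esub>"
    unfolding y_def using i p[OF g12(1)] k g12 proj_span_mult[OF LV i(1), of "ginv k \<cdot> g1"] by simp_all
  have yq: "y \<cdot> ev qs = ginv (?p g1) \<cdot> (ginv k \<cdot> g2)"
    unfolding y_def g12(3) using i k g12 pq by (simp add: GPg.m_assoc)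
  have yp: "y \<cdot> ginv (ev ps) = ginv (?p g1) \<cdot> (ginv k \<cdot> g)"
    unfolding y_def g1_def using i[unfolded g1_def] k g pq by (simp add: GPg.m_assoc)
  have Pq: "proj \<Lambda> (y \<cdot> ev qs) = ginv (?p g1) \<cdot> ?p g2"
    unfolding yq using proj_span_mult[OF LV i(1)] k g12 by simp
  have Pp: "ginv (proj \<Lambda> (y \<cdot> ginv (ev ps))) = ginv (?p g) \<cdot> ?p g1"
    unfolding yp using proj_span_mult[OF LV i(1)] k g i p[OF g] p[OF g12(1)]
    by (simp add: GPg.inv_mult_group)
  have "ginv (?p g) \<cdot> ?p g1 \<in> span \<Lambda>" "ginv (?p g1) \<cdot> ?p g2 \<in> span \<Lambda>"
    using p g g12 by (simp_all add: span_mult span_inv LV)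
  then obtain as bs where as: "red as" "ev as = ginv (?p g) \<cdot> ?p g1" "fst ` set as \<subseteq> \<Lambda>"
    and bs: "red bs" "ev bs = ginv (?p g1) \<cdot> ?p g2" "fst ` set bs \<subseteq> \<Lambda>"
    using span_red_cases[OF LV] by metis
  have ab: "red (as @ bs)"
    using gate_geodesic[OF LV y red as(1) _ bs(1)] as(2) bs(2) Pp Pq by simp
  have "ev (as @ bs) = ginv (?p g) \<cdot> ?p g2"
    using as bs red_words p[OF g] p[OF g12(1)] p[OF g12(2)] by (simp add: ev_append GPg.m_assoc)
  then have "class_dist c g g1 = nrm \<Lambda> (ev as)" "class_dist c g1 g2 = nrm \<Lambda> (ev bs)"
    "class_dist c g g2 = nrm \<Lambda> (ev (as @ bs))"
    using class_dist_eq[OF c] g g12 as(2) bs(2) by (simp_all add: cdist_def k_def \<Lambda>_def)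
  then show "class_dist c g g1 \<le> class_dist c g g2" "class_dist c g1 g2 \<le> class_dist c g g2"
    "class_dist c g g1 + class_dist c g1 g2 \<le> class_dist c g g2 + 2"
    using nrm_superadditive[OF L ab] as(3) bs(3) by auto
qed

text \<open>The truncation with the constant \<open>2\<close> subtracted makes the defect of superadditivity disappear.\<close>

definition trunc :: "real \<Rightarrow> nat \<Rightarrow> real" where
  "trunc \<sigma> n = (if \<sigma> \<le> real n then real n - 2 else 0)"

definition wsum :: "real \<Rightarrow> ('v \<times> 'a) list set set \<Rightarrow> ('v \<times> 'a) list set set \<Rightarrow> real" where
  "wsum \<sigma> g h = (\<Sum>c\<in>big \<sigma> g h. trunc \<sigma> (class_dist c g h))"

lemma trunc_nonneg: "20 \<le> \<sigma> \<Longrightarrow> 0 \<le> trunc \<sigma> n"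
  by (simp add: trunc_def)

lemma trunc_superadditive:
  "20 \<le> \<sigma> \<Longrightarrow> a \<le> n \<Longrightarrow> b \<le> n \<Longrightarrow> a + b \<le> n + 2 \<Longrightarrow> trunc \<sigma> a + trunc \<sigma> b \<le> trunc \<sigma> n"
  by (simp add: trunc_def)

lemma wsum_superadditive:
  assumes s: "20 \<le> \<sigma>" and g: "g \<in> carrier GP" and red: "red (ps @ qs)"
  defines "g1 \<equiv> g \<cdot> ev ps" and "g2 \<equiv> g \<cdot> ev (ps @ qs)"
  shows "wsum \<sigma> g g1 + wsum \<sigma> g1 g2 \<le> wsum \<sigma> g g2"
proof -
  have pq: "ps \<in> words" "qs \<in> words" using red_words[OF red] by auto
  have cl: "g1 \<in> carrier GP" "g2 \<in> carrier GP"
    using g pq by (auto simp: g1_def g2_def)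
  note super = class_dist_superadditive[OF _ g red, folded g1_def g2_def]
  have fin: "finite (big \<sigma> g g2)"
    using finite_big g cl s by blast
  \<comment> \<open>No part has a larger class distance than the whole, so all sums can be taken
    over \<open>big \<sigma> g g2\<close>; the terms added to them are truncated to 0.\<close>
  have "wsum \<sigma> g g1 = (\<Sum>c\<in>big \<sigma> g g2. trunc \<sigma> (class_dist c g g1))"
    unfolding wsum_def using fin
  proof (rule sum.mono_neutral_left)
    show "big \<sigma> g g1 \<subseteq> big \<sigma> g g2"
      using super(1) by (fastforce simp: big_def)
  qed (auto simp: big_def trunc_def)
  moreover have "wsum \<sigma> g1 g2 = (\<Sum>c\<in>big \<sigma> g g2. trunc \<sigma> (class_dist c g1 g2))"
    unfolding wsum_def using fin
  proof (rule sum.mono_neutral_left)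
    show "big \<sigma> g1 g2 \<subseteq> big \<sigma> g g2"
      using super(2) by (fastforce simp: big_def)
  qed (auto simp: big_def trunc_def)
  moreover have "(\<Sum>c\<in>big \<sigma> g g2. trunc \<sigma> (class_dist c g g1) + trunc \<sigma> (class_dist c g1 g2)) \<le> wsum \<sigma> g g2"
    unfolding wsum_def using super s
    by (intro sum_mono trunc_superadditive) (auto simp: big_def)
  ultimately show ?thesis
    by (simp add: sum.distrib)
qed

section \<open>The distance in the class of a given coset\<close>

lemma span_star_cases:
  assumes "\<Lambda> \<subseteq> V" "z \<in> span (star \<Lambda>)"
  obtains l m where "l \<in> span \<Lambda>" "m \<in> span (link \<Lambda>)" "z = l \<cdot> m"
proof -
  have "z \<in> carrier GP" using assms star_subset span_closed by blast
  then obtain as bs where ab: "red (as @ bs)" "fst ` set as \<subseteq> \<Lambda>" "nofront \<Lambda> bs" "z = ev (as @ bs)"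
      "z = ev as \<cdot> ev bs"
    using proj_cases[OF assms(1)] by metis
  have "fst ` set bs \<subseteq> star \<Lambda>"
    using assms(2) ab red_in_span_iff[OF star_subset[OF assms(1)] ab(1)] by auto
  then have "fst ` set bs \<subseteq> link \<Lambda>"
    using ab(3)
  proof (induction bs)
    \<comment> \<open>The head is not in \<Lambda>, so it lies in the link. It commutes with
      \<Lambda> and blocks no letter of \<Lambda>, so none is free without it either.\<close>
    case (Cons x bs)
    then have x: "fst x \<in> link \<Lambda>" by (auto simp: star_def)
    then have "nofront \<Lambda> bs"
      using Cons.prems(2) link_eq[OF assms(1)] adj_commute by auto
    then show ?case using Cons x by auto
  qed simp
  then show ?thesis
    using that[of "ev as" "ev bs"] ab ev_in_span[OF assms(1)] ev_in_span[OF link_subset] red_words[OF ab(1)]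
    by auto
qed

lemma proj_link:
  assumes "\<Lambda> \<subseteq> V" "m \<in> span (link \<Lambda>)"
  shows "proj \<Lambda> m = \<one>\<^bsub>GP\<^esub>"
proof -
  obtain u where u: "red u" "ev u = m" "fst ` set u \<subseteq> link \<Lambda>"
    using span_red_cases[OF link_subset assms(2)] by blast
  then have "nofront \<Lambda> u"
    using front_in_set by (fastforce simp: link_def)
  then show ?thesis
    using proj_ev[OF assms(1), of "[]" u] u by simp
qed

lemma parallelD:
  assumes "((g <#\<^bsub>GP\<^esub> span \<Lambda>, \<Lambda>), (h <#\<^bsub>GP\<^esub> span \<Lambda>, \<Lambda>)) \<in> parallel" "g \<in> carrier GP" "h \<in> carrier GP"
  shows "ginv g \<cdot> h \<in> span (star \<Lambda>)"
proof -
  obtain g' h' where *: "g <#\<^bsub>GP\<^esub> span \<Lambda> = g' <#\<^bsub>GP\<^esub> span \<Lambda>" "h <#\<^bsub>GP\<^esub> span \<Lambda> = h' <#\<^bsub>GP\<^esub> span \<Lambda>"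
      "g' \<in> carrier GP" "h' \<in> carrier GP" "\<Lambda> \<in> subgraphs" "ginv g' \<cdot> h' \<in> span (star \<Lambda>)"
    using assms(1) unfolding parallel_def by auto
  have L: "\<Lambda> \<subseteq> V" using * subgraphs_subset by blast
  have self: "x \<in> x <#\<^bsub>GP\<^esub> span \<Lambda>" if "x \<in> carrier GP" for x
    using that by (auto simp: l_coset_def intro!: bexI[of _ "\<one>\<^bsub>GP\<^esub>"])
  obtain l where l: "l \<in> span \<Lambda>" "g = g' \<cdot> l"
    using self[OF assms(2)] unfolding *(1) by (auto simp: l_coset_def)
  obtain m where m: "m \<in> span \<Lambda>" "h = h' \<cdot> m"
    using self[OF assms(3)] unfolding *(2) by (auto simp: l_coset_def)
  have st: "l \<in> span (star \<Lambda>)" "m \<in> span (star \<Lambda>)"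
    using l m span_mono[of \<Lambda> "star \<Lambda>"] by (auto simp: star_def)
  have "ginv g \<cdot> h = ginv l \<cdot> (ginv g' \<cdot> h') \<cdot> m"
    using * l m L by (simp add: GPg.inv_mult_group GPg.m_assoc)
  then show ?thesis
    using * st star_subset[OF L] by (simp add: span_mult span_inv)
qed

text \<open>The chosen representative may be another parallel coset. Up to a factor \<open>l\<close>
  of \<open>span \<Lambda>\<close>, which drops out of distances, it differs by a factor
  \<open>m\<close> of the link group; \<open>m\<close> commutes with \<open>x\<close> and is removed
  by the projection.\<close>

lemma own_class:
  assumes "\<Lambda> \<in> subgraphs" "g \<in> carrier GP"
  obtains c where "c \<in> index_set" "\<And>x. x \<in> span \<Lambda> \<Longrightarrow> class_dist c g (g \<cdot> x) = nrm \<Lambda> x"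
proof -
  have L: "\<Lambda> \<subseteq> V" using assms subgraphs_subset by blast
  define q where "q = (g <#\<^bsub>GP\<^esub> span \<Lambda>, \<Lambda>)"
  define c where "c = parallel `` {q}"
  have q: "q \<in> labelled_cosets"
    using assms by (auto simp: q_def labelled_cosets_def)
  then have c: "c \<in> index_set"
    by (auto simp: c_def index_set_def quotient_def)
  have "q \<in> c"
    using q equiv_class_self[OF equiv_parallel] by (simp add: c_def)
  then have "(SOME p. p \<in> c) \<in> c" by (rule someI)
  then have par: "(q, (rep c <#\<^bsub>GP\<^esub> span (lab c), lab c)) \<in> parallel"
    unfolding index_set_rep(4)[OF c] by (simp add: c_def)
  then have lab: "lab c = \<Lambda>"
    by (auto simp: parallel_def q_def)
  define k where "k = rep c"
  have k: "k \<in> carrier GP" using index_set_rep(2)[OF c] by (simp add: k_def)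
  have "ginv g \<cdot> k \<in> span (star \<Lambda>)"
    using parallelD[of g \<Lambda> k] par assms k by (simp add: lab q_def k_def)
  then have "ginv (ginv g \<cdot> k) \<in> span (star \<Lambda>)"
    by (intro span_inv star_subset L)
  then have "ginv k \<cdot> g \<in> span (star \<Lambda>)"
    using assms k by (simp add: GPg.inv_mult_group)
  then obtain l m where lm: "l \<in> span \<Lambda>" "m \<in> span (link \<Lambda>)" "ginv k \<cdot> g = l \<cdot> m"
    using span_star_cases[OF L] by metis
  have cl: "l \<in> carrier GP" "m \<in> carrier GP"
    using lm L link_subset span_closed by blast+
  have proj: "proj \<Lambda> (l' \<cdot> m) = l'" if "l' \<in> span \<Lambda>" for l'
    using proj_span_mult[OF L that cl(2)] proj_link[OF L lm(2)] that L by simp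
  have "class_dist c g (g \<cdot> x) = nrm \<Lambda> x" if x: "x \<in> span \<Lambda>" for x
  proof -
    have xc: "x \<in> carrier GP" using x L by simp
    have comm: "m \<cdot> x = x \<cdot> m"
      by (rule span_commute[OF link_subset L _ lm(2) x]) (simp add: link_eq[OF L])
    have "ginv k \<cdot> (g \<cdot> x) = l \<cdot> m \<cdot> x"
      using lm(3) k assms xc by (simp flip: GPg.m_assoc)
    also have "\<dots> = l \<cdot> x \<cdot> m"
      using comm cl xc by (simp add: GPg.m_assoc)
    finally have "proj \<Lambda> (ginv k \<cdot> (g \<cdot> x)) = l \<cdot> x"
      using proj[of "l \<cdot> x"] lm(1) x span_mult[OF L] by simp
    then show ?thesis
      using class_dist_eq[OF c assms(2), of "g \<cdot> x"] assms xc lm(3) proj[OF lm(1)] cl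
      by (simp add: cdist_def lab k_def)
  qed
  then show ?thesis using that c by blast
qed

section \<open>Induction on subgraphs\<close>

lemma wsum_nonneg: "20 \<le> \<sigma> \<Longrightarrow> 0 \<le> wsum \<sigma> g h"
  unfolding wsum_def by (intro sum_nonneg trunc_nonneg)

lemma nrm_le_wsum:
  assumes "20 \<le> \<sigma>" "\<Lambda> \<in> subgraphs" "g \<in> carrier GP" "x \<in> span \<Lambda>"
  shows "real (nrm \<Lambda> x) \<le> 2 * wsum \<sigma> g (g \<cdot> x) + \<sigma>"
proof -
  obtain c where c: "c \<in> index_set" "class_dist c g (g \<cdot> x) = nrm \<Lambda> x"
    using own_class assms by metis
  have gx: "g \<cdot> x \<in> carrier GP"
    using assms(3) span_closed[OF subgraphs_subset[OF assms(2)] assms(4)] by simp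
  show ?thesis
  proof (cases "\<sigma> \<le> real (nrm \<Lambda> x)")
    \<comment> \<open>The class of the coset itself contributes the norm minus 2, and this is at
      least half of the norm.\<close>
    case True
    then have "c \<in> big \<sigma> g (g \<cdot> x)" using c by (simp add: big_def)
    then have "trunc \<sigma> (class_dist c g (g \<cdot> x)) \<le> wsum \<sigma> g (g \<cdot> x)"
      unfolding wsum_def using finite_big[OF assms(3) gx assms(1)] trunc_nonneg assms(1)
      by (intro member_le_sum) auto
    then show ?thesis
      using True c assms(1) by (simp add: trunc_def)
  next
    case False
    then show ?thesis using wsum_nonneg[OF assms(1), of g "g \<cdot> x"] by linarith
  qed
qed

text \<open>Each block starts where the previous ones end, hence a hypothesis for all base points.
  \<open>wsum_superadditive\<close> absorbs the sums of the blocks into one, so that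
  \<open>K\<close> is kept and only \<open>L\<close> accumulates.\<close>

lemma wlen_concat:
  assumes s: "20 \<le> \<sigma>" and K: "0 \<le> K"
    and bound: "\<And>g ys. g \<in> carrier GP \<Longrightarrow> ys \<in> set yss \<Longrightarrow> real (wlen (ev ys)) \<le> K * wsum \<sigma> g (g \<cdot> ev ys) + L"
    and red: "red (concat yss)" and g: "g \<in> carrier GP"
  shows "real (wlen (ev (concat yss))) \<le> K * wsum \<sigma> g (g \<cdot> ev (concat yss)) + real (length yss) * L"
  using bound red g
proof (induction yss arbitrary: g)
  case Nil
  then show ?case
    using wlen_le[of "[]"] wsum_nonneg[OF s] K by simp
next
  case (Cons ys yss)
  have w: "ys \<in> words" "concat yss \<in> words" and r: "red (concat yss)" "red (ys @ concat yss)"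
    using Cons.prems(2) red_words[OF Cons.prems(2)] by (auto simp: red_append)
  have g1: "g \<cdot> ev ys \<in> carrier GP" using Cons.prems(3) w by simp
  have "real (wlen (ev (concat (ys # yss)))) \<le> real (wlen (ev ys)) + real (wlen (ev (concat yss)))"
    using wlen_mult[of "ev ys" "ev (concat yss)"] w by (simp add: ev_append)
  also have "real (wlen (ev ys)) \<le> K * wsum \<sigma> g (g \<cdot> ev ys) + L"
    using Cons.prems by simp
  also have "real (wlen (ev (concat yss))) \<le>
      K * wsum \<sigma> (g \<cdot> ev ys) (g \<cdot> ev ys \<cdot> ev (concat yss)) + real (length yss) * L"
    using Cons.prems r g1 by (intro Cons.IH) auto
  also have "g \<cdot> ev ys \<cdot> ev (concat yss) = g \<cdot> ev (ys @ concat yss)"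
    using w Cons.prems(3) by (simp add: ev_append GPg.m_assoc)
  finally have "real (wlen (ev (concat (ys # yss)))) \<le>
      K * (wsum \<sigma> g (g \<cdot> ev ys) + wsum \<sigma> (g \<cdot> ev ys) (g \<cdot> ev (ys @ concat yss))) + (real (length yss) + 1) * L"
    by (simp add: algebra_simps)
  also have "K * (wsum \<sigma> g (g \<cdot> ev ys) + wsum \<sigma> (g \<cdot> ev ys) (g \<cdot> ev (ys @ concat yss)))
      \<le> K * wsum \<sigma> g (g \<cdot> ev (ys @ concat yss))"
    using wsum_superadditive[OF s Cons.prems(3) r(2)] K by (intro mult_left_mono)
  finally show ?case by (simp add: algebra_simps)
qed

text \<open>The constants may depend on \<sigma> and \<open>m\<close>, but not on \<open>g\<close>
  or \<open>x\<close>: the inductive step applies them to blocks that start at arbitrary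
  elements.\<close>

lemma wlen_le_wsum:
  assumes s: "20 \<le> \<sigma>"
  shows "\<exists>K L. 0 \<le> K \<and> 0 \<le> L \<and> (\<forall>\<Lambda>\<in>subgraphs. card \<Lambda> \<le> m \<longrightarrow>
    (\<forall>g\<in>carrier GP. \<forall>x\<in>span \<Lambda>. real (wlen x) \<le> K * wsum \<sigma> g (g \<cdot> x) + L))"
proof (induction m)
  case 0
  have "card \<Lambda> \<noteq> 0" if "\<Lambda> \<in> subgraphs" for \<Lambda>
    using that finite_subset[of \<Lambda> V] finite_V by (auto simp: subgraphs_def)
  then have "real (wlen x) \<le> 0 * wsum \<sigma> g (g \<cdot> x) + 0" if "\<Lambda> \<in> subgraphs" "card \<Lambda> \<le> 0" for \<Lambda> g x
    using that by (metis le_zero_eq)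
  then show ?case by (intro exI[of _ "0 :: real"] conjI order_refl) blast
next
  case (Suc m)
  then obtain K L where KL: "0 \<le> K" "0 \<le> L" and
    IH: "\<And>\<Lambda> g x. \<Lambda> \<in> subgraphs \<Longrightarrow> card \<Lambda> \<le> m \<Longrightarrow> g \<in> carrier GP \<Longrightarrow> x \<in> span \<Lambda> \<Longrightarrow>
      real (wlen x) \<le> K * wsum \<sigma> g (g \<cdot> x) + L"
    by blast
  have "real (wlen x) \<le> (K + 2 * (L + 1)) * wsum \<sigma> g (g \<cdot> x) + (L + 1) * \<sigma>"
    if \<Lambda>: "\<Lambda> \<in> subgraphs" "card \<Lambda> \<le> Suc m" and g: "g \<in> carrier GP" and x: "x \<in> span \<Lambda>" for \<Lambda> g x
  proof -
    have LV: "\<Lambda> \<subseteq> V" "finite \<Lambda>"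
      using \<Lambda> finite_V finite_subset by (auto simp: subgraphs_def)
    let ?W = "wsum \<sigma> g (g \<cdot> x)"
    have W: "0 \<le> ?W" by (rule wsum_nonneg[OF s])
    have N: "real (nrm \<Lambda> x) \<le> 2 * ?W + \<sigma>"
      by (rule nrm_le_wsum[OF s \<Lambda>(1) g x])
    \<comment> \<open>The factor \<open>L + 1\<close> serves both cases: over a single vertex the
      norm itself bounds the word length, otherwise each of \<open>nrm \<Lambda> x\<close> blocks
      costs an additive \<open>L\<close>.\<close>
    have "real (wlen x) \<le> K * ?W + real (nrm \<Lambda> x) * (L + 1)"
    proof (cases "\<exists>v. \<Lambda> = {v}")
      case True
      then have "real (wlen x) \<le> real (nrm \<Lambda> x)"
        using wlen_vertex x LV by auto
      moreover have "real (nrm \<Lambda> x) \<le> real (nrm \<Lambda> x) * (L + 1)"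
        using KL by (simp add: algebra_simps)
      moreover have "0 \<le> K * ?W" using KL W by simp
      ultimately show ?thesis by linarith
    next
      case False
      then obtain yss where yss: "length yss = nrm \<Lambda> x" "\<forall>ys\<in>set yss. fst ` set ys \<subset> \<Lambda>"
          "red (concat yss)" "ev (concat yss) = x"
        using pieces_decomposition[OF \<Lambda>(1) _ nrm_pieces[OF \<Lambda>(1) x]] by blast
      have "real (wlen (ev ys)) \<le> K * wsum \<sigma> h (h \<cdot> ev ys) + L"
        if h: "h \<in> carrier GP" and ys: "ys \<in> set yss" for h ys
      proof (cases "ys = []")
        \<comment> \<open>The empty block has empty support, which is no subgraph, so the induction
          hypothesis cannot be applied to it.\<close>
        case True
        then show ?thesis
          using wlen_le[of "[]"] wsum_nonneg[OF s] KL by simp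
      next
        case False
        have sub: "fst ` set ys \<subset> \<Lambda>" using yss ys by blast
        then have "fst ` set ys \<in> subgraphs"
          using False LV by (auto simp: subgraphs_def)
        moreover have "card (fst ` set ys) \<le> m"
          using psubset_card_mono[OF LV(2) sub] \<Lambda>(2) by simp
        moreover have "ys \<in> words"
          using red_words[OF yss(3)] split_list[OF ys] by auto
        then have "ev ys \<in> span (fst ` set ys)"
          using sub LV by (intro ev_in_span) auto
        ultimately show ?thesis using IH h by blast
      qed
      then have "real (wlen x) \<le> K * ?W + real (nrm \<Lambda> x) * L"
        using wlen_concat[OF s KL(1) _ yss(3) g] yss(1,4) by simp
      moreover have "real (nrm \<Lambda> x) * L \<le> real (nrm \<Lambda> x) * (L + 1)"
        by (intro mult_left_mono) auto
      ultimately show ?thesis by linarith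
    qed
    also have "real (nrm \<Lambda> x) * (L + 1) \<le> (2 * ?W + \<sigma>) * (L + 1)"
      using N KL by (intro mult_right_mono) auto
    finally show ?thesis by (simp add: algebra_simps)
  qed
  moreover have "0 \<le> K + 2 * (L + 1)" "0 \<le> (L + 1) * \<sigma>"
    using KL s by auto
  ultimately show ?case by blast
qed

lemma distance_formula:
  assumes s: "20 \<le> \<sigma>"
  shows "\<exists>K L :: real. K \<ge> 1 \<and> L \<ge> 0 \<and> (\<forall>g\<in>carrier GP. \<forall>h\<in>carrier GP.
    ereal (1 / K) * dist_sum \<sigma> g h - ereal L \<le> ereal (real (word_dist g h)) \<and>
    ereal (real (word_dist g h)) \<le> ereal K * dist_sum \<sigma> g h + ereal L)"
proof -
  have V: "V \<in> subgraphs" "V \<subseteq> V"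
    using V_nonempty by (auto simp: subgraphs_def)
  obtain K L where KL: "0 \<le> K" "0 \<le> L" and
    bound: "\<And>g x. g \<in> carrier GP \<Longrightarrow> x \<in> span V \<Longrightarrow> real (wlen x) \<le> K * wsum \<sigma> g (g \<cdot> x) + L"
    using wlen_le_wsum[OF s, of "card V"] V(1) by blast
  \<comment> \<open>One constant for both inequalities: \<open>K\<close> comes from the induction,
    the power of 2 from the number of labels and the factor 2 lost in
    \<open>sum_class_dist_le\<close>.\<close>
  define K' where "K' = K + 2 ^ (card V + 1)"
  have pow: "(1::real) \<le> 2 ^ (card V + 1)" by (rule one_le_power) simp
  have K': "1 \<le> K'" "K \<le> K'" "2 ^ (card V + 1) \<le> K'"
    using KL pow by (auto simp: K'_def)
  have "ereal (1 / K') * dist_sum \<sigma> g h - ereal (L + 1) \<le> ereal (real (word_dist g h)) \<and>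
    ereal (real (word_dist g h)) \<le> ereal K' * dist_sum \<sigma> g h + ereal (L + 1)"
    if g: "g \<in> carrier GP" and h: "h \<in> carrier GP" for g h
  proof -
    define D where "D = (\<Sum>c\<in>big \<sigma> g h. real (class_dist c g h))"
    have D0: "0 \<le> D" by (simp add: D_def sum_nonneg)
    have "D \<le> 2 ^ (card V + 1) * (real (word_dist g h) + 1)"
      unfolding D_def by (rule dist_sum_le_word_dist[OF g h s])
    also have "\<dots> \<le> K' * (real (word_dist g h) + 1)"
      using K' by (intro mult_right_mono) auto
    finally have "D / K' \<le> real (word_dist g h) + 1"
      using K' by (simp add: field_simps)
    then have lower: "1 / K' * D - (L + 1) \<le> real (word_dist g h)"
      using KL by simp
    have "ginv g \<cdot> h \<in> span V"
    proof -
      have "ginv g \<cdot> h \<in> carrier GP" using g h by simp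
      then obtain u where "u \<in> words" "ginv g \<cdot> h = ev u"
        unfolding carrier_GP by blast
      then show ?thesis
        using ev_in_span[OF V(2) _ words_vertices] by simp
    qed
    then have "real (word_dist g h) \<le> K * wsum \<sigma> g h + L"
      using bound[OF g, of "ginv g \<cdot> h"] g h by (simp add: word_dist_eq)
    also have "wsum \<sigma> g h \<le> D"
      unfolding wsum_def D_def by (intro sum_mono) (simp add: trunc_def)
    then have "K * wsum \<sigma> g h \<le> K' * D"
      using K' KL D0 by (intro mult_mono) (auto simp: wsum_nonneg[OF s])
    finally have "real (word_dist g h) \<le> K' * D + (L + 1)" by simp
    then show ?thesis
      using lower dist_sum_eq[OF g h s] by (simp add: D_def[symmetric])
  qed
  then show ?thesis
    using K'(1) KL by (intro exI[of _ K'] exI[of _ "L + 1"]) auto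
qed

end

theorem corollary4p23:
  fixes V :: "'v set"
    and E :: "'v set set"
    and G :: "'v \<Rightarrow> ('a, 'b) monoid_scheme"
    and S :: "'v \<Rightarrow> 'a set"
  assumes "graph_product V E G S"
  shows "\<exists>\<sigma>\<^sub>0::real. \<sigma>\<^sub>0 > 0 \<and> (\<forall>\<sigma>::real. \<sigma> \<ge> \<sigma>\<^sub>0 \<longrightarrow>
    (\<exists>K L :: real. K \<ge> 1 \<and> L \<ge> 0 \<and>
      (\<forall>g \<in> carrier (graph_product.GP V E G). \<forall>h \<in> carrier (graph_product.GP V E G).
         ereal (1 / K) * graph_product.dist_sum V E G S \<sigma> g h - ereal L
           \<le> ereal (real (graph_product.word_dist V E G S g h)) \<and>
         ereal (real (graph_product.word_dist V E G S g h))
           \<le> ereal K * graph_product.dist_sum V E G S \<sigma> g h + ereal L)))"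
proof (rule exI[of _ 20], intro conjI allI impI)
  show "(0::real) < 20" by simp
  fix \<sigma> :: real
  assume "20 \<le> \<sigma>"
  then show "\<exists>K L :: real. K \<ge> 1 \<and> L \<ge> 0 \<and>
      (\<forall>g \<in> carrier (graph_product.GP V E G). \<forall>h \<in> carrier (graph_product.GP V E G).
         ereal (1 / K) * graph_product.dist_sum V E G S \<sigma> g h - ereal L
           \<le> ereal (real (graph_product.word_dist V E G S g h)) \<and>
         ereal (real (graph_product.word_dist V E G S g h))
           \<le> ereal K * graph_product.dist_sum V E G S \<sigma> g h + ereal L)"
    by (rule graph_product.distance_formula[OF assms])
qed

end
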